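(* Let $R$ be a ring with right Krull dimension, and let $N$ be its prime radical. Suppose that one of the following two conditions holds: (A) $R/N$ satisfies left ACC-reg; (B) $R/P$ satisfies left ACC-reg for every minimal prime ideal $P$ of $R$. If the maximal right ideals of $R$ are (all) principal, then $\mathrm{r.K.dim}(R) \leq 1$. In particular, a (left and right) noetherian ring whose maximal right ideals are principal has right Krull dimension at most $1$.
   Context: Rings are associative with identity. A ring satisfies left ACC-reg if it satisfies the ascending chain condition on left ideals of the form $Rs$ where $s \in R$ is a regular element (i.e. neither a left nor a right zero-divisor). The prime radical is the intersection of all prime ideals. Krull dimension here is the Gabriel–Rentschler Krull dimension: $\mathcal{K}_{-1}$ is the class consisting of the zero module; for an ordinal $\alpha \ge 0$, $\mathcal{K}_\alpha$ is the class of modules $M$ such that for every descending chain $M_0 \supseteq M_1 \supseteq \cdots$ of submodules of $M$, $M_i/M_{i+1} \in \bigcup_{\beta<\alpha}\mathcal{K}_\beta$ for all but finitely many $i$; $\mathrm{K.dim}(M)$ is the least $\alpha$ (where $-1$ counts as an ordinal) with $M \in \mathcal{K}_\alpha$, if it exists. $\mathrm{r.K.dim}(R) := \mathrm{K.dim}(R_R)$, and $R$ "has right Krull dimension" if this exists. *)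

theory Defs
  imports "HOL-Algebra.Module" "HOL-Algebra.QuotRing" "HOL-Algebra.Ideal_Product"
    "HOL-Library.Option_ord"
begin

section \<open>Right modules\<close>

text \<open>
  HOL-Algebra's locale \<open>module\<close> requires a commutative scalar ring, so right modules over an
  arbitrary ring are introduced here on the same record type. The right action is written with
  the scalar first: \<open>a \<odot> x\<close> stands for the product of \<open>x\<close> by \<open>a\<close> on the right, whence the order
  of the factors in \<open>smult_assoc\<close>. The library's predicate \<open>submodule\<close> needs no commutativity
  and is independent of the side. The fields \<open>mult\<close> and \<open>one\<close> of a module record are irrelevant.
\<close>

locale right_module = R?: ring R + M?: abelian_group M
  for R :: "('a, 'b) ring_scheme" (structure) and M :: "('a, 'm) module" (structure) +
  assumes smult_closed:
      "\<lbrakk>a \<in> carrier R; x \<in> carrier M\<rbrakk> \<Longrightarrow> a \<odot>\<^bsub>M\<^esub> x \<in> carrier M"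
    and smult_l_distr:
      "\<lbrakk>a \<in> carrier R; b \<in> carrier R; x \<in> carrier M\<rbrakk> \<Longrightarrow>
        (a \<oplus>\<^bsub>R\<^esub> b) \<odot>\<^bsub>M\<^esub> x = a \<odot>\<^bsub>M\<^esub> x \<oplus>\<^bsub>M\<^esub> b \<odot>\<^bsub>M\<^esub> x"
    and smult_r_distr:
      "\<lbrakk>a \<in> carrier R; x \<in> carrier M; y \<in> carrier M\<rbrakk> \<Longrightarrow>
        a \<odot>\<^bsub>M\<^esub> (x \<oplus>\<^bsub>M\<^esub> y) = a \<odot>\<^bsub>M\<^esub> x \<oplus>\<^bsub>M\<^esub> a \<odot>\<^bsub>M\<^esub> y"
    and smult_assoc:
      "\<lbrakk>a \<in> carrier R; b \<in> carrier R; x \<in> carrier M\<rbrakk> \<Longrightarrow>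
        (a \<otimes>\<^bsub>R\<^esub> b) \<odot>\<^bsub>M\<^esub> x = b \<odot>\<^bsub>M\<^esub> (a \<odot>\<^bsub>M\<^esub> x)"
    and smult_one:
      "x \<in> carrier M \<Longrightarrow> \<one>\<^bsub>R\<^esub> \<odot>\<^bsub>M\<^esub> x = x"

definition right_regular_module :: "('a, 'b) ring_scheme \<Rightarrow> ('a, 'a) module" where
  "right_regular_module R =
    \<lparr>carrier = carrier R, mult = mult R, one = one R, zero = zero R, add = add R,
     smult = (\<lambda>a x. x \<otimes>\<^bsub>R\<^esub> a)\<rparr>"

definition quotient_module :: "('a, 'm) module \<Rightarrow> 'm set \<Rightarrow> ('a, 'm set) module" where
  "quotient_module M B =
    \<lparr>carrier = a_rcosets\<^bsub>M\<^esub> B, mult = (\<lambda>_ _. B), one = B, zero = B, add = set_add M,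
     smult = (\<lambda>a X. \<Union>x\<in>X. B +>\<^bsub>M\<^esub> (a \<odot>\<^bsub>M\<^esub> x))\<rparr>"

definition module_iso ::
  "('a, 'b) ring_scheme \<Rightarrow> ('a, 'm) module \<Rightarrow> ('a, 'n) module \<Rightarrow> bool" where
  "module_iso R M N \<longleftrightarrow>
    (\<exists>h. bij_betw h (carrier M) (carrier N) \<and>
         (\<forall>x\<in>carrier M. \<forall>y\<in>carrier M. h (x \<oplus>\<^bsub>M\<^esub> y) = h x \<oplus>\<^bsub>N\<^esub> h y) \<and>
         (\<forall>a\<in>carrier R. \<forall>x\<in>carrier M. h (a \<odot>\<^bsub>M\<^esub> x) = a \<odot>\<^bsub>N\<^esub> h x))"

lemma (in ring) right_regular_module_is_right_module:
  "right_module R (right_regular_module R)"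
proof -
  have "abelian_group (right_regular_module R)"
  proof (rule abelian_groupI)
    fix x assume "x \<in> carrier (right_regular_module R)"
    then show "\<exists>y\<in>carrier (right_regular_module R).
        y \<oplus>\<^bsub>right_regular_module R\<^esub> x = \<zero>\<^bsub>right_regular_module R\<^esub>"
      by (auto simp: right_regular_module_def intro!: bexI[of _ "\<ominus> x"] l_neg)
  qed (auto simp: right_regular_module_def a_ac)
  then show ?thesis
    by (intro right_module.intro right_module_axioms.intro ring_axioms)
      (auto simp: right_regular_module_def l_distr r_distr m_assoc)
qed

lemma (in right_module) submodule_is_right_module:
  assumes "submodule A R M"
  shows "right_module R (M\<lparr>carrier := A\<rparr>)"
proof -
  interpret A: submodule A R M by fact
  have sub: "x \<in> carrier M" if "x \<in> A" for x
    using A.subset that by auto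
  have add: "x \<oplus>\<^bsub>M\<^esub> y \<in> A" if "x \<in> A" "y \<in> A" for x y
    using A.m_closed that by auto
  have zero: "\<zero>\<^bsub>M\<^esub> \<in> A"
    using A.one_closed by auto
  have inv: "\<ominus>\<^bsub>M\<^esub> x \<in> A" if "x \<in> A" for x
    using A.m_inv_closed that by (auto simp: a_inv_def)
  have "abelian_group (M\<lparr>carrier := A\<rparr>)"
  proof (rule abelian_groupI)
    fix x assume "x \<in> carrier (M\<lparr>carrier := A\<rparr>)"
    then show "\<exists>y\<in>carrier (M\<lparr>carrier := A\<rparr>).
        y \<oplus>\<^bsub>M\<lparr>carrier := A\<rparr>\<^esub> x = \<zero>\<^bsub>M\<lparr>carrier := A\<rparr>\<^esub>"
      using inv sub by (auto intro!: bexI[of _ "\<ominus>\<^bsub>M\<^esub> x"] M.l_neg)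
  qed (auto simp: add zero sub M.a_ac)
  then show ?thesis
    by (intro right_module.intro right_module_axioms.intro R.ring_axioms)
      (auto simp: sub smult_l_distr smult_r_distr smult_assoc smult_one)
qed

lemma (in right_module) quotient_module_is_right_module:
  assumes "submodule B R M"
  shows "right_module R (quotient_module M B)"
proof -
  interpret B: submodule B R M by fact
  have Bsub: "B \<subseteq> carrier M" using B.subset by simp
  have abB: "abelian_subgroup B M"
    by (rule abelian_subgroupI3)
      (auto intro: additive_subgroup.intro B.subgroup_axioms M.abelian_group_axioms)
  interpret B': abelian_subgroup B M by (rule abB)
  let ?c = "\<lambda>x. B +>\<^bsub>M\<^esub> x"
  let ?Q = "quotient_module M B"
  have car: "carrier ?Q = ?c ` carrier M"
    by (auto simp: quotient_module_def A_RCOSETS_def')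
  have add: "?c x \<oplus>\<^bsub>?Q\<^esub> ?c y = ?c (x \<oplus>\<^bsub>M\<^esub> y)" if "x \<in> carrier M" "y \<in> carrier M" for x y
    using that by (simp add: quotient_module_def B'.a_rcos_sum)
  have zero: "\<zero>\<^bsub>?Q\<^esub> = ?c \<zero>\<^bsub>M\<^esub>"
    using Bsub by (simp add: quotient_module_def)
  have smult: "a \<odot>\<^bsub>?Q\<^esub> ?c x = ?c (a \<odot>\<^bsub>M\<^esub> x)" if a: "a \<in> carrier R" and x: "x \<in> carrier M" for a x
  proof -
    have "?c (a \<odot>\<^bsub>M\<^esub> y) = ?c (a \<odot>\<^bsub>M\<^esub> x)" if y: "y \<in> ?c x" for y
    proof -
      obtain b where b: "b \<in> B" "y = b \<oplus>\<^bsub>M\<^esub> x"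
        using y by (auto simp: a_r_coset_def')
      have "a \<odot>\<^bsub>M\<^esub> y = a \<odot>\<^bsub>M\<^esub> b \<oplus>\<^bsub>M\<^esub> a \<odot>\<^bsub>M\<^esub> x"
        using b a x Bsub by (auto simp: smult_r_distr)
      moreover have "a \<odot>\<^bsub>M\<^esub> b \<in> B"
        using b a by (rule_tac B.smult_closed)
      ultimately have "a \<odot>\<^bsub>M\<^esub> y \<in> ?c (a \<odot>\<^bsub>M\<^esub> x)"
        by (auto simp: a_r_coset_def')
      then show ?thesis
        using M.a_repr_independence[OF _ smult_closed[OF a x] B.subgroup_axioms] by simp
    qed
    moreover have "x \<in> ?c x"
      using x B'.a_rcos_self by blast
    ultimately have "(\<Union>y\<in>?c x. ?c (a \<odot>\<^bsub>M\<^esub> y)) = ?c (a \<odot>\<^bsub>M\<^esub> x)"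
      by blast
    then show ?thesis by (simp add: quotient_module_def)
  qed
  have "abelian_group ?Q"
  proof (rule abelian_groupI)
    fix X assume "X \<in> carrier ?Q"
    then obtain x where x: "x \<in> carrier M" "X = ?c x" by (auto simp: car)
    then have "?c (\<ominus>\<^bsub>M\<^esub> x) \<oplus>\<^bsub>?Q\<^esub> X = \<zero>\<^bsub>?Q\<^esub>" by (simp add: add zero M.l_neg)
    then show "\<exists>Y\<in>carrier ?Q. Y \<oplus>\<^bsub>?Q\<^esub> X = \<zero>\<^bsub>?Q\<^esub>" using x by (auto simp: car)
  qed (auto simp: car add zero M.a_ac)
  then show ?thesis
    by (intro right_module.intro right_module_axioms.intro R.ring_axioms)
      (auto simp: car add smult smult_closed smult_l_distr smult_r_distr smult_assoc smult_one)
qed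

lemma (in right_module) quotient_module_copy:
  assumes "submodule B R M"
  shows "\<exists>Q :: ('a, 'm) module. right_module R Q \<and> module_iso R Q (quotient_module M B)"
proof -
  let ?N = "quotient_module M B"
  interpret N: right_module R ?N
    using assms by (rule quotient_module_is_right_module)
  have "B \<subseteq> carrier M" "\<zero>\<^bsub>M\<^esub> \<in> B"
    using submodule.axioms(1)[OF assms] subgroup.subset subgroup.one_closed by fastforce+
  then have ne: "X \<noteq> {}" if "X \<in> carrier ?N" for X
    using that by (auto simp: quotient_module_def A_RCOSETS_def' a_r_coset_def')
  define rep where "rep = (\<lambda>X :: 'm set. SOME x. x \<in> X)"
  have rep_in: "rep X \<in> X" if "X \<in> carrier ?N" for X
    using ne[OF that] by (auto simp: rep_def some_in_eq)
  have disj: "X = Y" if "X \<in> carrier ?N" "Y \<in> carrier ?N" "x \<in> X" "x \<in> Y" for X Y x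
  proof -
    have "X \<in> rcosets\<^bsub>add_monoid M\<^esub> B" "Y \<in> rcosets\<^bsub>add_monoid M\<^esub> B"
      using that by (auto simp: quotient_module_def A_RCOSETS_def)
    then show ?thesis
      using group.rcos_disjoint[OF M.a_group submodule.axioms(1)[OF assms]] that
      by (auto simp: pairwise_def disjnt_def)
  qed
  have inj: "inj_on rep (carrier ?N)"
    by (rule inj_onI) (metis disj rep_in)
  define h where "h = the_inv_into (carrier ?N) rep"
  define Q :: "('a, 'm) module" where
    "Q = \<lparr>carrier = rep ` carrier ?N, mult = (\<lambda>_ _. undefined), one = undefined,
          zero = rep \<zero>\<^bsub>?N\<^esub>, add = (\<lambda>x y. rep (h x \<oplus>\<^bsub>?N\<^esub> h y)),
          smult = (\<lambda>a x. rep (a \<odot>\<^bsub>?N\<^esub> h x))\<rparr>"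
  have h: "h (rep X) = X" if "X \<in> carrier ?N" for X
    using inj that by (simp add: h_def the_inv_into_f_f)
  have "abelian_group Q"
  proof (rule abelian_groupI)
    fix x assume "x \<in> carrier Q"
    then obtain X where X: "X \<in> carrier ?N" "x = rep X" by (auto simp: Q_def)
    then have "rep (\<ominus>\<^bsub>?N\<^esub> X) \<oplus>\<^bsub>Q\<^esub> x = \<zero>\<^bsub>Q\<^esub>" by (simp add: Q_def h N.M.l_neg)
    then show "\<exists>y\<in>carrier Q. y \<oplus>\<^bsub>Q\<^esub> x = \<zero>\<^bsub>Q\<^esub>" using X by (auto simp: Q_def)
  qed (auto simp: Q_def h N.M.a_ac)
  then have "right_module R Q"
    by (intro right_module.intro right_module_axioms.intro R.ring_axioms)
      (auto simp: Q_def h N.smult_closed N.smult_l_distr N.smult_r_distr N.smult_assoc N.smult_one)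
  moreover have "bij_betw h (carrier Q) (carrier ?N)"
    using inj by (auto simp: h_def Q_def intro: bij_betw_the_inv_into inj_on_imp_bij_betw)
  then have "module_iso R Q ?N"
    unfolding module_iso_def
    by (intro exI[of _ h]) (auto simp: Q_def h N.smult_closed)
  ultimately show ?thesis by blast
qed


section \<open>Krull dimension\<close>

text \<open>
  Ordinals are the elements of a well-ordered type \<open>'o\<close>, and \<open>-1\<close> is adjoined below them as
  \<open>None\<close>: the order of \<open>'o option\<close> is again a well-order, with least element \<open>None\<close>. An element
  of \<open>'o\<close> represents the ordinal that is the order type of its initial segment; in particular
  \<open>0\<close> and \<open>1\<close> of type \<open>nat\<close> represent the ordinals 0 and 1. As no type contains all ordinals,
  the existence of a Krull dimension is formulated relative to \<open>'o\<close>, and is to be used as a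
  hypothesis with \<open>'o\<close> an arbitrary type variable.

  The class of index \<open>\<alpha>\<close> consists of the modules on a fixed type \<open>'m\<close>. The factor
  \<open>C i / C (i + 1)\<close> is a module on \<open>'m set\<close>, hence the passage to an isomorphic module \<open>Q\<close>
  on \<open>'m\<close>; such a \<open>Q\<close> always exists, see \<open>quotient_module_copy\<close> above.
\<close>

definition descending_chain ::
  "('a, 'b) ring_scheme \<Rightarrow> ('a, 'm) module \<Rightarrow> (nat \<Rightarrow> 'm set) \<Rightarrow> bool" where
  "descending_chain R M C \<longleftrightarrow> (\<forall>i. submodule (C i) R M \<and> C (Suc i) \<subseteq> C i)"

declare conj_cong [fundef_cong]

function krull_class ::
  "('a, 'b) ring_scheme \<Rightarrow> 'o::wellorder option \<Rightarrow> ('a, 'm) module \<Rightarrow> bool" where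
  "krull_class R None M \<longleftrightarrow> right_module R M \<and> carrier M = {\<zero>\<^bsub>M\<^esub>}"
| "krull_class R (Some \<alpha>) M \<longleftrightarrow> right_module R M \<and>
    (\<forall>C. descending_chain R M C \<longrightarrow>
      finite {i. \<not> (\<exists>\<beta> Q. \<beta> < Some \<alpha> \<and>
        module_iso R Q (quotient_module (M\<lparr>carrier := C i\<rparr>) (C (Suc i))) \<and>
        krull_class R \<beta> Q)})"
  by pat_completeness auto
termination
  by (relation "inv_image {(x, y). x < y} (\<lambda>(R, \<alpha>, M). \<alpha>)")
    (simp_all add: wf)

definition has_krull_dim ::
  "'o::wellorder itself \<Rightarrow> ('a, 'b) ring_scheme \<Rightarrow> ('a, 'm) module \<Rightarrow> bool" where
  "has_krull_dim TYPE('o) R M \<longleftrightarrow> (\<exists>\<alpha> :: 'o option. krull_class R \<alpha> M)"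

definition krull_dim ::
  "('a, 'b) ring_scheme \<Rightarrow> ('a, 'm) module \<Rightarrow> 'o::wellorder option" where
  "krull_dim R M = (LEAST \<alpha>. krull_class R \<alpha> M)"

definition has_right_krull_dim ::
  "'o::wellorder itself \<Rightarrow> ('a, 'b) ring_scheme \<Rightarrow> bool" where
  "has_right_krull_dim TYPE('o) R \<longleftrightarrow> has_krull_dim TYPE('o) R (right_regular_module R)"

definition right_krull_dim :: "('a, 'b) ring_scheme \<Rightarrow> 'o::wellorder option" where
  "right_krull_dim R = krull_dim R (right_regular_module R)"


section \<open>Prime ideals and the prime radical\<close>

text \<open>
  The library's \<open>primeideal\<close> is the elementwise notion and presupposes commutativity. The zero
  ring has no prime ideals, and its prime radical, an empty intersection, is the whole ring.
\<close>

definition prime_ideal :: "('a, 'b) ring_scheme \<Rightarrow> 'a set \<Rightarrow> bool" where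
  "prime_ideal R P \<longleftrightarrow> ideal P R \<and> P \<noteq> carrier R \<and>
    (\<forall>I J. ideal I R \<longrightarrow> ideal J R \<longrightarrow> I \<cdot>\<^bsub>R\<^esub> J \<subseteq> P \<longrightarrow> I \<subseteq> P \<or> J \<subseteq> P)"

definition minimal_prime_ideal :: "('a, 'b) ring_scheme \<Rightarrow> 'a set \<Rightarrow> bool" where
  "minimal_prime_ideal R P \<longleftrightarrow> prime_ideal R P \<and> (\<forall>Q. prime_ideal R Q \<longrightarrow> Q \<subseteq> P \<longrightarrow> Q = P)"

definition prime_radical :: "('a, 'b) ring_scheme \<Rightarrow> 'a set" where
  "prime_radical R = {x \<in> carrier R. \<forall>P. prime_ideal R P \<longrightarrow> x \<in> P}"


section \<open>Conditions on one-sided ideals\<close>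

definition right_ideal :: "('a, 'b) ring_scheme \<Rightarrow> 'a set \<Rightarrow> bool" where
  "right_ideal R I \<longleftrightarrow> additive_subgroup I R \<and> (\<forall>x\<in>I. \<forall>r\<in>carrier R. x \<otimes>\<^bsub>R\<^esub> r \<in> I)"

definition left_ideal :: "('a, 'b) ring_scheme \<Rightarrow> 'a set \<Rightarrow> bool" where
  "left_ideal R I \<longleftrightarrow> additive_subgroup I R \<and> (\<forall>x\<in>I. \<forall>r\<in>carrier R. r \<otimes>\<^bsub>R\<^esub> x \<in> I)"

definition maximal_right_ideal :: "('a, 'b) ring_scheme \<Rightarrow> 'a set \<Rightarrow> bool" where
  "maximal_right_ideal R I \<longleftrightarrow> right_ideal R I \<and> I \<noteq> carrier R \<and>
    (\<forall>J. right_ideal R J \<longrightarrow> I \<subseteq> J \<longrightarrow> J = I \<or> J = carrier R)"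

definition principal_right_ideal :: "('a, 'b) ring_scheme \<Rightarrow> 'a set \<Rightarrow> bool" where
  "principal_right_ideal R I \<longleftrightarrow> (\<exists>a\<in>carrier R. I = {a \<otimes>\<^bsub>R\<^esub> r | r. r \<in> carrier R})"

definition regular_element :: "('a, 'b) ring_scheme \<Rightarrow> 'a \<Rightarrow> bool" where
  "regular_element R s \<longleftrightarrow> s \<in> carrier R \<and>
    (\<forall>x\<in>carrier R. s \<otimes>\<^bsub>R\<^esub> x = \<zero>\<^bsub>R\<^esub> \<longrightarrow> x = \<zero>\<^bsub>R\<^esub>) \<and>
    (\<forall>x\<in>carrier R. x \<otimes>\<^bsub>R\<^esub> s = \<zero>\<^bsub>R\<^esub> \<longrightarrow> x = \<zero>\<^bsub>R\<^esub>)"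

definition satisfies_acc :: "('a set \<Rightarrow> bool) \<Rightarrow> bool" where
  "satisfies_acc F \<longleftrightarrow>
    (\<forall>C :: nat \<Rightarrow> 'a set. (\<forall>i. F (C i) \<and> C i \<subseteq> C (Suc i)) \<longrightarrow> (\<exists>n. \<forall>m\<ge>n. C m = C n))"

definition left_acc_reg :: "('a, 'b) ring_scheme \<Rightarrow> bool" where
  "left_acc_reg R \<longleftrightarrow>
    satisfies_acc (\<lambda>I. \<exists>s. regular_element R s \<and> I = {r \<otimes>\<^bsub>R\<^esub> s | r. r \<in> carrier R})"

definition left_right_noetherian :: "('a, 'b) ring_scheme \<Rightarrow> bool" where
  "left_right_noetherian R \<longleftrightarrow> satisfies_acc (left_ideal R) \<and> satisfies_acc (right_ideal R)"

end

(*
  Only one consequence of right Krull dimension is used: there is no densely ordered chain of right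
  ideals. Let N be the prime radical. As R/N is semiprime, this yields Goldie's theorem for it:
  every essential right ideal contains a regular element c. If c is not a unit modulo N, then
  c = a t, where a generates a maximal right ideal containing N and a, t are again regular modulo N;
  the left ideals generated by c, t, ... increase modulo N strictly, so by ACC-reg the process ends,
  and every essential right ideal contains a product c of generators of maximal right ideals.
  Hence (R/N)/E has finite length for E essential, and N = cN. The latter makes N^(k+1) finitely
  generated modulo N^(k+2) by elements of N^k, and since there is no nonzero idempotent ideal in the
  Jacobson radical, Zorn's lemma shows that N is nilpotent. A descending chain in N^k/N^(k+1) has
  essential inclusions from some point on, whose factors are locally of finite length, hence
  artinian.
*)
theory Submission
  imports Defs "HOL-Library.Infinite_Set"
begin

text \<open>No argument is moved to the ring R/N: its right ideals are treated as right ideals of R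
  that contain N, its elements as elements of R, and only the ACC conditions mention a quotient
  ring. Each appeal to right Krull dimension exhibits a relation \<open>\<Phi> A B\<close> that
  reproduces itself: some right ideal between A and B satisfies it with both. Most appeals pass
  through one such family, which shows that no infinite sequence is independent modulo a right
  ideal. Two obstacles shape the proof. Under condition (B) the factors of a regular element are
  controlled only modulo minimal primes; an annihilator ideal of R/N that lies in infinitely many of
  the maximal right ideals is therefore enlarged until it is prime, and then it is minimal. For
  nilpotency, N need not be finitely generated, so the ideals containing no power of N are not
  obviously closed under unions of chains; finite generation of N^(k+1) modulo N^(k+2) is the
  substitute.\<close>

section \<open>Right ideals\<close>

context ring
begin

lemma right_idealI:
  assumes "A \<subseteq> carrier R" "\<zero> \<in> A" "\<And>x y. \<lbrakk>x \<in> A; y \<in> A\<rbrakk> \<Longrightarrow> x \<oplus> y \<in> A"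
    and mult: "\<And>x r. \<lbrakk>x \<in> A; r \<in> carrier R\<rbrakk> \<Longrightarrow> x \<otimes> r \<in> A"
  shows "right_ideal R A"
proof -
  have "\<ominus> x \<in> A" if "x \<in> A" for x
    using mult[OF that, of "\<ominus> \<one>"] that assms(1) by (auto simp: r_minus)
  then have "subgroup A (add_monoid R)"
    using assms by (intro add.subgroupI) (auto simp: a_inv_def)
  then show ?thesis
    unfolding right_ideal_def using mult by (auto intro: additive_subgroup.intro)
qed

lemma right_ideal_closed:
  assumes "right_ideal R A"
  shows right_ideal_subset: "A \<subseteq> carrier R"
    and right_ideal_carr: "x \<in> A \<Longrightarrow> x \<in> carrier R"
    and right_ideal_zero: "\<zero> \<in> A"
    and right_ideal_add: "\<lbrakk>x \<in> A; y \<in> A\<rbrakk> \<Longrightarrow> x \<oplus> y \<in> A"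
    and right_ideal_mult: "\<lbrakk>x \<in> A; r \<in> carrier R\<rbrakk> \<Longrightarrow> x \<otimes> r \<in> A"
    and right_ideal_uminus: "x \<in> A \<Longrightarrow> \<ominus> x \<in> A"
    and right_ideal_minus: "\<lbrakk>x \<in> A; y \<in> A\<rbrakk> \<Longrightarrow> x \<ominus> y \<in> A"
proof -
  interpret additive_subgroup A R using assms by (simp add: right_ideal_def)
  show "A \<subseteq> carrier R" by (rule a_subset)
  show "x \<in> A \<Longrightarrow> x \<in> carrier R" by (rule a_Hcarr)
  show "\<zero> \<in> A" by (rule zero_closed)
  show "\<lbrakk>x \<in> A; y \<in> A\<rbrakk> \<Longrightarrow> x \<oplus> y \<in> A" by (rule a_closed)
  show "\<lbrakk>x \<in> A; r \<in> carrier R\<rbrakk> \<Longrightarrow> x \<otimes> r \<in> A"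
    using assms by (auto simp: right_ideal_def)
  show m: "x \<in> A \<Longrightarrow> \<ominus> x \<in> A" for x
    by (rule a_inv_closed)
  show "\<lbrakk>x \<in> A; y \<in> A\<rbrakk> \<Longrightarrow> x \<ominus> y \<in> A"
    unfolding minus_eq by (intro a_closed m)
qed

lemma ideal_right_ideal: "ideal I R \<Longrightarrow> right_ideal R I"
  by (simp add: right_ideal_def ideal.axioms(1) ideal.I_r_closed)

lemma idealI':
  assumes "right_ideal R I" "\<And>x r. \<lbrakk>x \<in> I; r \<in> carrier R\<rbrakk> \<Longrightarrow> r \<otimes> x \<in> I"
  shows "ideal I R"
  using assms by (auto intro!: idealI simp: ring_axioms right_ideal_def additive_subgroup_def)

lemma right_ideal_carrier: "right_ideal R (carrier R)"
  by (rule ideal_right_ideal) (rule oneideal)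

lemma right_ideal_Int: "\<lbrakk>right_ideal R A; right_ideal R B\<rbrakk> \<Longrightarrow> right_ideal R (A \<inter> B)"
  by (rule right_idealI)
    (auto simp: right_ideal_zero right_ideal_add right_ideal_mult dest: right_ideal_carr)

lemma right_ideal_Inter:
  "\<lbrakk>\<And>A. A \<in> S \<Longrightarrow> right_ideal R A; S \<noteq> {}\<rbrakk> \<Longrightarrow> right_ideal R (\<Inter>S)"
  by (rule right_idealI)
    (auto simp: right_ideal_zero right_ideal_add right_ideal_mult dest: right_ideal_carr)

lemma right_ideal_colon:
  assumes "right_ideal R A" "y \<in> carrier R"
  shows "right_ideal R {r \<in> carrier R. y \<otimes> r \<in> A}"
  using assms
  by (intro right_idealI)
    (auto simp: r_distr m_assoc[symmetric] right_ideal_zero right_ideal_add right_ideal_mult)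

lemma right_ideal_colon_in:
  assumes "right_ideal R A" "right_ideal R B" "y \<in> carrier R"
  shows "right_ideal R {b \<in> B. y \<otimes> b \<in> A}"
proof -
  have "{b \<in> B. y \<otimes> b \<in> A} = B \<inter> {r \<in> carrier R. y \<otimes> r \<in> A}"
    using assms(2) by (auto dest: right_ideal_carr)
  then show ?thesis
    using right_ideal_Int[OF assms(2) right_ideal_colon[OF assms(1,3)]] by simp
qed

lemma right_ideal_image:
  assumes "right_ideal R A" "y \<in> carrier R"
  shows "right_ideal R ((\<lambda>x. y \<otimes> x) ` A)"
proof (rule right_idealI)
  show "(\<lambda>x. y \<otimes> x) ` A \<subseteq> carrier R"
    using assms by (auto dest: right_ideal_carr)
  show "\<zero> \<in> (\<lambda>x. y \<otimes> x) ` A"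
    using assms right_ideal_zero[OF assms(1)] by (auto intro!: image_eqI[of _ _ \<zero>])
next
  fix u v assume "u \<in> (\<lambda>x. y \<otimes> x) ` A" "v \<in> (\<lambda>x. y \<otimes> x) ` A"
  then obtain a b where "a \<in> A" "b \<in> A" "u = y \<otimes> a" "v = y \<otimes> b" by auto
  then show "u \<oplus> v \<in> (\<lambda>x. y \<otimes> x) ` A"
    using right_ideal_add[OF assms(1)] right_ideal_carr[OF assms(1)] assms(2)
    by (intro image_eqI[of _ _ "a \<oplus> b"]) (auto simp: r_distr)
next
  fix u r assume "u \<in> (\<lambda>x. y \<otimes> x) ` A" and r: "r \<in> carrier R"
  then obtain a where "a \<in> A" "u = y \<otimes> a" by auto
  then show "u \<otimes> r \<in> (\<lambda>x. y \<otimes> x) ` A"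
    using right_ideal_mult[OF assms(1)] right_ideal_carr[OF assms(1)] assms(2) r
    by (intro image_eqI[of _ _ "a \<otimes> r"]) (auto simp: m_assoc)
qed

lemma right_ideal_chain_Union:
  assumes "\<And>A. A \<in> \<C> \<Longrightarrow> right_ideal R A" "\<C> \<noteq> {}" "subset.chain \<A> \<C>"
  shows "right_ideal R (\<Union>\<C>)"
proof (rule right_idealI)
  show "\<Union>\<C> \<subseteq> carrier R" using assms(1) right_ideal_subset by blast
  show "\<zero> \<in> \<Union>\<C>" using assms(1,2) right_ideal_zero by blast
  show "x \<otimes> r \<in> \<Union>\<C>" if "x \<in> \<Union>\<C>" "r \<in> carrier R" for x r
    using that assms(1) right_ideal_mult by blast
  fix x y assume "x \<in> \<Union>\<C>" "y \<in> \<Union>\<C>"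
  then obtain A B where AB: "A \<in> \<C>" "x \<in> A" "B \<in> \<C>" "y \<in> B" by auto
  then have "A \<subseteq> B \<or> B \<subseteq> A" using assms(3) by (auto simp: subset.chain_def)
  then show "x \<oplus> y \<in> \<Union>\<C>"
    using AB assms(1) right_ideal_add by blast
qed

section \<open>Right ideals generated by a set\<close>

definition rgen :: "'a set \<Rightarrow> 'a set" where
  "rgen X = \<Inter>{I. right_ideal R I \<and> X \<subseteq> I}"

lemma rgen_right_ideal: "X \<subseteq> carrier R \<Longrightarrow> right_ideal R (rgen X)"
  unfolding rgen_def using right_ideal_carrier by (intro right_ideal_Inter) auto

lemma rgen_incl: "X \<subseteq> rgen X"
  by (auto simp: rgen_def)

lemma rgen_least: "\<lbrakk>right_ideal R I; X \<subseteq> I\<rbrakk> \<Longrightarrow> rgen X \<subseteq> I"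
  by (auto simp: rgen_def)

lemma rgen_mono: "X \<subseteq> Y \<Longrightarrow> rgen X \<subseteq> rgen Y"
  by (auto simp: rgen_def)

lemma rgen_eq: "right_ideal R A \<Longrightarrow> rgen A = A"
  by (simp add: rgen_incl rgen_least subset_antisym)

lemma rgen_Un:
  assumes A: "right_ideal R A" and B: "right_ideal R B"
  shows "rgen (A \<union> B) = {a \<oplus> b | a b. a \<in> A \<and> b \<in> B}" (is "_ = ?S")
proof
  have "right_ideal R ?S"
  proof (rule right_idealI)
    show "?S \<subseteq> carrier R" using A B by (auto dest: right_ideal_carr)
    show "\<zero> \<in> ?S" using right_ideal_zero[OF A] right_ideal_zero[OF B] by force
  next
    fix x y assume "x \<in> ?S" "y \<in> ?S"
    then obtain a b c d where *: "a \<in> A" "b \<in> B" "c \<in> A" "d \<in> B" "x = a \<oplus> b" "y = c \<oplus> d"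
      by auto
    then have "x \<oplus> y = (a \<oplus> c) \<oplus> (b \<oplus> d)"
      using A B by (simp add: right_ideal_carr a_ac)
    then show "x \<oplus> y \<in> ?S" using * A B right_ideal_add by blast
  next
    fix x r assume "x \<in> ?S" and r: "r \<in> carrier R"
    then obtain a b where *: "a \<in> A" "b \<in> B" "x = a \<oplus> b" by auto
    then have "x \<otimes> r = a \<otimes> r \<oplus> b \<otimes> r"
      using A B r by (simp add: right_ideal_carr l_distr)
    then show "x \<otimes> r \<in> ?S" using * A B r right_ideal_mult by blast
  qed
  moreover have "A \<union> B \<subseteq> ?S"
  proof
    fix x assume "x \<in> A \<union> B"
    moreover have "x = x \<oplus> \<zero>" "x = \<zero> \<oplus> x" if "x \<in> carrier R" using that by auto
    ultimately show "x \<in> ?S"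
      using right_ideal_zero[OF A] right_ideal_zero[OF B] right_ideal_carr[OF A] right_ideal_carr[OF B]
      by blast
  qed
  ultimately show "rgen (A \<union> B) \<subseteq> ?S" by (rule rgen_least)
  have "right_ideal R (rgen (A \<union> B))"
    using A B by (intro rgen_right_ideal) (auto dest: right_ideal_carr)
  then show "?S \<subseteq> rgen (A \<union> B)"
    using rgen_incl[of "A \<union> B"] right_ideal_add by blast
qed

lemma right_ideal_principal: "a \<in> carrier R \<Longrightarrow> right_ideal R {a \<otimes> r | r. r \<in> carrier R}"
  using right_ideal_image[OF right_ideal_carrier, of a] by (simp add: image_def conj_commute Bex_def)

lemma rgen_insert:
  assumes X: "X \<subseteq> carrier R" and x: "x \<in> carrier R"
  shows "rgen (insert x X) = {u \<oplus> x \<otimes> r | u r. u \<in> rgen X \<and> r \<in> carrier R}" (is "_ = ?S")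
proof -
  let ?P = "{x \<otimes> r | r. r \<in> carrier R}"
  have P: "right_ideal R ?P" by (rule right_ideal_principal) (rule x)
  have X': "right_ideal R (rgen X)" by (rule rgen_right_ideal) (rule X)
  have x1: "x \<in> ?P" using x r_one[of x] one_closed by (metis (mono_tags, lifting) mem_Collect_eq)
  have "rgen (insert x X) = rgen (rgen X \<union> ?P)"
  proof
    show "rgen (insert x X) \<subseteq> rgen (rgen X \<union> ?P)"
      using rgen_incl[of X] x1 by (intro rgen_mono) auto
    have I: "right_ideal R (rgen (insert x X))" using X x by (intro rgen_right_ideal) auto
    moreover have "rgen X \<subseteq> rgen (insert x X)" by (rule rgen_mono) auto
    moreover have "?P \<subseteq> rgen (insert x X)"
      using rgen_incl[of "insert x X"] right_ideal_mult[OF I] by blast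
    ultimately show "rgen (rgen X \<union> ?P) \<subseteq> rgen (insert x X)" by (intro rgen_least) auto
  qed
  also have "\<dots> = ?S" unfolding rgen_Un[OF X' P] by blast
  finally show ?thesis .
qed

text \<open>The right ideals \<open>rgen (A \<union> F)\<close> with \<open>F\<close> a finite
  subset of \<open>X\<close> form a directed family, so their union is itself a right ideal and
  contains all generators.\<close>

lemma rgen_finite_support:
  assumes "A \<subseteq> carrier R" "X \<subseteq> carrier R" "y \<in> rgen (A \<union> X)"
  shows "\<exists>F. finite F \<and> F \<subseteq> X \<and> y \<in> rgen (A \<union> F)"
proof -
  let ?U = "{y. \<exists>F. finite F \<and> F \<subseteq> X \<and> y \<in> rgen (A \<union> F)}"
  have ri: "right_ideal R (rgen (A \<union> F))" if "F \<subseteq> X" for F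
    using that assms by (intro rgen_right_ideal) auto
  have "right_ideal R ?U"
  proof (rule right_idealI)
    show "?U \<subseteq> carrier R" using ri right_ideal_carr by blast
    show "\<zero> \<in> ?U" using ri[of "{}"] right_ideal_zero by blast
  next
    fix x y assume "x \<in> ?U" "y \<in> ?U"
    then obtain F G where *: "finite F" "F \<subseteq> X" "x \<in> rgen (A \<union> F)" "finite G" "G \<subseteq> X"
      "y \<in> rgen (A \<union> G)" by auto
    moreover have "rgen (A \<union> F) \<subseteq> rgen (A \<union> (F \<union> G))" "rgen (A \<union> G) \<subseteq> rgen (A \<union> (F \<union> G))"
      by (rule rgen_mono, blast)+
    ultimately have "x \<oplus> y \<in> rgen (A \<union> (F \<union> G))"
      using ri[of "F \<union> G"] right_ideal_add by blast
    then show "x \<oplus> y \<in> ?U" using * by blast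
  next
    fix x r assume "x \<in> ?U" "r \<in> carrier R"
    then show "x \<otimes> r \<in> ?U" using ri right_ideal_mult by blast
  qed
  moreover have "A \<union> X \<subseteq> ?U"
  proof
    fix x assume "x \<in> A \<union> X"
    then show "x \<in> ?U"
    proof
      assume "x \<in> A" then show ?thesis using rgen_incl[of "A \<union> {}"] by blast
    next
      assume "x \<in> X" then show ?thesis using rgen_incl[of "A \<union> {x}"] by blast
    qed
  qed
  ultimately have "rgen (A \<union> X) \<subseteq> ?U" by (rule rgen_least)
  then show ?thesis using assms by blast
qed

section \<open>Zorn's lemma and maximal right ideals\<close>

lemma Zorn_right_ideal:
  assumes A0: "right_ideal R A0" "P A0"
    and finite_char: "\<And>\<C>. \<lbrakk>\<C> \<noteq> {}; subset.chain {A. right_ideal R A \<and> A0 \<subseteq> A \<and> P A} \<C>\<rbrakk> \<Longrightarrow> P (\<Union>\<C>)"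
  obtains M where "right_ideal R M" "A0 \<subseteq> M" "P M"
    "\<And>A. \<lbrakk>right_ideal R A; M \<subseteq> A; P A\<rbrakk> \<Longrightarrow> A = M"
proof -
  let ?F = "{A. right_ideal R A \<and> A0 \<subseteq> A \<and> P A}"
  have "\<exists>M\<in>?F. \<forall>X\<in>?F. M \<subseteq> X \<longrightarrow> X = M"
  proof (rule subset_Zorn_nonempty)
    show "?F \<noteq> {}" using A0 by blast
    fix \<C> assume C: "\<C> \<noteq> {}" "subset.chain ?F \<C>"
    then have sub: "\<C> \<subseteq> ?F" by (simp add: subset.chain_def)
    have "right_ideal R (\<Union>\<C>)"
      by (rule right_ideal_chain_Union[OF _ C]) (use sub in auto)
    moreover have "A0 \<subseteq> \<Union>\<C>" using C(1) sub by blast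
    ultimately show "\<Union>\<C> \<in> ?F" using finite_char[OF C] by blast
  qed
  then obtain M where M: "M \<in> ?F" "\<forall>X\<in>?F. M \<subseteq> X \<longrightarrow> X = M" by blast
  show ?thesis
  proof (rule that[of M])
    show "A = M" if "right_ideal R A" "M \<subseteq> A" "P A" for A
      using M that by (metis (mono_tags, lifting) mem_Collect_eq subset_trans)
  qed (use M in auto)
qed

text \<open>A finite \<open>F\<close> lies in the union of a chain only if it lies in one member, so
  the right ideals that omit part of \<open>F\<close> are closed under unions of chains. Between
  \<open>A\<close> and \<open>rgen (A \<union> F)\<close>, omitting part of \<open>F\<close> is the
  same as being proper.\<close>

lemma maximal_subideal:
  assumes A: "right_ideal R A" and F: "finite F" "F \<subseteq> carrier R" "\<not> F \<subseteq> A"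
  obtains M where "right_ideal R M" "A \<subseteq> M" "M \<subseteq> rgen (A \<union> F)" "M \<noteq> rgen (A \<union> F)"
    "\<And>J. \<lbrakk>right_ideal R J; M \<subseteq> J; J \<subseteq> rgen (A \<union> F)\<rbrakk> \<Longrightarrow> J = M \<or> J = rgen (A \<union> F)"
proof -
  let ?B = "rgen (A \<union> F)"
  have B: "right_ideal R ?B"
    using A F by (intro rgen_right_ideal) (auto dest: right_ideal_carr)
  have eqB: "J = ?B" if "right_ideal R J" "A \<subseteq> J" "F \<subseteq> J" "J \<subseteq> ?B" for J
    using rgen_least[OF that(1), of "A \<union> F"] that by blast
  have chain: "\<Union>\<C> \<subseteq> ?B \<and> \<not> F \<subseteq> \<Union>\<C>" if C: "\<C> \<noteq> {}"
    "subset.chain {J. right_ideal R J \<and> A \<subseteq> J \<and> J \<subseteq> ?B \<and> \<not> F \<subseteq> J} \<C>" for \<C>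
  proof -
    have sub: "\<C> \<subseteq> {J. right_ideal R J \<and> A \<subseteq> J \<and> J \<subseteq> ?B \<and> \<not> F \<subseteq> J}"
      using C(2) by (simp add: subset.chain_def)
    have "\<not> F \<subseteq> \<Union>\<C>"
    proof
      assume "F \<subseteq> \<Union>\<C>"
      then obtain J where "J \<in> \<C>" "F \<subseteq> J"
        using finite_subset_Union_chain[OF F(1) _ C] by blast
      then show False using sub by blast
    qed
    then show ?thesis using sub by blast
  qed
  have "A \<subseteq> ?B \<and> \<not> F \<subseteq> A" using F rgen_incl[of "A \<union> F"] by auto
  then obtain M where M: "right_ideal R M" "A \<subseteq> M" "M \<subseteq> ?B \<and> \<not> F \<subseteq> M"
    "\<And>J. \<lbrakk>right_ideal R J; M \<subseteq> J; J \<subseteq> ?B \<and> \<not> F \<subseteq> J\<rbrakk> \<Longrightarrow> J = M"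
    using Zorn_right_ideal[OF A, of "\<lambda>M. M \<subseteq> ?B \<and> \<not> F \<subseteq> M", OF _ chain] by blast
  show ?thesis
  proof (rule that[OF M(1,2)])
    show "M \<subseteq> ?B" using M(3) by blast
    show "M \<noteq> ?B" using M(3) rgen_incl[of "A \<union> F"] by blast
    fix J assume J: "right_ideal R J" "M \<subseteq> J" "J \<subseteq> ?B"
    show "J = M \<or> J = ?B"
      using M(4)[OF J(1,2)] J(3) eqB[OF J(1) _ _ J(3)] M(2) J(2) by blast
  qed
qed

text \<open>This is \<open>maximal_subideal\<close> with \<open>F = {\<one>}\<close>, since 1
  generates the whole ring.\<close>

lemma exists_maximal_right_ideal:
  assumes A: "right_ideal R A" "A \<noteq> carrier R"
  obtains M where "maximal_right_ideal R M" "A \<subseteq> M"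
proof -
  have "\<one> \<notin> A"
    using A right_ideal_mult[OF A(1), of \<one>] right_ideal_subset[OF A(1)] by auto
  have "right_ideal R (rgen (A \<union> {\<one>}))"
    using A by (intro rgen_right_ideal) (auto dest: right_ideal_carr)
  moreover have "\<one> \<in> rgen (A \<union> {\<one>})" using rgen_incl[of "A \<union> {\<one>}"] by auto
  ultimately have eq: "rgen (A \<union> {\<one>}) = carrier R"
    using right_ideal_mult[of "rgen (A \<union> {\<one>})" \<one>] right_ideal_subset by force
  show ?thesis
  proof (rule maximal_subideal[OF A(1), of "{\<one>}"])
    fix M assume M: "right_ideal R M" "A \<subseteq> M" "M \<subseteq> rgen (A \<union> {\<one>})"
      "M \<noteq> rgen (A \<union> {\<one>})"
      "\<And>J. \<lbrakk>right_ideal R J; M \<subseteq> J; J \<subseteq> rgen (A \<union> {\<one>})\<rbrakk>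
        \<Longrightarrow> J = M \<or> J = rgen (A \<union> {\<one>})"
    have "maximal_right_ideal R M"
      unfolding maximal_right_ideal_def
      using M(1,3,4,5) right_ideal_subset unfolding eq by blast
    then show thesis using that M by blast
  qed (use \<open>\<one> \<notin> A\<close> in auto)
qed

end


section \<open>Rings with deviation\<close>

text \<open>
  Every module with Krull dimension and every noetherian module has this property. It amounts to
  the absence of a densely ordered chain of right ideals.
\<close>

definition has_deviation :: "('a, 'b) ring_scheme \<Rightarrow> bool" where
  "has_deviation R \<longleftrightarrow> (\<forall>\<Phi>.
    (\<forall>A B. \<Phi> A B \<longrightarrow> right_ideal R A \<and> right_ideal R B \<and> A \<subset> B \<and> (\<exists>C. \<Phi> A C \<and> \<Phi> C B)) \<longrightarrow>
    (\<forall>A B. \<not> \<Phi> A B))"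

locale deviation_ring = ring R for R :: "('a, 'b) ring_scheme" (structure) +
  assumes has_deviation: "has_deviation R"
begin

lemma no_dense_family:
  assumes "\<Phi> A B"
    and "\<And>A B. \<Phi> A B \<Longrightarrow> right_ideal R A \<and> right_ideal R B"
    and "\<And>A B. \<Phi> A B \<Longrightarrow> A \<subseteq> B \<and> A \<noteq> B"
    and "\<And>A B. \<Phi> A B \<Longrightarrow> \<exists>C. \<Phi> A C \<and> \<Phi> C B"
  shows False
proof -
  have "\<forall>A B. \<Phi> A B \<longrightarrow> right_ideal R A \<and> right_ideal R B \<and> A \<subset> B \<and> (\<exists>C. \<Phi> A C \<and> \<Phi> C B)"
    using assms(2,3,4) by (simp add: psubset_eq)
  then show False
    using has_deviation[unfolded has_deviation_def, THEN spec, THEN mp] assms(1) by blast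
qed

text \<open>Independence modulo \<open>A\<close> is demanded in a weak form: every nonempty finite
  set of indices has one index whose term meets the span of the others only in \<open>A\<close>.
  This covers terms independent of all later ones, where the index is the minimum, and terms
  independent of all earlier ones, where it is the maximum. Full independence follows, so sets of
  indices embed into the right ideals above \<open>A\<close>, and the subsets of an infinite set
  contain a dense family.\<close>

lemma no_independent_sequence:
  fixes x :: "nat \<Rightarrow> 'a"
  assumes A: "right_ideal R A" and x: "\<And>n. x n \<in> carrier R" "\<And>n. x n \<notin> A"
    and extremal: "\<And>K. \<lbrakk>finite K; K \<noteq> {}\<rbrakk> \<Longrightarrow>
      \<exists>k\<in>K. \<forall>r\<in>carrier R. x k \<otimes> r \<in> rgen (A \<union> x ` (K - {k})) \<longrightarrow> x k \<otimes> r \<in> A"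
  shows False
proof -
  have gen: "right_ideal R (rgen (A \<union> x ` I))" for I
    using A x by (intro rgen_right_ideal) (auto dest: right_ideal_carr)
  have indep: "x j \<otimes> r \<in> A"
    if "finite K" "j \<in> K" "r \<in> carrier R" "x j \<otimes> r \<in> rgen (A \<union> x ` (K - {j}))" for K j r
    using that
  proof (induction "card K" arbitrary: K)
    case 0
    then show ?case by auto
  next
    case (Suc n)
    obtain k where k: "k \<in> K"
      "\<forall>r\<in>carrier R. x k \<otimes> r \<in> rgen (A \<union> x ` (K - {k})) \<longrightarrow> x k \<otimes> r \<in> A"
      using extremal[of K] Suc.prems by blast
    show ?case
    proof (cases "k = j")
      case True
      then show ?thesis using k Suc.prems by blast
    next
      case False
      let ?L = "K - {k}"
      have "A \<union> x ` (K - {j}) = insert (x k) (A \<union> x ` (?L - {j}))"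
        using k False by auto
      then obtain u s where us: "u \<in> rgen (A \<union> x ` (?L - {j}))" "s \<in> carrier R"
        "x j \<otimes> r = u \<oplus> x k \<otimes> s"
        using Suc.prems(4) rgen_insert[of "A \<union> x ` (?L - {j})" "x k"] A x right_ideal_carr
        by (auto simp: image_subset_iff subset_iff)
      have uc: "u \<in> carrier R" using us(1) gen right_ideal_carr by blast
      have "x k \<otimes> s = x j \<otimes> r \<ominus> u"
        using us uc x Suc.prems(3) by (simp add: minus_eq a_ac r_neg2)
      moreover have "x j \<otimes> r \<in> rgen (A \<union> x ` ?L)"
        using rgen_incl[of "A \<union> x ` ?L"] Suc.prems(2,3) False right_ideal_mult[OF gen] by blast
      moreover have "u \<in> rgen (A \<union> x ` ?L)"
        using us(1) rgen_mono[of "A \<union> x ` (?L - {j})" "A \<union> x ` ?L"] by blast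
      ultimately have "x k \<otimes> s \<in> rgen (A \<union> x ` ?L)"
        using right_ideal_minus[OF gen] by simp
      then have "x k \<otimes> s \<in> A" using k us by blast
      then have "x k \<otimes> s \<in> rgen (A \<union> x ` (?L - {j}))"
        using rgen_incl by blast
      then have "x j \<otimes> r \<in> rgen (A \<union> x ` (?L - {j}))"
        using us right_ideal_add[OF gen] by simp
      then show ?thesis
        using Suc.hyps(1)[of ?L] Suc.hyps(2) Suc.prems(1,2,3) k(1) False by simp
    qed
  qed
  have notin: "x j \<notin> rgen (A \<union> x ` I)" if "j \<notin> I" for j I
  proof
    assume "x j \<in> rgen (A \<union> x ` I)"
    then obtain F where F: "finite F" "F \<subseteq> x ` I" "x j \<in> rgen (A \<union> F)"
      using rgen_finite_support[of A "x ` I" "x j"] A x right_ideal_subset by blast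
    then obtain I0 where I0: "finite I0" "I0 \<subseteq> I" "F = x ` I0"
      by (meson finite_subset_image)
    have "insert j I0 - {j} = I0" using I0 that by blast
    then have "x j \<otimes> \<one> \<in> A"
      using I0 F(3) x by (intro indep[of "insert j I0"]) auto
    then show False using x by simp
  qed
  \<comment> \<open>An infinite difference splits into two infinite ones, which makes the family
    dense.\<close>
  define \<Phi> where "\<Phi> = (\<lambda>C D. \<exists>I J. I \<subseteq> J \<and> infinite (J - I) \<and>
    C = rgen (A \<union> x ` I) \<and> D = rgen (A \<union> x ` J))"
  show False
  proof (rule no_dense_family[of \<Phi>])
    show "\<Phi> (rgen (A \<union> x ` {})) (rgen (A \<union> x ` UNIV))"
      unfolding \<Phi>_def by (intro exI[of _ "{}"] exI[of _ UNIV]) simp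
  next
    fix C D assume "\<Phi> C D"
    then obtain I J where IJ: "I \<subseteq> J" "infinite (J - I)"
      "C = rgen (A \<union> x ` I)" "D = rgen (A \<union> x ` J)"
      unfolding \<Phi>_def by blast
    show "right_ideal R C \<and> right_ideal R D" using IJ gen by blast
    obtain j where j: "j \<in> J - I" using infinite_imp_nonempty[OF IJ(2)] by blast
    have "x j \<in> D" using j IJ(4) rgen_incl[of "A \<union> x ` J"] by auto
    moreover have "x j \<notin> C" using j IJ(3) notin by blast
    moreover have "C \<subseteq> D" unfolding IJ(3,4) using IJ(1) by (intro rgen_mono) auto
    ultimately show "C \<subseteq> D \<and> C \<noteq> D" by blast
    obtain f :: "nat \<Rightarrow> nat" where f: "inj f" "range f \<subseteq> J - I"
      using infinite_countable_subset[OF IJ(2)] by blast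
    \<comment> \<open>Even and odd arguments of \<open>f\<close> leave infinitely many indices on
      either side of the cut.\<close>
    define S where "S = range (\<lambda>n. f (2 * n))"
    have "inj (\<lambda>n. f (2 * n))" "inj (\<lambda>n. f (Suc (2 * n)))"
      by (rule injI, drule injD[OF f(1)], simp)+
    then have inf: "infinite S" "infinite (range (\<lambda>n. f (Suc (2 * n))))"
      unfolding S_def by (auto dest: finite_imageD)
    have "f (Suc (2 * n)) \<notin> S" for n
    proof
      assume "f (Suc (2 * n)) \<in> S"
      then obtain m where "f (Suc (2 * n)) = f (2 * m)" by (auto simp: S_def)
      then have "Suc (2 * n) = 2 * m" by (rule injD[OF f(1)])
      then show False by presburger
    qed
    then have "range (\<lambda>n. f (Suc (2 * n))) \<subseteq> (J - I) - S" using f(2) by blast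
    then have "infinite ((J - I) - S)" using inf(2) infinite_super by blast
    moreover have "S \<subseteq> J - I" using f(2) by (auto simp: S_def)
    ultimately have S: "S \<subseteq> J - I" "infinite S" "infinite ((J - I) - S)"
      using inf(1) by auto
    show "\<exists>E. \<Phi> C E \<and> \<Phi> E D"
    proof (intro exI conjI)
      show "\<Phi> C (rgen (A \<union> x ` (I \<union> S)))"
        unfolding \<Phi>_def
      proof (intro exI conjI)
        have "(I \<union> S) - I = S" using S(1) by blast
        then show "infinite ((I \<union> S) - I)" using S(2) by simp
      qed (use IJ in auto)
      show "\<Phi> (rgen (A \<union> x ` (I \<union> S))) D"
        unfolding \<Phi>_def
      proof (intro exI conjI)
        have "J - (I \<union> S) = (J - I) - S" by blast
        then show "infinite (J - (I \<union> S))" using S(3) by simp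
        show "I \<union> S \<subseteq> J" using S(1) IJ(1) by blast
      qed (use IJ in auto)
    qed
  qed
qed

text \<open>The witness \<open>y i\<close> shows that \<open>D (Suc i)\<close> is not essential in
  \<open>D i\<close> modulo \<open>A\<close>, and all later witnesses lie in
  \<open>D (Suc i)\<close>. Each witness is thus independent of the later ones, the minimum case of
  \<open>no_independent_sequence\<close>. In applications this shows that a descending chain has
  essential inclusions from some point on.\<close>

lemma descending_chain_essential:
  fixes D :: "nat \<Rightarrow> 'a set"
  assumes A: "right_ideal R A" and D: "\<And>i. right_ideal R (D i)" "\<And>i. A \<subseteq> D i" "\<And>i. D (Suc i) \<subseteq> D i"
    and y: "\<And>i. y i \<in> D i" "\<And>i. y i \<notin> A"
    and disjoint: "\<And>i r. \<lbrakk>r \<in> carrier R; y i \<otimes> r \<in> D (Suc i)\<rbrakk> \<Longrightarrow> y i \<otimes> r \<in> A"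
  shows False
proof (rule no_independent_sequence[OF A, of y])
  show "y n \<in> carrier R" for n using y D right_ideal_carr by blast
  show "y n \<notin> A" for n by (rule y)
  fix K :: "nat set" assume K: "finite K" "K \<noteq> {}"
  let ?k = "Min K"
  have anti: "D j \<subseteq> D i" if "i \<le> j" for i j
    using lift_Suc_antimono_le[of D, OF _ that] D(3) by blast
  have "y i \<in> D (Suc ?k)" if i: "i \<in> K - {?k}" for i
  proof -
    have "Suc ?k \<le> i" using i K Min_le[of K i] by (metis DiffE Suc_leI insertCI order_less_le)
    then show ?thesis using anti y by blast
  qed
  then have "rgen (A \<union> y ` (K - {?k})) \<subseteq> D (Suc ?k)"
    using D by (intro rgen_least) auto
  then show "\<exists>k\<in>K. \<forall>r\<in>carrier R. y k \<otimes> r \<in> rgen (A \<union> y ` (K - {k})) \<longrightarrow> y k \<otimes> r \<in> A"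
    using disjoint K by (intro bexI[of _ ?k]) (auto intro: Min_in)
qed

text \<open>If no finite \<open>F\<close> worked, each would leave an element \<open>f F\<close>
  whose multiples meet \<open>rgen (A \<union> F)\<close> only in \<open>A\<close>. Adjoining these
  one after another gives terms independent of the earlier ones, the maximum case of
  \<open>no_independent_sequence\<close>.\<close>

lemma finite_essential:
  assumes A: "right_ideal R A" and B: "right_ideal R B"
  obtains F where "finite F" "F \<subseteq> B"
    "\<And>x. \<lbrakk>x \<in> B; x \<notin> A\<rbrakk> \<Longrightarrow> \<exists>r\<in>carrier R. x \<otimes> r \<in> rgen (A \<union> F) \<and> x \<otimes> r \<notin> A"
proof (rule ccontr)
  assume contr: "\<not> thesis"
  note result = that
  have "\<exists>x. x \<in> B \<and> x \<notin> A \<and> (\<forall>r\<in>carrier R. x \<otimes> r \<in> rgen (A \<union> F) \<longrightarrow> x \<otimes> r \<in> A)"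
    if "finite F" "F \<subseteq> B" for F
    using contr result[OF that] by blast
  then obtain f where f: "\<And>F. \<lbrakk>finite F; F \<subseteq> B\<rbrakk> \<Longrightarrow> f F \<in> B \<and> f F \<notin> A \<and>
      (\<forall>r\<in>carrier R. f F \<otimes> r \<in> rgen (A \<union> F) \<longrightarrow> f F \<otimes> r \<in> A)"
    by metis
  define S where "S = rec_nat {} (\<lambda>_ T. insert (f T) T)"
  have S: "S 0 = {}" "S (Suc n) = insert (f (S n)) (S n)" for n
    by (simp_all add: S_def)
  have fin: "finite (S n) \<and> S n \<subseteq> B" for n
    by (induction n) (auto simp: S f)
  then have fS: "f (S n) \<in> B \<and> f (S n) \<notin> A \<and>
      (\<forall>r\<in>carrier R. f (S n) \<otimes> r \<in> rgen (A \<union> S n) \<longrightarrow> f (S n) \<otimes> r \<in> A)" for n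
    by (simp add: f)
  have Sn: "S n = (\<lambda>i. f (S i)) ` {..<n}" for n
    by (induction n) (auto simp: S lessThan_Suc)
  show False
  proof (rule no_independent_sequence[OF A, of "\<lambda>n. f (S n)"])
    show "f (S n) \<in> carrier R" "f (S n) \<notin> A" for n
      using fS[of n] right_ideal_carr[OF B] by auto
    fix K :: "nat set" assume K: "finite K" "K \<noteq> {}"
    let ?k = "Max K"
    have "K - {?k} \<subseteq> {..<?k}"
      using K by (auto simp: order_less_le)
    then have "rgen (A \<union> (\<lambda>n. f (S n)) ` (K - {?k})) \<subseteq> rgen (A \<union> S ?k)"
      unfolding Sn[of ?k] by (intro rgen_mono) blast
    then show "\<exists>k\<in>K. \<forall>r\<in>carrier R.
        f (S k) \<otimes> r \<in> rgen (A \<union> (\<lambda>n. f (S n)) ` (K - {k})) \<longrightarrow> f (S k) \<otimes> r \<in> A"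
      using fS[of ?k] K by (intro bexI[of _ ?k]) (auto intro: Max_in)
  qed
qed

end

section \<open>Regularity and essentiality modulo an ideal\<close>

context ring
begin

lemma rgen_insert_right_ideal:
  assumes "right_ideal R A" "x \<in> carrier R"
  shows "rgen (insert x A) = {u \<oplus> x \<otimes> r | u r. u \<in> A \<and> r \<in> carrier R}"
  using rgen_insert[of A x] assms by (simp add: rgen_eq right_ideal_subset)

lemma right_ideal_rgen_insert:
  "\<lbrakk>right_ideal R A; x \<in> carrier R\<rbrakk> \<Longrightarrow> right_ideal R (rgen (insert x A))"
  by (rule rgen_right_ideal) (simp add: right_ideal_subset)

lemma rgen_insert_self: "A \<subseteq> rgen (insert x A)" "x \<in> rgen (insert x A)"
  using rgen_incl[of "insert x A"] by auto

lemma ideal_right_left: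
  assumes "ideal I R"
  shows ideal_l: "\<lbrakk>x \<in> I; r \<in> carrier R\<rbrakk> \<Longrightarrow> r \<otimes> x \<in> I"
    and ideal_r: "\<lbrakk>x \<in> I; r \<in> carrier R\<rbrakk> \<Longrightarrow> x \<otimes> r \<in> I"
  using assms by (simp_all add: ideal.I_l_closed ideal.I_r_closed)

lemma right_ideal_add_cancel:
  assumes "right_ideal R A" "x \<in> carrier R" "y \<in> A"
  shows "x \<oplus> y \<in> A \<longleftrightarrow> x \<in> A" "y \<oplus> x \<in> A \<longleftrightarrow> x \<in> A"
proof -
  have y: "y \<in> carrier R" using assms right_ideal_carr by blast
  have "x = (x \<oplus> y) \<ominus> y" using assms(2) y by (simp add: minus_eq a_assoc r_neg)
  then show 1: "x \<oplus> y \<in> A \<longleftrightarrow> x \<in> A"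
    using right_ideal_minus[OF assms(1) _ assms(3), of "x \<oplus> y"] right_ideal_add[OF assms(1) _ assms(3)]
    by metis
  then show "y \<oplus> x \<in> A \<longleftrightarrow> x \<in> A" using a_comm[OF assms(2) y] by simp
qed

definition regular_mod :: "'a set \<Rightarrow> 'a \<Rightarrow> bool" where
  "regular_mod I s \<longleftrightarrow> s \<in> carrier R \<and> (\<forall>x\<in>carrier R. s \<otimes> x \<in> I \<longrightarrow> x \<in> I) \<and>
    (\<forall>x\<in>carrier R. x \<otimes> s \<in> I \<longrightarrow> x \<in> I)"

text \<open>E/I is essential in R/I as a right module. Testing single elements suffices because
  every nonzero submodule contains a nonzero cyclic one.\<close>

definition essential_over :: "'a set \<Rightarrow> 'a set \<Rightarrow> bool" where
  "essential_over I E \<longleftrightarrow> right_ideal R E \<and> I \<subseteq> E \<and>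
    (\<forall>x\<in>carrier R. x \<notin> I \<longrightarrow> (\<exists>r\<in>carrier R. x \<otimes> r \<in> E \<and> x \<otimes> r \<notin> I))"

end


section \<open>Goldie's theorem for semiprime ideals\<close>

locale semiprime_mod = deviation_ring R for R :: "('a, 'b) ring_scheme" (structure) +
  fixes N :: "'a set"
  assumes ideal_N: "ideal N R"
    and semiprime: "\<lbrakk>a \<in> carrier R; \<And>r. r \<in> carrier R \<Longrightarrow> a \<otimes> r \<otimes> a \<in> N\<rbrakk> \<Longrightarrow> a \<in> N"
begin

lemma right_ideal_N: "right_ideal R N"
  using ideal_N by (rule ideal_right_ideal)

lemmas N_l = ideal_l[OF ideal_N]
  and N_r = ideal_r[OF ideal_N]
  and N_zero = right_ideal_zero[OF right_ideal_N]
  and N_add = right_ideal_add[OF right_ideal_N]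
  and N_carr = right_ideal_carr[OF right_ideal_N]
  and N_add_cancel = right_ideal_add_cancel[OF right_ideal_N]

definition right_ann :: "'a \<Rightarrow> 'a set" where
  "right_ann s = {x \<in> carrier R. s \<otimes> x \<in> N}"

text \<open>The right singular ideal of R/N pulled back to R: its elements are those whose right
  annihilator modulo \<open>N\<close> is essential.\<close>

definition singular :: "'a set" where
  "singular = {x \<in> carrier R. \<forall>y\<in>carrier R. y \<notin> N \<longrightarrow>
    (\<exists>r\<in>carrier R. x \<otimes> (y \<otimes> r) \<in> N \<and> y \<otimes> r \<notin> N)}"

lemma right_ideal_right_ann: "s \<in> carrier R \<Longrightarrow> right_ideal R (right_ann s)"
  unfolding right_ann_def using right_ideal_colon[OF right_ideal_N] .

lemma N_subset_right_ann: "s \<in> carrier R \<Longrightarrow> N \<subseteq> right_ann s"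
  by (auto simp: right_ann_def N_l N_carr)

lemma right_ann_carr: "x \<in> right_ann s \<Longrightarrow> x \<in> carrier R"
  by (simp add: right_ann_def)

lemma singular_mult:
  assumes "x \<in> singular" "s \<in> carrier R"
  shows "x \<otimes> s \<in> singular"
  unfolding singular_def
proof (intro CollectI conjI ballI impI)
  have x: "x \<in> carrier R" using assms by (simp add: singular_def)
  show "x \<otimes> s \<in> carrier R" using x assms(2) by simp
  fix y assume y: "y \<in> carrier R" "y \<notin> N"
  show "\<exists>r\<in>carrier R. x \<otimes> s \<otimes> (y \<otimes> r) \<in> N \<and> y \<otimes> r \<notin> N"
  proof (cases "s \<otimes> y \<in> N")
    case True
    then have "x \<otimes> s \<otimes> (y \<otimes> \<one>) \<in> N" using x y assms(2) N_l by (simp add: m_assoc)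
    then show ?thesis using y by (intro bexI[of _ \<one>]) auto
  next
    case False
    then obtain r where r: "r \<in> carrier R" "x \<otimes> (s \<otimes> y \<otimes> r) \<in> N" "s \<otimes> y \<otimes> r \<notin> N"
      using assms y unfolding singular_def by auto
    have "y \<otimes> r \<notin> N" using r y assms(2) N_l[of "y \<otimes> r" s] by (auto simp: m_assoc)
    then show ?thesis using r x y assms(2) by (intro bexI[of _ r]) (auto simp: m_assoc)
  qed
qed

text \<open>
  For a right ideal \<open>X\<close> inside the singular ideal and \<open>u \<in> X\<close> with \<open>u X \<noteq> 0\<close>, the kernel of
  \<open>X \<rightarrow> u X\<close> is nonzero, so \<open>X\<close> has a proper nonzero submodule with both the submodule and the
  factor isomorphic to right ideals inside the singular ideal.
\<close>

lemma singular_subset_N: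
  assumes z: "z \<in> singular"
  shows "z \<in> N"
proof (rule ccontr)
  assume zN: "z \<notin> N"
  have zc: "z \<in> carrier R" using z by (simp add: singular_def)
  \<comment> \<open>Left multiplication by \<open>v\<close> maps \<open>B\<close> into the singular
    ideal with kernel \<open>A\<close> modulo \<open>N\<close>, so B/A is isomorphic to a nonzero
    right ideal of R/N inside the singular ideal.\<close>
  define \<Phi> where "\<Phi> = (\<lambda>A B. right_ideal R B \<and> N \<subseteq> B \<and>
    (\<exists>v\<in>carrier R. (\<forall>b\<in>B. v \<otimes> b \<in> singular) \<and> A = {b \<in> B. v \<otimes> b \<in> N} \<and> A \<noteq> B))"
  show False
  proof (rule no_dense_family[of \<Phi>])
    show "\<Phi> {b \<in> carrier R. z \<otimes> b \<in> N} (carrier R)"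
      unfolding \<Phi>_def
    proof (intro conjI bexI[of _ z])
      show "\<forall>b\<in>carrier R. z \<otimes> b \<in> singular" using z singular_mult by blast
      have "z \<otimes> \<one> \<notin> N" using zN zc by simp
      then show "{b \<in> carrier R. z \<otimes> b \<in> N} \<noteq> carrier R" by blast
    qed (use zc right_ideal_carrier N_carr in auto)
  next
    fix A B assume "\<Phi> A B"
    then obtain v where B: "right_ideal R B" "N \<subseteq> B" and v: "v \<in> carrier R"
      and vB: "\<And>b. b \<in> B \<Longrightarrow> v \<otimes> b \<in> singular" and A: "A = {b \<in> B. v \<otimes> b \<in> N}" "A \<noteq> B"
      unfolding \<Phi>_def by blast
    show "right_ideal R A \<and> right_ideal R B"
      using right_ideal_colon_in[OF right_ideal_N B(1) v] A B by simp
    show "A \<subseteq> B \<and> A \<noteq> B" using A by blast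
    obtain b0 where b0: "b0 \<in> B" "v \<otimes> b0 \<notin> N" using A by blast
    have b0c: "b0 \<in> carrier R" using b0 B right_ideal_carr by blast
    \<comment> \<open>Semiprimeness provides \<open>r\<close> such that \<open>u\<close> does not
      kill \<open>v \<otimes> b0\<close>, so the kernel of multiplication by
      \<open>u \<otimes> v\<close> is properly below \<open>B\<close>. It is properly above
      \<open>A\<close> because the singular element \<open>u\<close> kills some multiple of
      \<open>v \<otimes> b0\<close> outside \<open>N\<close>.\<close>
    obtain r where r: "r \<in> carrier R" "v \<otimes> b0 \<otimes> r \<otimes> (v \<otimes> b0) \<notin> N"
      using semiprime[of "v \<otimes> b0"] b0 b0c v by blast
    define u where "u = v \<otimes> b0 \<otimes> r"
    have u: "u \<in> carrier R" using v b0c r by (simp add: u_def)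
    have u_sing: "u \<in> singular" using vB[OF b0(1)] r singular_mult by (simp add: u_def)
    let ?C = "{b \<in> B. u \<otimes> v \<otimes> b \<in> N}"
    have C: "right_ideal R ?C" using B u v right_ideal_N by (intro right_ideal_colon_in) auto
    have Bc: "b \<in> carrier R" if "b \<in> B" for b using that B right_ideal_carr by blast
    have "\<Phi> A ?C"
      unfolding \<Phi>_def
    proof (intro conjI bexI[of _ v])
      show "A = {b \<in> ?C. v \<otimes> b \<in> N}"
        using A(1) u v Bc N_l by (auto simp: m_assoc)
      have "\<exists>t\<in>carrier R. u \<otimes> (v \<otimes> b0 \<otimes> t) \<in> N \<and> v \<otimes> b0 \<otimes> t \<notin> N"
        using u_sing b0 b0c v unfolding singular_def by simp
      then obtain t where t: "t \<in> carrier R" "u \<otimes> (v \<otimes> b0 \<otimes> t) \<in> N" "v \<otimes> b0 \<otimes> t \<notin> N" by blast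
      have "b0 \<otimes> t \<in> ?C" using t b0 b0c u v B right_ideal_mult by (auto simp: m_assoc)
      moreover have "b0 \<otimes> t \<notin> A" using t A b0c v by (simp add: m_assoc)
      ultimately show "A \<noteq> ?C" by blast
      show "N \<subseteq> ?C" using B u v N_carr N_l by auto
    qed (use C v vB in auto)
    moreover have "\<Phi> ?C B"
      unfolding \<Phi>_def
    proof (intro conjI bexI[of _ "u \<otimes> v"] ballI)
      fix b assume b: "b \<in> B"
      have "u \<otimes> v \<otimes> b = v \<otimes> (b0 \<otimes> (r \<otimes> v \<otimes> b))"
        using b Bc b0c r v by (simp add: u_def m_assoc)
      moreover have "b0 \<otimes> (r \<otimes> v \<otimes> b) \<in> B"
        using b Bc r v b0 B right_ideal_mult by simp
      ultimately show "u \<otimes> v \<otimes> b \<in> singular" using vB by simp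
    next
      have "u \<otimes> v \<otimes> b0 \<notin> N" using r v b0c by (simp add: u_def m_assoc)
      then show "?C \<noteq> B" using b0 by blast
    qed (use B u v in auto)
    ultimately show "\<exists>C. \<Phi> A C \<and> \<Phi> C B" by blast
  qed
qed

definition uniform :: "'a set \<Rightarrow> bool" where
  "uniform U \<longleftrightarrow> right_ideal R U \<and> N \<subseteq> U \<and> U \<noteq> N \<and>
    (\<forall>A B. right_ideal R A \<longrightarrow> right_ideal R B \<longrightarrow> N \<subseteq> A \<longrightarrow> N \<subseteq> B \<longrightarrow> A \<subseteq> U \<longrightarrow> B \<subseteq> U \<longrightarrow>
      A \<inter> B \<subseteq> N \<longrightarrow> A = N \<or> B = N)"

text \<open>If no right ideal inside \<open>X\<close> were uniform, each nonzero \<open>C\<close>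
  inside \<open>X\<close> would contain two nonzero independent right ideals \<open>C1\<close> and
  \<open>C2\<close>, all modulo \<open>N\<close>. The dense family consists of pairs whose upper
  member contains such a \<open>C\<close> independent of the lower one: adding \<open>C1\<close> to
  the lower member gives the middle, and \<open>C2\<close> remains independent of it.\<close>

lemma exists_uniform:
  assumes X: "right_ideal R X" "N \<subseteq> X" "X \<noteq> N"
  obtains U where "uniform U" "U \<subseteq> X"
proof (rule ccontr)
  assume contr: "\<not> thesis"
  note result = that
  have nonuniform: "\<not> uniform U" if "U \<subseteq> X" for U
    using contr result[OF _ that] by blast
  define \<Phi> where "\<Phi> = (\<lambda>A B. right_ideal R A \<and> right_ideal R B \<and> N \<subseteq> A \<and> A \<subseteq> B \<and>
    (\<exists>C. right_ideal R C \<and> N \<subseteq> C \<and> C \<subseteq> B \<and> C \<subseteq> X \<and> C \<noteq> N \<and> C \<inter> A \<subseteq> N))"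
  show False
  proof (rule no_dense_family[of \<Phi>])
    show "\<Phi> N X" unfolding \<Phi>_def using X right_ideal_N by blast
  next
    fix A B assume "\<Phi> A B"
    then obtain C where A: "right_ideal R A" "N \<subseteq> A" and B: "right_ideal R B" "A \<subseteq> B"
      and C: "right_ideal R C" "N \<subseteq> C" "C \<subseteq> B" "C \<subseteq> X" "C \<noteq> N" "C \<inter> A \<subseteq> N"
      unfolding \<Phi>_def by blast
    show "right_ideal R A \<and> right_ideal R B" using A B by blast
    show "A \<subseteq> B \<and> A \<noteq> B" using B C by blast
    obtain C1 C2 where C1: "right_ideal R C1" "N \<subseteq> C1" "C1 \<subseteq> C" "C1 \<noteq> N"
      and C2: "right_ideal R C2" "N \<subseteq> C2" "C2 \<subseteq> C" "C2 \<noteq> N" and C12: "C1 \<inter> C2 \<subseteq> N"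
      using nonuniform[OF C(4)] C unfolding uniform_def by blast
    let ?M = "rgen (A \<union> C1)"
    have M: "right_ideal R ?M"
      using A C1 by (intro rgen_right_ideal) (auto dest: right_ideal_carr)
    have AM: "A \<subseteq> ?M" "C1 \<subseteq> ?M" using rgen_incl[of "A \<union> C1"] by auto
    have MB: "?M \<subseteq> B" using A B C C1 by (intro rgen_least) auto
    \<comment> \<open>The modular law: if an element of \<open>C2\<close> is the sum of one from
      \<open>A\<close> and one from \<open>C1\<close>, the summand from \<open>A\<close> lies in
      \<open>C\<close>, hence in \<open>N\<close> and so in \<open>C1\<close>.\<close>
    have "C2 \<inter> ?M \<subseteq> N"
    proof
      fix y assume y: "y \<in> C2 \<inter> ?M"
      then obtain a c where ac: "a \<in> A" "c \<in> C1" "y = a \<oplus> c"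
        unfolding rgen_Un[OF A(1) C1(1)] by blast
      have "a \<oplus> c \<in> C" "c \<in> C" using ac y C1(3) C2(3) by auto
      then have "a \<in> C"
        using right_ideal_add_cancel(1)[OF C(1) right_ideal_carr[OF A(1) ac(1)]] by simp
      then have "a \<in> C1" using ac C(6) C1(2) by blast
      then have "y \<in> C1" using ac right_ideal_add[OF C1(1)] by simp
      then show "y \<in> N" using y C12 by blast
    qed
    then have "\<Phi> ?M B"
      unfolding \<Phi>_def
      using subset_trans[OF C2(3) C(3)] subset_trans[OF C2(3) C(4)] subset_trans[OF A(2) AM(1)] M B(1) MB C2
      by (intro conjI exI[of _ C2]) simp_all
    moreover have "\<Phi> A ?M"
      unfolding \<Phi>_def
      using subset_trans[OF C1(3) C(4)] M A AM C1 C(6) by (intro conjI exI[of _ C1]) auto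
    ultimately show "\<exists>C. \<Phi> A C \<and> \<Phi> C B" by blast
  qed
qed

text \<open>By semiprimeness \<open>U\<close> contains \<open>u\<close> and \<open>z\<close> with
  \<open>u \<otimes> z\<close> outside \<open>N\<close>. If \<open>u\<close> killed some
  \<open>y\<close> of \<open>U\<close> outside \<open>N\<close>, uniformity would make the multiples
  of any nonzero \<open>z \<otimes> w\<close> meet those of \<open>y\<close> outside
  \<open>N\<close>, so \<open>u \<otimes> z\<close> would be singular and hence in
  \<open>N\<close>.\<close>

lemma uniform_element:
  assumes U: "uniform U"
  obtains u where "u \<in> U" "right_ann u \<inter> U \<subseteq> N"
proof -
  have UR: "right_ideal R U" "N \<subseteq> U" "U \<noteq> N" using U by (auto simp: uniform_def)
  obtain z where z: "z \<in> U" "z \<notin> N" using UR by blast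
  have zc: "z \<in> carrier R" using z UR right_ideal_carr by blast
  obtain r where r: "r \<in> carrier R" "z \<otimes> r \<otimes> z \<notin> N" using semiprime[OF zc] z by blast
  define u where "u = z \<otimes> r"
  have u: "u \<in> U" "u \<in> carrier R" using z r zc UR right_ideal_mult by (auto simp: u_def)
  have uz: "u \<otimes> z \<notin> N" using r by (simp add: u_def)
  have "right_ann u \<inter> U \<subseteq> N"
  proof (rule ccontr)
    assume "\<not> right_ann u \<inter> U \<subseteq> N"
    then obtain y where y: "y \<in> U" "y \<in> carrier R" "u \<otimes> y \<in> N" "y \<notin> N"
      by (auto simp: right_ann_def)
    have "u \<otimes> z \<in> singular"
      unfolding singular_def
    proof (intro CollectI conjI ballI impI)
      fix w assume w: "w \<in> carrier R" "w \<notin> N"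
      show "\<exists>r\<in>carrier R. u \<otimes> z \<otimes> (w \<otimes> r) \<in> N \<and> w \<otimes> r \<notin> N"
      proof (cases "z \<otimes> w \<in> N")
        case True
        then show ?thesis using w u zc N_l by (intro bexI[of _ \<one>]) (auto simp: m_assoc)
      next
        case False
        let ?A = "rgen (insert (z \<otimes> w) N)" and ?B = "rgen (insert y N)"
        have ri: "right_ideal R ?A" "right_ideal R ?B"
          using zc w y right_ideal_N by (auto intro: right_ideal_rgen_insert)
        have "\<not> ?A \<inter> ?B \<subseteq> N"
        proof
          assume AB: "?A \<inter> ?B \<subseteq> N"
          have "?A \<subseteq> U" "?B \<subseteq> U"
            using UR z w y right_ideal_mult[OF UR(1)] by (intro rgen_least; simp)+
          moreover have "N \<subseteq> ?A" "N \<subseteq> ?B" by (rule rgen_insert_self)+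
          ultimately have "?A = N \<or> ?B = N"
            using U[unfolded uniform_def] AB ri by simp
          then show False
            using False y rgen_insert_self(2)[of "z \<otimes> w" N] rgen_insert_self(2)[of y N] by auto
        qed
        then obtain t where t: "t \<in> ?A" "t \<in> ?B" "t \<notin> N" by blast
        obtain n s where ns: "n \<in> N" "s \<in> carrier R" "t = n \<oplus> z \<otimes> w \<otimes> s"
          using t(1) rgen_insert_right_ideal[OF right_ideal_N, of "z \<otimes> w"] zc w by auto
        obtain n' s' where ns': "n' \<in> N" "s' \<in> carrier R" "t = n' \<oplus> y \<otimes> s'"
          using t(2) rgen_insert_right_ideal[OF right_ideal_N, of y] y by auto
        have "u \<otimes> t = u \<otimes> n' \<oplus> u \<otimes> y \<otimes> s'"
          unfolding ns'(3) using ns'(1,2) u y N_carr by (simp add: r_distr m_assoc)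
        moreover have "u \<otimes> t = u \<otimes> n \<oplus> u \<otimes> z \<otimes> (w \<otimes> s)"
          unfolding ns(3) using ns(1,2) u zc w N_carr by (simp add: r_distr m_assoc)
        moreover have "u \<otimes> n' \<oplus> u \<otimes> y \<otimes> s' \<in> N"
          using ns' u y N_add N_l N_r by simp
        ultimately have "u \<otimes> n \<oplus> u \<otimes> z \<otimes> (w \<otimes> s) \<in> N" by simp
        then have "u \<otimes> z \<otimes> (w \<otimes> s) \<in> N"
          using N_add_cancel(2)[of "u \<otimes> z \<otimes> (w \<otimes> s)" "u \<otimes> n"] ns u zc w N_l by simp
        moreover have "z \<otimes> w \<otimes> s \<notin> N" using t(3) ns N_add by blast
        then have "w \<otimes> s \<notin> N" using N_l[of "w \<otimes> s" z] zc w ns by (auto simp: m_assoc)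
        ultimately show ?thesis using ns by blast
      qed
    qed (use u zc in auto)
    then show False using uz singular_subset_N by blast
  qed
  then show ?thesis using that u by blast
qed

text \<open>Goldie's construction builds \<open>s\<close> as a sum of elements \<open>u\<close> of
  uniform right ideals, each chosen inside the right annihilator of the sum so far. Adding
  \<open>u\<close> cuts this annihilator down to the elements that \<open>u\<close> kills too, so it
  loses an independent uniform piece. Endless repetition would give a descending chain with
  inessential inclusions.\<close>

lemma essential_ann_trivial:
  assumes E: "essential_over N E"
  obtains s where "s \<in> E" "right_ann s \<subseteq> N"
proof (rule ccontr)
  assume contr: "\<not> thesis"
  note result = that
  have ER: "right_ideal R E" "N \<subseteq> E" using E by (auto simp: essential_over_def)
  \<comment> \<open>The second condition says that the multiples of \<open>s\<close> meet the right
    annihilator of \<open>s\<close> only in \<open>N\<close>. For \<open>u\<close> in that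
    annihilator a relation \<open>s \<otimes> x \<oplus> u \<otimes> x \<in> N\<close> therefore
    splits into its two terms.\<close>
  define good where "good = (\<lambda>s. s \<in> E \<and> (\<forall>x\<in>carrier R. s \<otimes> (s \<otimes> x) \<in> N \<longrightarrow> s \<otimes> x \<in> N))"
  have step: "\<exists>s'. good s' \<and> right_ann s' \<subseteq> right_ann s \<and>
      (\<exists>y\<in>right_ann s. y \<notin> N \<and> (\<forall>r\<in>carrier R. y \<otimes> r \<in> right_ann s' \<longrightarrow> y \<otimes> r \<in> N))"
    if s: "good s" for s
  proof -
    have sE: "s \<in> E" and sc: "s \<in> carrier R" using s ER right_ideal_carr by (auto simp: good_def)
    have s2: "\<And>x. \<lbrakk>x \<in> carrier R; s \<otimes> (s \<otimes> x) \<in> N\<rbrakk> \<Longrightarrow> s \<otimes> x \<in> N"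
      using s by (simp add: good_def)
    obtain x where x: "x \<in> right_ann s" "x \<notin> N" using contr result[OF sE] by blast
    then obtain r where r: "r \<in> carrier R" "x \<otimes> r \<in> E" "x \<otimes> r \<notin> N"
      using E right_ann_carr[OF x(1)] unfolding essential_over_def by blast
    have "x \<otimes> r \<in> right_ann s" using right_ideal_mult[OF right_ideal_right_ann[OF sc] x(1) r(1)] .
    then have ne: "right_ann s \<inter> E \<noteq> N" using r by blast
    have "N \<subseteq> right_ann s \<inter> E" using N_subset_right_ann[OF sc] ER by blast
    then obtain U where U: "uniform U" "U \<subseteq> right_ann s \<inter> E"
      using exists_uniform[OF right_ideal_Int[OF right_ideal_right_ann[OF sc] ER(1)] _ ne] by blast
    obtain u where u: "u \<in> U" "right_ann u \<inter> U \<subseteq> N" using uniform_element[OF U(1)] .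
    have UR: "right_ideal R U" "N \<subseteq> U" "U \<noteq> N" using U(1) by (auto simp: uniform_def)
    have uc: "u \<in> carrier R" using u UR right_ideal_carr by blast
    have su: "s \<otimes> u \<in> N" using u U by (auto simp: right_ann_def)
    let ?s = "s \<oplus> u"
    have right_ann_s: "s \<otimes> x \<in> N \<and> u \<otimes> x \<in> N" if x: "x \<in> carrier R" "?s \<otimes> x \<in> N" for x
    proof -
      have 1: "s \<otimes> x \<oplus> u \<otimes> x \<in> N" using x sc uc by (simp add: l_distr)
      then have "s \<otimes> (s \<otimes> x \<oplus> u \<otimes> x) \<in> N" using N_l sc by blast
      then have "s \<otimes> (s \<otimes> x) \<oplus> s \<otimes> u \<otimes> x \<in> N" using x sc uc by (simp add: r_distr m_assoc)
      then have "s \<otimes> (s \<otimes> x) \<in> N"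
        using N_add_cancel(1)[of "s \<otimes> (s \<otimes> x)" "s \<otimes> u \<otimes> x"] x sc uc su N_r by simp
      then have "s \<otimes> x \<in> N" using s2 x by blast
      then show ?thesis using 1 N_add_cancel(2)[of "u \<otimes> x" "s \<otimes> x"] x uc by simp
    qed
    have "good ?s"
      unfolding good_def
    proof (intro conjI ballI impI)
      show "?s \<in> E" using sE u U ER right_ideal_add by blast
      fix x assume x: "x \<in> carrier R" "?s \<otimes> (?s \<otimes> x) \<in> N"
      have *: "s \<otimes> (?s \<otimes> x) \<in> N" "u \<otimes> (?s \<otimes> x) \<in> N"
        using right_ann_s[of "?s \<otimes> x"] x sc uc by auto
      have "s \<otimes> (s \<otimes> x) \<oplus> s \<otimes> u \<otimes> x \<in> N" using *(1) x sc uc by (simp add: l_distr r_distr m_assoc)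
      then have "s \<otimes> (s \<otimes> x) \<in> N"
        using N_add_cancel(1)[of "s \<otimes> (s \<otimes> x)" "s \<otimes> u \<otimes> x"] x sc uc su N_r by simp
      then have sx: "s \<otimes> x \<in> N" using s2 x by blast
      have "u \<otimes> (s \<otimes> x) \<oplus> u \<otimes> (u \<otimes> x) \<in> N" using *(2) x sc uc by (simp add: l_distr r_distr)
      then have "u \<otimes> (u \<otimes> x) \<in> N"
        using N_add_cancel(2)[of "u \<otimes> (u \<otimes> x)" "u \<otimes> (s \<otimes> x)"] x uc sx N_l by simp
      then have "u \<otimes> x \<in> right_ann u \<inter> U" using u UR x uc right_ideal_mult by (auto simp: right_ann_def)
      then show "?s \<otimes> x \<in> N" using u sx N_add x sc uc by (auto simp: l_distr)
    qed
    moreover have "right_ann ?s \<subseteq> right_ann s" using right_ann_s by (auto simp: right_ann_def)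
    moreover obtain y where y: "y \<in> U" "y \<notin> N" using UR by blast
    moreover have "y \<otimes> r \<in> N" if "r \<in> carrier R" "y \<otimes> r \<in> right_ann ?s" for r
    proof -
      have "y \<otimes> r \<in> right_ann u \<inter> U"
        using right_ann_s[of "y \<otimes> r"] that y UR right_ideal_mult by (auto simp: right_ann_def)
      then show ?thesis using u by blast
    qed
    ultimately show ?thesis using U by blast
  qed
  have "good \<zero>" using ER right_ideal_zero N_zero by (auto simp: good_def)
  then obtain s where s: "\<And>n::nat. good (s n)" and sn: "\<And>n. right_ann (s (Suc n)) \<subseteq> right_ann (s n) \<and>
      (\<exists>y\<in>right_ann (s n). y \<notin> N \<and> (\<forall>r\<in>carrier R. y \<otimes> r \<in> right_ann (s (Suc n)) \<longrightarrow> y \<otimes> r \<in> N))"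
    using dependent_nat_choice[of "\<lambda>_. good" "\<lambda>_ s s'. right_ann s' \<subseteq> right_ann s \<and>
      (\<exists>y\<in>right_ann s. y \<notin> N \<and> (\<forall>r\<in>carrier R. y \<otimes> r \<in> right_ann s' \<longrightarrow> y \<otimes> r \<in> N))"] step by metis
  obtain y where y: "\<And>n. y n \<in> right_ann (s n) \<and> y n \<notin> N \<and>
      (\<forall>r\<in>carrier R. y n \<otimes> r \<in> right_ann (s (Suc n)) \<longrightarrow> y n \<otimes> r \<in> N)"
    using sn by metis
  have sc: "s n \<in> carrier R" for n using s[of n] ER right_ideal_carr by (auto simp: good_def)
  show False
    by (rule descending_chain_essential[OF right_ideal_N, of "\<lambda>n. right_ann (s n)" y])
      (use sc right_ideal_right_ann N_subset_right_ann sn y in auto)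
qed

text \<open>If the nonzero \<open>x\<close> had no nonzero multiple in the right ideal of
  \<open>s\<close>, the elements x, s x, s^2 x and so on would be independent modulo
  \<open>N\<close>: cancelling s^n turns a relation between s^n x and the multiples of s^(n+1) into
  one between x and the multiples of s.\<close>

lemma essential_principal:
  assumes s: "s \<in> carrier R" "right_ann s \<subseteq> N"
  shows "essential_over N (rgen (insert s N))"
  unfolding essential_over_def
proof (intro conjI ballI impI)
  have gen: "rgen (insert t N) = {u \<oplus> t \<otimes> r | u r. u \<in> N \<and> r \<in> carrier R}"
    if "t \<in> carrier R" for t
    using that right_ideal_N by (intro rgen_insert_right_ideal)
  show "right_ideal R (rgen (insert s N))" using s right_ideal_N by (intro right_ideal_rgen_insert)
  show "N \<subseteq> rgen (insert s N)" by (rule rgen_insert_self)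
  fix x assume x: "x \<in> carrier R" "x \<notin> N"
  show "\<exists>r\<in>carrier R. x \<otimes> r \<in> rgen (insert s N) \<and> x \<otimes> r \<notin> N"
  proof (rule ccontr)
    assume contr: "\<not> ?thesis"
    have pow: "s [^] n \<in> carrier R" for n :: nat using s by simp
    have cancel: "x \<in> N" if "x \<in> carrier R" "s [^] n \<otimes> x \<in> N" for x and n :: nat
      using that
    proof (induction n arbitrary: x)
      case (Suc n)
      then have "s [^] n \<otimes> (s \<otimes> x) \<in> N" using s by (simp add: m_assoc)
      then have "s \<otimes> x \<in> N" using Suc s by simp
      then show ?case using s Suc by (auto simp: right_ann_def)
    qed simp
    let ?D = "\<lambda>n::nat. rgen (insert (s [^] n) N)"
    show False
    proof (rule descending_chain_essential[OF right_ideal_N, of ?D "\<lambda>n. s [^] n \<otimes> x"])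
      fix n
      show D: "right_ideal R (?D n)" for n using pow right_ideal_N by (intro right_ideal_rgen_insert)
      show "N \<subseteq> ?D n" by (rule rgen_insert_self)
      have "s [^] n \<in> ?D n" by (rule rgen_insert_self)
      then have "s [^] Suc n \<in> ?D n" using right_ideal_mult[OF D] s by simp
      then show "?D (Suc n) \<subseteq> ?D n" using D rgen_insert_self(1) by (intro rgen_least) auto
      show "s [^] n \<otimes> x \<in> ?D n" using right_ideal_mult[OF D rgen_insert_self(2)] x by simp
      show "s [^] n \<otimes> x \<notin> N" using cancel x by blast
      fix r assume r: "r \<in> carrier R" "s [^] n \<otimes> x \<otimes> r \<in> ?D (Suc n)"
      then obtain u t where ut: "u \<in> N" "t \<in> carrier R" "s [^] n \<otimes> x \<otimes> r = u \<oplus> s [^] Suc n \<otimes> t"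
        unfolding gen[OF pow] by blast
      have "s [^] n \<otimes> (x \<otimes> r \<ominus> s \<otimes> t) = s [^] n \<otimes> x \<otimes> r \<ominus> s [^] Suc n \<otimes> t"
        using s x r ut pow by (simp add: minus_eq r_distr r_minus m_assoc)
      also have "\<dots> = u" using ut s N_carr by (simp add: minus_eq a_assoc r_neg)
      finally have "x \<otimes> r \<ominus> s \<otimes> t \<in> N"
        using cancel[of "x \<otimes> r \<ominus> s \<otimes> t" n] ut(1,2) s x r by simp
      moreover have "x \<otimes> r = (x \<otimes> r \<ominus> s \<otimes> t) \<oplus> s \<otimes> t"
        using s x r ut by (simp add: minus_eq a_assoc l_neg)
      ultimately have "x \<otimes> r \<in> rgen (insert s N)" unfolding gen[OF s(1)] using ut by blast
      then have "x \<otimes> r \<in> N" using contr r by blast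
      then show "s [^] n \<otimes> x \<otimes> r \<in> N" using N_l pow x r by (simp add: m_assoc)
    qed
  qed
qed

text \<open>If \<open>x \<otimes> s \<in> N\<close>, the right annihilator of \<open>x\<close>
  contains the right ideal generated by \<open>s\<close> and \<open>N\<close>, which is essential.
  Hence \<open>x\<close> is singular and lies in \<open>N\<close>, so cancellation on one side
  implies it on the other.\<close>

lemma regular_modI:
  assumes s: "s \<in> carrier R" "right_ann s \<subseteq> N"
  shows "regular_mod N s"
  unfolding regular_mod_def
proof (intro conjI ballI impI)
  fix x assume x: "x \<in> carrier R" "x \<otimes> s \<in> N"
  have "x \<in> singular"
    unfolding singular_def
  proof (intro CollectI conjI ballI impI)
    fix y assume y: "y \<in> carrier R" "y \<notin> N"
    then obtain r where r: "r \<in> carrier R" "y \<otimes> r \<in> rgen (insert s N)" "y \<otimes> r \<notin> N"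
      using essential_principal[OF s] unfolding essential_over_def by blast
    obtain u t where ut: "u \<in> N" "t \<in> carrier R" "y \<otimes> r = u \<oplus> s \<otimes> t"
      using r(2) rgen_insert_right_ideal[OF right_ideal_N s(1)] by auto
    have "x \<otimes> (y \<otimes> r) = x \<otimes> u \<oplus> x \<otimes> s \<otimes> t"
      using ut x s N_carr by (simp add: r_distr m_assoc)
    also have "\<dots> \<in> N" using ut x s N_add N_l N_r by simp
    finally show "\<exists>r\<in>carrier R. x \<otimes> (y \<otimes> r) \<in> N \<and> y \<otimes> r \<notin> N" using r by blast
  qed (use x in auto)
  then show "x \<in> N" by (rule singular_subset_N)
qed (use s in \<open>auto simp: right_ann_def\<close>)

lemma essential_contains_regular:
  assumes "essential_over N E"
  obtains s where "s \<in> E" "regular_mod N s"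
proof -
  obtain s where s: "s \<in> E" "right_ann s \<subseteq> N" using essential_ann_trivial[OF assms] .
  moreover have "s \<in> carrier R"
    using s(1) assms right_ideal_carr[of E s] unfolding essential_over_def by simp
  ultimately show ?thesis using that regular_modI by simp
qed

end

section \<open>Factoring regular elements\<close>

context ring
begin

lemma regular_modD:
  assumes "regular_mod I s"
  shows regular_mod_carr: "s \<in> carrier R"
    and regular_mod_l: "\<lbrakk>x \<in> carrier R; s \<otimes> x \<in> I\<rbrakk> \<Longrightarrow> x \<in> I"
    and regular_mod_r: "\<lbrakk>x \<in> carrier R; x \<otimes> s \<in> I\<rbrakk> \<Longrightarrow> x \<in> I"
  using assms unfolding regular_mod_def by blast+

definition multiples :: "'a \<Rightarrow> 'a set" where
  "multiples a = {a \<otimes> r | r. r \<in> carrier R}"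

lemma right_ideal_multiples: "a \<in> carrier R \<Longrightarrow> right_ideal R (multiples a)"
  unfolding multiples_def by (rule right_ideal_principal)

lemma multiples_mem: "r \<in> carrier R \<Longrightarrow> a \<otimes> r \<in> multiples a"
  by (auto simp: multiples_def)

lemma right_ideal_one:
  assumes "right_ideal R A" "\<one> \<in> A"
  shows "A = carrier R"
  using right_ideal_mult[OF assms] right_ideal_subset[OF assms(1)] by auto

lemma maximal_right_ideal_not_one: "maximal_right_ideal R M \<Longrightarrow> \<one> \<notin> M"
  using right_ideal_one unfolding maximal_right_ideal_def by blast

lemma maximal_right_ideal_complement:
  assumes M: "maximal_right_ideal R M" and A: "right_ideal R A" "\<not> A \<subseteq> M"
  obtains q where "q \<in> A" "\<one> \<ominus> q \<in> M"
proof -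
  have MR: "right_ideal R M" using M by (simp add: maximal_right_ideal_def)
  have "right_ideal R (rgen (M \<union> A))"
    using MR A by (intro rgen_right_ideal) (auto dest: right_ideal_carr)
  moreover have "M \<subseteq> rgen (M \<union> A)" "rgen (M \<union> A) \<noteq> M" using rgen_incl[of "M \<union> A"] A by auto
  ultimately have "rgen (M \<union> A) = carrier R" using M unfolding maximal_right_ideal_def by blast
  then have "\<one> \<in> rgen (M \<union> A)" by simp
  then obtain m q where mq: "m \<in> M" "q \<in> A" "\<one> = m \<oplus> q" unfolding rgen_Un[OF MR A(1)] by blast
  have c: "m \<in> carrier R" "q \<in> carrier R"
    using mq right_ideal_carr[OF MR] right_ideal_carr[OF A(1)] by auto
  have "m = (m \<oplus> q) \<ominus> q" using c by (simp add: minus_eq a_assoc r_neg)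
  then have "\<one> \<ominus> q = m" using mq(3) by simp
  then show ?thesis using that mq by simp
qed

text \<open>Choose \<open>x\<close> and \<open>y\<close> congruent to 1 modulo \<open>M\<close>.
  Although \<open>M\<close> is only a right ideal, it contains
  \<open>(\<one> \<ominus> x) \<otimes> y\<close>, so \<open>x \<otimes> y\<close> is congruent to
  \<open>y\<close> and hence to 1.\<close>

lemma maximal_right_ideal_prod:
  assumes M: "maximal_right_ideal R M" and I: "right_ideal R I" "\<not> I \<subseteq> M"
    and J: "right_ideal R J" "\<not> J \<subseteq> M"
  obtains x y where "x \<in> I" "y \<in> J" "x \<otimes> y \<notin> M"
proof -
  have MR: "right_ideal R M" using M by (simp add: maximal_right_ideal_def)
  obtain x where x: "x \<in> I" "\<one> \<ominus> x \<in> M" using maximal_right_ideal_complement[OF M I] .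
  obtain y where y: "y \<in> J" "\<one> \<ominus> y \<in> M" using maximal_right_ideal_complement[OF M J] .
  have c: "x \<in> carrier R" "y \<in> carrier R"
    using x y right_ideal_carr[OF I(1)] right_ideal_carr[OF J(1)] by auto
  have "x \<otimes> y \<notin> M"
  proof
    assume "x \<otimes> y \<in> M"
    moreover have "(\<one> \<ominus> x) \<otimes> y \<in> M" using right_ideal_mult[OF MR x(2) c(2)] .
    ultimately have "(\<one> \<ominus> x) \<otimes> y \<oplus> x \<otimes> y \<in> M" using right_ideal_add[OF MR] by blast
    moreover have "(\<one> \<ominus> x) \<otimes> y \<oplus> x \<otimes> y = y"
      using c by (simp add: minus_eq l_distr l_minus a_assoc l_neg)
    ultimately have "y \<in> M" by simp
    then have "(\<one> \<ominus> y) \<oplus> y \<in> M" using right_ideal_add[OF MR y(2)] by blast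
    then show False
      using maximal_right_ideal_not_one[OF M] c by (simp add: minus_eq a_assoc l_neg)
  qed
  then show ?thesis using that x y by blast
qed

section \<open>Primeness tested on elements\<close>

lemma prime_idealI':
  assumes "ideal Q R" "Q \<noteq> carrier R"
    and "\<And>x y. \<lbrakk>x \<in> carrier R; y \<in> carrier R; \<And>r. r \<in> carrier R \<Longrightarrow> x \<otimes> r \<otimes> y \<in> Q\<rbrakk>
      \<Longrightarrow> x \<in> Q \<or> y \<in> Q"
  shows "prime_ideal R Q"
  unfolding prime_ideal_def
proof (intro conjI allI impI)
  fix I J assume IJ: "ideal I R" "ideal J R" "I \<cdot> J \<subseteq> Q"
  show "I \<subseteq> Q \<or> J \<subseteq> Q"
  proof (rule ccontr)
    assume "\<not> ?thesis"
    then obtain x y where xy: "x \<in> I" "x \<notin> Q" "y \<in> J" "y \<notin> Q" by blast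
    have "x \<otimes> r \<otimes> y \<in> Q" if "r \<in> carrier R" for r
      using IJ(3) ideal_prod.prod[OF ideal_r[OF IJ(1) xy(1) that] xy(3)] by blast
    then show False
      using assms(3)[of x y] xy ideal.Icarr[OF IJ(1)] ideal.Icarr[OF IJ(2)] by blast
  qed
qed (use assms in auto)

text \<open>Instead of the ideals generated by \<open>x\<close> and \<open>y\<close> the largest
  suitable ones are used: all v with v R y inside \<open>P\<close>, and all w that these v multiply
  into \<open>P\<close>. Their product lies in \<open>P\<close> by construction, and no element has
  to be expanded into a sum.\<close>

lemma prime_idealD':
  assumes P: "prime_ideal R P" and xy: "x \<in> carrier R" "y \<in> carrier R"
    and prod: "\<And>r. r \<in> carrier R \<Longrightarrow> x \<otimes> r \<otimes> y \<in> P"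
  shows "x \<in> P \<or> y \<in> P"
proof -
  have PI: "ideal P R" using P by (simp add: prime_ideal_def)
  have PR: "right_ideal R P" using PI by (rule ideal_right_ideal)
  let ?K = "{v \<in> carrier R. \<forall>r\<in>carrier R. v \<otimes> r \<otimes> y \<in> P}"
  have K: "ideal ?K R"
  proof (rule idealI'[OF right_idealI])
    show "\<zero> \<in> ?K" using xy right_ideal_zero[OF PR] by simp
    show "a \<oplus> b \<in> ?K" if "a \<in> ?K" "b \<in> ?K" for a b
      using that xy right_ideal_add[OF PR] by (simp add: l_distr)
    show "a \<otimes> r \<in> ?K" if "a \<in> ?K" "r \<in> carrier R" for a r
    proof -
      have "a \<otimes> (r \<otimes> s) \<otimes> y \<in> P" if "s \<in> carrier R" for s using that \<open>a \<in> ?K\<close> \<open>r \<in> carrier R\<close> by simp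
      then show ?thesis using that by (simp add: m_assoc)
    qed
    show "r \<otimes> a \<in> ?K" if "a \<in> ?K" "r \<in> carrier R" for a r
    proof -
      have "r \<otimes> (a \<otimes> s \<otimes> y) \<in> P" if "s \<in> carrier R" for s
        using that \<open>a \<in> ?K\<close> \<open>r \<in> carrier R\<close> ideal_l[OF PI] by simp
      then show ?thesis using that xy by (simp add: m_assoc)
    qed
  qed auto
  let ?L = "{w \<in> carrier R. \<forall>v\<in>?K. v \<otimes> w \<in> P}"
  have L: "ideal ?L R"
  proof (rule idealI'[OF right_idealI])
    show "\<zero> \<in> ?L" using right_ideal_zero[OF PR] by simp
    show "a \<oplus> b \<in> ?L" if "a \<in> ?L" "b \<in> ?L" for a b
      using that right_ideal_add[OF PR] by (simp add: r_distr)
    show "a \<otimes> r \<in> ?L" if a: "a \<in> ?L" and r: "r \<in> carrier R" for a r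
    proof (intro CollectI conjI ballI)
      show "a \<otimes> r \<in> carrier R" using a r by simp
      fix v assume v: "v \<in> ?K"
      then have "v \<otimes> a \<otimes> r \<in> P" using a r right_ideal_mult[OF PR] by blast
      then show "v \<otimes> (a \<otimes> r) \<in> P" using a r v by (simp add: m_assoc)
    qed
    show "r \<otimes> a \<in> ?L" if a: "a \<in> ?L" and r: "r \<in> carrier R" for a r
    proof (intro CollectI conjI ballI)
      show "r \<otimes> a \<in> carrier R" using a r by simp
      fix v assume v: "v \<in> ?K"
      then have "v \<otimes> r \<in> ?K" using ideal_r[OF K] r by blast
      then have "v \<otimes> r \<otimes> a \<in> P" using a by blast
      then show "v \<otimes> (r \<otimes> a) \<in> P" using a r v by (simp add: m_assoc)
    qed
  qed auto
  have "?K \<cdot> ?L \<subseteq> P"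
  proof
    fix s assume "s \<in> ?K \<cdot> ?L"
    then show "s \<in> P"
      by (induction s rule: ideal_prod.induct) (auto intro: right_ideal_add[OF PR])
  qed
  then have "?K \<subseteq> P \<or> ?L \<subseteq> P" using P K L unfolding prime_ideal_def by blast
  moreover have "x \<in> ?K" using xy prod by simp
  moreover have "y \<in> ?L"
  proof (intro CollectI conjI ballI)
    fix v assume "v \<in> ?K"
    then have "v \<in> carrier R" "v \<otimes> \<one> \<otimes> y \<in> P" by (blast, blast)
    then show "v \<otimes> y \<in> P" by simp
  qed (rule xy)
  ultimately show ?thesis by blast
qed

text \<open>Modulo \<open>Q\<close> the left ideals generated by the \<open>c i\<close> ascend. Once
  they are stationary, \<open>c (Suc i)\<close> is a left multiple of
  \<open>c i = a i \<otimes> c (Suc i)\<close>, and cancelling \<open>c (Suc i)\<close> makes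
  \<open>a i\<close> left invertible. So the factors \<open>a i\<close> are eventually units modulo
  \<open>Q\<close>.\<close>

lemma left_acc_reg_factors:
  assumes Q: "ideal Q R" and acc: "left_acc_reg (R Quot Q)"
    and c: "\<And>i::nat. regular_mod Q (c i)" and a: "\<And>i. regular_mod Q (a i)"
    and ca: "\<And>i. c i = a i \<otimes> c (Suc i)"
  shows "\<exists>n. \<forall>i\<ge>n. \<exists>u\<in>carrier R. a i \<otimes> u \<ominus> \<one> \<in> Q"
proof -
  interpret Q: ideal Q R by (rule Q)
  have QR: "right_ideal R Q" using Q by (rule ideal_right_ideal)
  let ?S = "R Quot Q"
  have cc: "c i \<in> carrier R" "a i \<in> carrier R" for i
    using c a by (blast intro: regular_mod_carr)+
  have carS: "carrier ?S = (+>) Q ` carrier R"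
    by (auto simp: FactRing_def A_RCOSETS_def')
  have mult: "(Q +> x) \<otimes>\<^bsub>?S\<^esub> (Q +> y) = Q +> (x \<otimes> y)" if "x \<in> carrier R" "y \<in> carrier R" for x y
    using that by (simp add: FactRing_def Q.rcoset_mult_add)
  have zero: "(Q +> x) = \<zero>\<^bsub>?S\<^esub> \<longleftrightarrow> x \<in> Q" if "x \<in> carrier R" for x
    using that Q.rcos_const_imp_mem a_rcos_zero[OF Q] by (auto simp: FactRing_def)
  define C where "C = (\<lambda>i. {r \<otimes>\<^bsub>?S\<^esub> (Q +> c i) | r. r \<in> carrier ?S})"
  have C: "C i = {Q +> (x \<otimes> c i) | x. x \<in> carrier R}" for i
  proof -
    have "C i = (\<lambda>x. (Q +> x) \<otimes>\<^bsub>?S\<^esub> (Q +> c i)) ` carrier R"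
      unfolding C_def carS by blast
    also have "\<dots> = (\<lambda>x. Q +> (x \<otimes> c i)) ` carrier R"
      by (rule image_cong) (simp_all add: mult cc)
    finally show ?thesis by (simp add: Setcompr_eq_image)
  qed
  have reg: "regular_element ?S (Q +> c i)" for i
    unfolding regular_element_def
  proof (intro conjI ballI impI)
    show "Q +> c i \<in> carrier ?S" unfolding carS using cc by blast
    fix z assume "z \<in> carrier ?S"
    then obtain x where x: "x \<in> carrier R" "z = Q +> x" unfolding carS by blast
    note cx = regular_mod_l[OF c x(1), of i] regular_mod_r[OF c x(1), of i]
    show "z = \<zero>\<^bsub>?S\<^esub>" if "(Q +> c i) \<otimes>\<^bsub>?S\<^esub> z = \<zero>\<^bsub>?S\<^esub>"
      using that cx(1) x cc[of i] zero[of x] zero[of "c i \<otimes> x"] mult[of "c i" x] by simp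
    show "z = \<zero>\<^bsub>?S\<^esub>" if "z \<otimes>\<^bsub>?S\<^esub> (Q +> c i) = \<zero>\<^bsub>?S\<^esub>"
      using that cx(2) x cc[of i] zero[of x] zero[of "x \<otimes> c i"] mult[of x "c i"] by simp
  qed
  have "C i \<subseteq> C (Suc i)" for i
  proof
    fix z assume "z \<in> C i"
    then obtain x where x: "x \<in> carrier R" "z = Q +> (x \<otimes> c i)" by (auto simp: C)
    have "x \<otimes> c i = (x \<otimes> a i) \<otimes> c (Suc i)" using x cc by (subst ca) (simp add: m_assoc)
    then show "z \<in> C (Suc i)" using x cc unfolding C by auto
  qed
  moreover have "\<exists>s. regular_element ?S s \<and> C i = {r \<otimes>\<^bsub>?S\<^esub> s | r. r \<in> carrier ?S}" for i
    using reg C_def by blast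
  ultimately have "\<forall>i. (\<exists>s. regular_element ?S s \<and> C i = {r \<otimes>\<^bsub>?S\<^esub> s | r. r \<in> carrier ?S}) \<and>
      C i \<subseteq> C (Suc i)"
    by simp
  then have "\<exists>n. \<forall>m\<ge>n. C m = C n"
    by (rule acc[unfolded left_acc_reg_def satisfies_acc_def, THEN spec, THEN mp])
  then obtain n where n: "\<And>m. m \<ge> n \<Longrightarrow> C m = C n" by blast
  have "\<exists>u\<in>carrier R. a i \<otimes> u \<ominus> \<one> \<in> Q" if "n \<le> i" for i
  proof -
    have "Q +> (\<one> \<otimes> c (Suc i)) \<in> C (Suc i)" unfolding C by blast
    moreover have "C (Suc i) = C i" using n[of i] n[of "Suc i"] that by simp
    ultimately obtain u where u: "u \<in> carrier R" "Q +> c (Suc i) = Q +> (u \<otimes> c i)"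
      unfolding C using cc by auto
    let ?v = "\<one> \<ominus> u \<otimes> a i"
    have "c (Suc i) \<ominus> u \<otimes> c i \<in> Q"
      using u cc quotient_eq_iff_same_a_r_cos[OF Q] by simp
    moreover have "c (Suc i) \<ominus> u \<otimes> c i = ?v \<otimes> c (Suc i)"
      using u cc by (subst (2) ca) (simp add: minus_eq l_distr l_minus m_assoc)
    ultimately have v: "?v \<in> Q" using regular_mod_r[OF c[of "Suc i"], of ?v] u cc by simp
    \<comment> \<open>A left inverse of an element regular modulo \<open>Q\<close> is also a right
      inverse: multiply by \<open>a i\<close> on the right and cancel it.\<close>
    have "(a i \<otimes> u \<ominus> \<one>) \<otimes> a i = \<ominus> (a i \<otimes> ?v)"
      using u cc by (simp add: minus_eq l_distr r_distr l_minus r_minus m_assoc minus_add a_comm)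
    also have "\<dots> \<in> Q" using v cc ideal_l[OF Q] right_ideal_uminus[OF QR] by simp
    finally have "a i \<otimes> u \<ominus> \<one> \<in> Q" using regular_mod_r[OF a[of i], of "a i \<otimes> u \<ominus> \<one>"] u cc by simp
    then show ?thesis using u by blast
  qed
  then show ?thesis by blast
qed

end

section \<open>Products of generators of maximal right ideals\<close>

locale principal_mod = semiprime_mod R N for R :: "('a, 'b) ring_scheme" (structure) and N +
  assumes principal: "maximal_right_ideal R I \<Longrightarrow> principal_right_ideal R I"
begin

text \<open>The generators \<open>a\<close> have two duties. Maximality of aR will make R/(cR + N)
  artinian for every product c. The inclusion \<open>N \<subseteq> multiples a\<close> and
  regularity of \<open>a\<close> modulo \<open>N\<close> give N = aN, and hence N = cN.\<close>

inductive_set factored :: "'a set" where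
  one: "\<one> \<in> factored"
| mult: "\<lbrakk>a \<in> carrier R; maximal_right_ideal R (multiples a); N \<subseteq> multiples a; regular_mod N a; c \<in> factored\<rbrakk>
    \<Longrightarrow> a \<otimes> c \<in> factored"

lemma factored_carrier: "c \<in> factored \<Longrightarrow> c \<in> carrier R"
  by (induction rule: factored.induct) auto

lemma factored_N: "c \<in> factored \<Longrightarrow> n \<in> N \<Longrightarrow> \<exists>n'\<in>N. n = c \<otimes> n'"
proof (induction arbitrary: n rule: factored.induct)
  case one
  then show ?case using N_carr by (intro bexI[of _ n]) auto
next
  case (mult a c)
  then obtain r where r: "r \<in> carrier R" "n = a \<otimes> r" by (auto simp: multiples_def)
  then have "r \<in> N" using mult.prems regular_mod_l[OF mult.hyps(4)] by simp
  then obtain n' where "n' \<in> N" "r = c \<otimes> n'" using mult.IH by blast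
  then show ?case
    using r mult factored_carrier N_carr by (intro bexI[of _ n']) (auto simp: m_assoc)
qed

text \<open>As 1 is \<open>factored\<close>, the right ideal of \<open>c\<close> and
  \<open>N\<close> is proper and lies in a maximal one, \<open>multiples a\<close>. The last
  condition passes from \<open>c\<close> to \<open>t\<close>, which makes the step repeatable: if c'
  is \<open>factored\<close> and lies in the right ideal of \<open>t\<close> and \<open>N\<close>,
  then a c' is \<open>factored\<close> and lies in that of \<open>c\<close> and
  \<open>N\<close>.\<close>

lemma factor_step:
  assumes c: "regular_mod N c" and none: "rgen (insert c N) \<inter> factored = {}"
  obtains a t where "maximal_right_ideal R (multiples a)" "N \<subseteq> multiples a" "c = a \<otimes> t"
    "regular_mod N a" "regular_mod N t" "rgen (insert t N) \<inter> factored = {}"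
proof -
  have cc: "c \<in> carrier R" using c by (rule regular_mod_carr)
  let ?E = "rgen (insert c N)"
  have E: "right_ideal R ?E" using cc right_ideal_N by (intro right_ideal_rgen_insert)
  have "?E \<noteq> carrier R" using none factored.one by blast
  then obtain M where M: "maximal_right_ideal R M" "?E \<subseteq> M"
    using exists_maximal_right_ideal[OF E] by blast
  then obtain a where a: "a \<in> carrier R" "M = multiples a"
    using principal[OF M(1)] by (auto simp: principal_right_ideal_def multiples_def)
  have EM: "c \<in> multiples a" "N \<subseteq> multiples a" using M(2) a rgen_incl[of "insert c N"] by auto
  then obtain t where t: "t \<in> carrier R" "c = a \<otimes> t" by (auto simp: multiples_def)
  have ct: "t \<otimes> x \<in> N \<Longrightarrow> x \<in> N" if "x \<in> carrier R" for x
  proof -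
    assume "t \<otimes> x \<in> N"
    then have "a \<otimes> (t \<otimes> x) \<in> N" using a N_l by blast
    then have "c \<otimes> x \<in> N" using t a that by (simp add: m_assoc)
    then show "x \<in> N" using regular_mod_l[OF c that] by simp
  qed
  then have annt: "right_ann t \<subseteq> N" by (auto simp: right_ann_def)
  \<comment> \<open>An \<open>x\<close> outside \<open>N\<close> killed by \<open>a\<close> would
    have a multiple \<open>n \<oplus> t \<otimes> s\<close> outside \<open>N\<close>, because the
    right ideal of \<open>t\<close> and \<open>N\<close> is essential. Then
    \<open>c \<otimes> s\<close> lies in \<open>N\<close>, so \<open>s\<close> does by regularity of
    \<open>c\<close>, a contradiction.\<close>
  have "right_ann a \<subseteq> N"
  proof
    fix x assume "x \<in> right_ann a"
    then have x: "x \<in> carrier R" "a \<otimes> x \<in> N" by (auto simp: right_ann_def)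
    show "x \<in> N"
    proof (rule ccontr)
      assume "x \<notin> N"
      then obtain r where r: "r \<in> carrier R" "x \<otimes> r \<in> rgen (insert t N)" "x \<otimes> r \<notin> N"
        using essential_principal[OF t(1) annt] x unfolding essential_over_def by blast
      then obtain n s where ns: "n \<in> N" "s \<in> carrier R" "x \<otimes> r = n \<oplus> t \<otimes> s"
        using rgen_insert_right_ideal[OF right_ideal_N t(1)] by auto
      have "a \<otimes> x \<otimes> r \<in> N" using x r N_r by blast
      then have "a \<otimes> (n \<oplus> t \<otimes> s) \<in> N" using ns(3) x r a by (simp add: m_assoc)
      then have "a \<otimes> n \<oplus> c \<otimes> s \<in> N" using ns(1,2) a t N_carr by (simp add: r_distr m_assoc)
      then have "c \<otimes> s \<in> N" using N_add_cancel(2)[of "c \<otimes> s" "a \<otimes> n"] ns a cc N_l by simp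
      then have "s \<in> N" using regular_mod_l[OF c ns(2)] by simp
      then have "x \<otimes> r \<in> N" using ns t N_add N_l by simp
      then show False using r by blast
    qed
  qed
  then have "regular_mod N a" using a regular_modI by blast
  moreover have "regular_mod N t" using t annt regular_modI by blast
  moreover have "rgen (insert t N) \<inter> factored = {}"
  proof (rule ccontr)
    assume "rgen (insert t N) \<inter> factored \<noteq> {}"
    then obtain c' where c': "c' \<in> rgen (insert t N)" "c' \<in> factored" by blast
    then obtain n s where ns: "n \<in> N" "s \<in> carrier R" "c' = n \<oplus> t \<otimes> s"
      using rgen_insert_right_ideal[OF right_ideal_N t(1)] by auto
    have "a \<otimes> c' = a \<otimes> n \<oplus> c \<otimes> s"
      unfolding ns(3) t(2) using ns(1,2) a t(1) N_carr by (simp add: r_distr m_assoc)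
    moreover have "a \<otimes> n \<in> N" using ns a N_l by blast
    ultimately have "a \<otimes> c' \<in> ?E"
      using rgen_insert_right_ideal[OF right_ideal_N cc] ns by auto
    moreover have "a \<otimes> c' \<in> factored"
      using factored.mult[OF a(1) _ EM(2) \<open>regular_mod N a\<close> c'(2)] M a by simp
    ultimately show False using none by blast
  qed
  ultimately show ?thesis using that M a EM t by blast
qed

section \<open>Annihilators of ideals of R/N, pulled back to R, and minimal primes\<close>

definition annihilator :: "'a set \<Rightarrow> 'a set" where
  "annihilator T = {q \<in> carrier R. \<forall>t\<in>T. \<forall>r\<in>carrier R. q \<otimes> r \<otimes> t \<in> N}"

lemma ideal_annihilator:
  assumes T: "T \<subseteq> carrier R"
  shows "ideal (annihilator T) R"
proof (rule idealI'[OF right_idealI])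
  have Tc: "t \<in> carrier R" if "t \<in> T" for t using T that by blast
  show "annihilator T \<subseteq> carrier R" by (auto simp: annihilator_def)
  show "\<zero> \<in> annihilator T" using Tc N_zero by (auto simp: annihilator_def)
  show "x \<oplus> y \<in> annihilator T" if "x \<in> annihilator T" "y \<in> annihilator T" for x y
    using that Tc N_add by (auto simp: annihilator_def l_distr)
  show "x \<otimes> r \<in> annihilator T" if x: "x \<in> annihilator T" and r: "r \<in> carrier R" for x r
    unfolding annihilator_def
  proof (intro CollectI conjI ballI)
    show "x \<otimes> r \<in> carrier R" using x r by (simp add: annihilator_def)
    fix t s assume ts: "t \<in> T" "s \<in> carrier R"
    then have "x \<otimes> (r \<otimes> s) \<otimes> t \<in> N" using x r by (simp add: annihilator_def)
    then show "x \<otimes> r \<otimes> s \<otimes> t \<in> N" using x r ts by (simp add: annihilator_def m_assoc)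
  qed
  show "r \<otimes> x \<in> annihilator T" if x: "x \<in> annihilator T" and r: "r \<in> carrier R" for x r
    unfolding annihilator_def
  proof (intro CollectI conjI ballI)
    show "r \<otimes> x \<in> carrier R" using x r by (simp add: annihilator_def)
    fix t s assume ts: "t \<in> T" "s \<in> carrier R"
    then have "r \<otimes> (x \<otimes> s \<otimes> t) \<in> N" using x r N_l by (simp add: annihilator_def)
    then show "r \<otimes> x \<otimes> s \<otimes> t \<in> N" using x r ts Tc by (simp add: annihilator_def m_assoc)
  qed
qed

lemma annihilatorD: "\<lbrakk>q \<in> annihilator T; t \<in> T; r \<in> carrier R\<rbrakk> \<Longrightarrow> q \<otimes> r \<otimes> t \<in> N"
  by (simp add: annihilator_def)

lemma annihilator_carr: "q \<in> annihilator T \<Longrightarrow> q \<in> carrier R"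
  by (simp add: annihilator_def)

text \<open>Any product of \<open>t \<otimes> r \<otimes> q\<close> with itself, with
  \<open>s\<close> between, contains the factor \<open>q \<otimes> s \<otimes> t\<close> from
  \<open>N\<close>; semiprimeness does the rest. Left and right annihilators of an ideal of R/N
  therefore coincide.\<close>

lemma annihilator_sym:
  assumes q: "q \<in> carrier R" and t: "t \<in> carrier R" and r: "r \<in> carrier R"
    and N: "\<And>r. r \<in> carrier R \<Longrightarrow> q \<otimes> r \<otimes> t \<in> N"
  shows "t \<otimes> r \<otimes> q \<in> N"
proof (rule semiprime)
  show "t \<otimes> r \<otimes> q \<in> carrier R" using q t r by simp
  fix s assume s: "s \<in> carrier R"
  have "t \<otimes> r \<otimes> (q \<otimes> s \<otimes> t) \<otimes> (r \<otimes> q) \<in> N"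
    using q t r N_r[OF N_l[OF N[OF s], of "t \<otimes> r"], of "r \<otimes> q"] by simp
  then show "t \<otimes> r \<otimes> q \<otimes> s \<otimes> (t \<otimes> r \<otimes> q) \<in> N"
    using q t r s by (simp add: m_assoc)
qed

lemma annihilator_symD:
  assumes "T \<subseteq> carrier R" "q \<in> annihilator T" "t \<in> T" "r \<in> carrier R"
  shows "t \<otimes> r \<otimes> q \<in> N"
  using annihilator_sym[OF annihilator_carr[OF assms(2)] _ assms(4) annihilatorD[OF assms(2,3)]] assms(1,3) by blast

text \<open>A factor \<open>c\<close> on the left of \<open>x\<close> is cancelled directly. A
  factor on the right stands between \<open>x\<close> and \<open>T\<close>; the symmetry of
  annihilators first moves it to the end of the product.\<close>

lemma regular_mod_annihilator:
  assumes T: "T \<subseteq> carrier R" and c: "regular_mod N c"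
  shows "regular_mod (annihilator T) c"
proof -
  note cc = regular_mod_carr[OF c] and c1 = regular_mod_l[OF c] and c2 = regular_mod_r[OF c]
  have Tc: "t \<in> carrier R" if "t \<in> T" for t using T that by blast
  have "x \<in> annihilator T" if x: "x \<in> carrier R" "c \<otimes> x \<in> annihilator T" for x
    unfolding annihilator_def
  proof (intro CollectI conjI ballI)
    fix t r assume tr: "t \<in> T" "r \<in> carrier R"
    then have "c \<otimes> (x \<otimes> r \<otimes> t) \<in> N" using annihilatorD[OF x(2) tr] x cc Tc by (simp add: m_assoc)
    then show "x \<otimes> r \<otimes> t \<in> N" using c1[of "x \<otimes> r \<otimes> t"] x tr Tc by blast
  qed (rule x)
  moreover have "x \<in> annihilator T" if x: "x \<in> carrier R" "x \<otimes> c \<in> annihilator T" for x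
    unfolding annihilator_def
  proof (intro CollectI conjI ballI)
    fix t r assume tr: "t \<in> T" "r \<in> carrier R"
    have "t \<otimes> s \<otimes> x \<in> N" if s: "s \<in> carrier R" for s
    proof -
      have "t \<otimes> s \<otimes> x \<otimes> c \<in> N" using annihilator_symD[OF T x(2) tr(1) s] x cc Tc tr s by (simp add: m_assoc)
      then show ?thesis using c2[of "t \<otimes> s \<otimes> x"] x tr Tc s by blast
    qed
    then show "x \<otimes> r \<otimes> t \<in> N" using annihilator_sym[OF Tc[OF tr(1)] x(1) tr(2)] by blast
  qed (rule x)
  ultimately show ?thesis unfolding regular_mod_def using cc by blast
qed

text \<open>Take \<open>t\<close> in \<open>T\<close> outside \<open>N\<close>. A prime
  \<open>P\<close> inside the annihilator cannot contain \<open>t\<close>, for then t R t would lie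
  in \<open>N\<close>. The annihilator multiplies R t into \<open>N\<close> and hence into
  \<open>P\<close>, so it lies in \<open>P\<close>.\<close>

lemma annihilator_minimal_prime:
  assumes T: "T \<subseteq> carrier R" and prime: "prime_ideal R (annihilator T)"
    and N: "\<And>P. prime_ideal R P \<Longrightarrow> N \<subseteq> P"
  shows "minimal_prime_ideal R (annihilator T)"
  unfolding minimal_prime_ideal_def
proof (intro conjI allI impI)
  fix P assume P: "prime_ideal R P" "P \<subseteq> annihilator T"
  have "\<not> T \<subseteq> N"
  proof
    assume TN: "T \<subseteq> N"
    have "carrier R \<subseteq> annihilator T" using TN N_l by (auto simp: annihilator_def)
    then show False using prime annihilator_carr unfolding prime_ideal_def by blast
  qed
  then obtain t where t: "t \<in> T" "t \<notin> N" by blast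
  have tc: "t \<in> carrier R" using t T by blast
  have "t \<notin> P"
  proof
    assume "t \<in> P"
    then have "t \<in> annihilator T" using P by blast
    then have "t \<in> N" using semiprime[OF tc] annihilatorD t by blast
    then show False using t by blast
  qed
  have "annihilator T \<subseteq> P"
  proof
    fix q assume q: "q \<in> annihilator T"
    have "q \<otimes> r \<otimes> t \<in> P" if "r \<in> carrier R" for r
      using annihilatorD[OF q t(1) that] N[OF P(1)] by blast
    then show "q \<in> P" using prime_idealD'[OF P(1) annihilator_carr[OF q] tc] \<open>t \<notin> P\<close> by blast
  qed
  then show "P = annihilator T" using P by blast
qed (rule prime)

text \<open>\<open>T1\<close> is y R T, which \<open>x\<close> annihilates, and \<open>T2\<close>
  consists of the products of the annihilator of \<open>T1\<close> with R and \<open>T\<close>. By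
  construction the annihilator of \<open>T2\<close> times that of \<open>T1\<close> annihilates
  \<open>T\<close>; semiprimeness reverses the order of this product and shows that \<open>y\<close>
  annihilates \<open>T2\<close>. Both new ideals are again annihilators, so the chain condition for
  annihilators applies to them.\<close>

lemma annihilator_split:
  assumes T: "T \<subseteq> carrier R" and x: "x \<in> carrier R" "x \<notin> annihilator T" and y: "y \<in> carrier R" "y \<notin> annihilator T"
    and xy: "\<And>r. r \<in> carrier R \<Longrightarrow> x \<otimes> r \<otimes> y \<in> annihilator T"
  obtains T1 T2 where "T1 \<subseteq> carrier R" "T2 \<subseteq> carrier R" "annihilator T \<subset> annihilator T1" "annihilator T \<subset> annihilator T2"
    "\<And>q1 q2. \<lbrakk>q1 \<in> annihilator T1; q2 \<in> annihilator T2\<rbrakk> \<Longrightarrow> q1 \<otimes> q2 \<in> annihilator T"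
proof -
  have Tc: "t \<in> carrier R" if "t \<in> T" for t using T that by blast
  have AT: "ideal (annihilator T) R" using T by (rule ideal_annihilator)
  define T1 where "T1 = {y \<otimes> r \<otimes> t | r t. r \<in> carrier R \<and> t \<in> T}"
  define T2 where "T2 = {q \<otimes> r \<otimes> t | q r t. q \<in> annihilator T1 \<and> r \<in> carrier R \<and> t \<in> T}"
  have T1: "T1 \<subseteq> carrier R" using Tc y by (auto simp: T1_def)
  have T2: "T2 \<subseteq> carrier R" using Tc annihilator_carr by (auto simp: T2_def)
  have q1: "q \<otimes> s \<otimes> (y \<otimes> r \<otimes> t) \<in> N" if "q \<in> annihilator T1" "s \<in> carrier R" "r \<in> carrier R" "t \<in> T" for q s r t
    using that by (intro annihilatorD[of q T1]) (auto simp: T1_def)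
  have q2: "q \<otimes> s \<otimes> (q' \<otimes> r \<otimes> t) \<in> N"
    if "q \<in> annihilator T2" "s \<in> carrier R" "q' \<in> annihilator T1" "r \<in> carrier R" "t \<in> T" for q q' s r t
    using that by (intro annihilatorD[of q T2]) (auto simp: T2_def)
  have "annihilator T \<subseteq> annihilator T1"
  proof
    fix q assume q: "q \<in> annihilator T"
    have "q \<otimes> s \<otimes> (y \<otimes> r \<otimes> t) \<in> N" if "s \<in> carrier R" "r \<in> carrier R" "t \<in> T" for s r t
      using annihilatorD[OF q that(3), of "s \<otimes> y \<otimes> r"] that y Tc annihilator_carr[OF q] by (simp add: m_assoc)
    then show "q \<in> annihilator T1" using annihilator_carr[OF q] by (auto simp: annihilator_def T1_def)
  qed
  moreover have "x \<in> annihilator T1"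
  proof -
    have "x \<otimes> s \<otimes> (y \<otimes> r \<otimes> t) \<in> N" if "s \<in> carrier R" "r \<in> carrier R" "t \<in> T" for s r t
      using annihilatorD[OF xy that(3), OF that(1,2)] that y x Tc by (simp add: m_assoc)
    then show ?thesis using x by (auto simp: annihilator_def T1_def)
  qed
  ultimately have "annihilator T \<subset> annihilator T1" using x by blast
  moreover have "annihilator T \<subseteq> annihilator T2"
  proof
    fix q assume q: "q \<in> annihilator T"
    have "q \<otimes> s \<otimes> (p \<otimes> r \<otimes> t) \<in> N" if "s \<in> carrier R" "p \<in> annihilator T1" "r \<in> carrier R" "t \<in> T" for s p r t
      using annihilatorD[OF q that(4), of "s \<otimes> p \<otimes> r"] that Tc annihilator_carr[OF q] annihilator_carr[OF that(2)]
      by (simp add: m_assoc)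
    then show "q \<in> annihilator T2" using annihilator_carr[OF q] by (auto simp: annihilator_def T2_def)
  qed
  moreover have "y \<in> annihilator T2"
  proof -
    have "y \<otimes> s \<otimes> (p \<otimes> r \<otimes> t) \<in> N" if s: "s \<in> carrier R" and p: "p \<in> annihilator T1" and r: "r \<in> carrier R" and t: "t \<in> T" for s p r t
    proof (rule semiprime)
      have pc: "p \<in> carrier R" using p by (rule annihilator_carr)
      show "y \<otimes> s \<otimes> (p \<otimes> r \<otimes> t) \<in> carrier R" using s pc r t Tc y by simp
      fix w assume w: "w \<in> carrier R"
      have "y \<otimes> s \<otimes> (p \<otimes> (r \<otimes> t \<otimes> w) \<otimes> (y \<otimes> (s \<otimes> p \<otimes> r) \<otimes> t)) \<in> N"
        using s pc r t Tc y w N_l[OF q1[OF p, of "r \<otimes> t \<otimes> w" "s \<otimes> p \<otimes> r" t], of "y \<otimes> s"] by simp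
      then show "y \<otimes> s \<otimes> (p \<otimes> r \<otimes> t) \<otimes> w \<otimes> (y \<otimes> s \<otimes> (p \<otimes> r \<otimes> t)) \<in> N"
        using s pc r t Tc y w by (simp add: m_assoc)
    qed
    then show ?thesis using y by (auto simp: annihilator_def T2_def)
  qed
  ultimately have "annihilator T \<subset> annihilator T2" using y by blast
  have "p \<otimes> q \<in> annihilator T" if p: "p \<in> annihilator T1" and q: "q \<in> annihilator T2" for p q
    unfolding annihilator_def
  proof (intro CollectI conjI ballI)
    have c: "p \<in> carrier R" "q \<in> carrier R" using p q annihilator_carr by auto
    show "p \<otimes> q \<in> carrier R" using c by simp
    fix t r assume tr: "t \<in> T" "r \<in> carrier R"
    have tc: "t \<in> carrier R" using tr Tc by simp
    have pq: "p \<otimes> q \<in> annihilator T1" using p c ideal_r[OF ideal_annihilator[OF T1]] by blast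
    show "p \<otimes> q \<otimes> r \<otimes> t \<in> N"
    proof (rule semiprime)
      show "p \<otimes> q \<otimes> r \<otimes> t \<in> carrier R" using c tr tc by simp
      fix w assume w: "w \<in> carrier R"
      have "p \<otimes> (q \<otimes> (r \<otimes> t \<otimes> w) \<otimes> (p \<otimes> q \<otimes> r \<otimes> t)) \<in> N"
        using c tr tc w N_l[OF q2[OF q _ pq, of "r \<otimes> t \<otimes> w" r t], of p] by simp
      then show "p \<otimes> q \<otimes> r \<otimes> t \<otimes> w \<otimes> (p \<otimes> q \<otimes> r \<otimes> t) \<in> N"
        using c tr tc w by (simp add: m_assoc)
    qed
  qed
  then show ?thesis using that T1 T2 \<open>annihilator T \<subset> annihilator T1\<close> \<open>annihilator T \<subset> annihilator T2\<close> by blast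
qed

text \<open>The double annihilators descend. An element \<open>p\<close> that is in the new
  annihilator but not in the old one yields a product \<open>p \<otimes> (r \<otimes> t)\<close>
  outside \<open>N\<close> in both the new annihilator and the old double annihilator. It is
  independent of the new double annihilator, because an ideal meets its own annihilator only in
  \<open>N\<close>.\<close>

lemma no_ascending_annihilator:
  assumes T: "\<And>i::nat. T i \<subseteq> carrier R" and asc: "\<And>i. annihilator (T i) \<subset> annihilator (T (Suc i))"
  shows False
proof -
  have Ac: "annihilator S \<subseteq> carrier R" for S using annihilator_carr by blast
  have ex: "\<exists>y. y \<in> annihilator (T (Suc i)) \<and> y \<in> annihilator (annihilator (T i)) \<and> y \<notin> N" for i
  proof -
    obtain p where p: "p \<in> annihilator (T (Suc i))" "p \<notin> annihilator (T i)" using asc[of i] by blast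
    have pc: "p \<in> carrier R" using p annihilator_carr by blast
    then obtain t r where tr: "t \<in> T i" "r \<in> carrier R" "p \<otimes> r \<otimes> t \<notin> N"
      using p(2) by (auto simp: annihilator_def)
    have tc: "t \<in> carrier R" using tr T by blast
    have "p \<otimes> (r \<otimes> t) \<in> annihilator (T (Suc i))"
      using ideal_r[OF ideal_annihilator[OF T] p(1)] tr tc by simp
    moreover have "p \<otimes> (r \<otimes> t) \<in> annihilator (annihilator (T i))"
      unfolding annihilator_def[of "annihilator (T i)"]
    proof (intro CollectI conjI ballI)
      show "p \<otimes> (r \<otimes> t) \<in> carrier R" using pc tr tc by simp
      fix q s assume q: "q \<in> annihilator (T i)" and s: "s \<in> carrier R"
      have "p \<otimes> r \<otimes> (t \<otimes> s \<otimes> q) \<in> N"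
        using annihilator_symD[OF T q tr(1) s] pc tr N_l by simp
      then show "p \<otimes> (r \<otimes> t) \<otimes> s \<otimes> q \<in> N"
        using pc tr tc s annihilator_carr[OF q] by (simp add: m_assoc)
    qed
    ultimately show ?thesis using tr pc tc by (intro exI[of _ "p \<otimes> (r \<otimes> t)"]) (simp add: m_assoc)
  qed
  then obtain y where y: "\<And>i. y i \<in> annihilator (T (Suc i)) \<and> y i \<in> annihilator (annihilator (T i)) \<and> y i \<notin> N" by metis
  have idAA: "ideal (annihilator (annihilator (T i))) R" for i using Ac by (rule ideal_annihilator)
  show False
  proof (rule descending_chain_essential[OF right_ideal_N, of "\<lambda>i. annihilator (annihilator (T i))" y])
    fix i
    show "right_ideal R (annihilator (annihilator (T i)))" using idAA by (rule ideal_right_ideal)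
    show "N \<subseteq> annihilator (annihilator (T i))" using N_r N_carr Ac by (auto simp: annihilator_def)
    show "annihilator (annihilator (T (Suc i))) \<subseteq> annihilator (annihilator (T i))"
      using asc[of i] unfolding annihilator_def[of "annihilator (T i)"] annihilator_def[of "annihilator (T (Suc i))"] by blast
    show "y i \<in> annihilator (annihilator (T i))" "y i \<notin> N" using y by auto
    fix r assume r: "r \<in> carrier R" "y i \<otimes> r \<in> annihilator (annihilator (T (Suc i)))"
    have "y i \<otimes> r \<in> annihilator (T (Suc i))" using y r ideal_r[OF ideal_annihilator[OF T]] by blast
    then show "y i \<otimes> r \<in> N" using semiprime[OF annihilator_carr[OF r(2)]] annihilatorD[OF r(2)] by blast
  qed
qed

text \<open>If ACC-reg holds modulo an ideal \<open>Q\<close> and all \<open>a i\<close>,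
  \<open>c i\<close> are regular modulo \<open>Q\<close>, then
  \<open>Q \<subseteq> multiples (a i)\<close> for only finitely many \<open>i\<close>, since
  eventually \<open>a i\<close> is a unit modulo \<open>Q\<close>. Condition (A) is the case
  \<open>Q = N\<close>. Under (B), an annihilator inside infinitely many
  \<open>multiples (a i)\<close> cannot be prime, as it would be a minimal prime; it splits into two
  larger annihilators, one of which again lies in infinitely many of them. This contradicts the
  chain condition for annihilators.\<close>

lemma no_factor_sequence:
  assumes M: "\<And>i::nat. maximal_right_ideal R (multiples (a i))" "\<And>i. N \<subseteq> multiples (a i)"
    and a: "\<And>i. regular_mod N (a i)" and c: "\<And>i. regular_mod N (c i)" "\<And>i. c i = a i \<otimes> c (Suc i)"
    and N: "\<And>P. prime_ideal R P \<Longrightarrow> N \<subseteq> P"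
    and acc: "left_acc_reg (R Quot N) \<or> (\<forall>P. minimal_prime_ideal R P \<longrightarrow> left_acc_reg (R Quot P))"
  shows False
proof -
  have ac: "a i \<in> carrier R" for i using a by (rule regular_mod_carr)
  have MR: "right_ideal R (multiples (a i))" for i using ac by (rule right_ideal_multiples)
  have eventually_not: "\<exists>n. \<forall>i\<ge>n. \<not> Q \<subseteq> multiples (a i)"
    if Q: "ideal Q R" "left_acc_reg (R Quot Q)" "\<And>i. regular_mod Q (a i)" "\<And>i. regular_mod Q (c i)" for Q
  proof -
    obtain n where n: "\<And>i. i \<ge> n \<Longrightarrow> \<exists>u\<in>carrier R. a i \<otimes> u \<ominus> \<one> \<in> Q"
      using left_acc_reg_factors[of Q c a, OF Q(1,2,4,3) c(2)] by blast
    have "\<not> Q \<subseteq> multiples (a i)" if i: "i \<ge> n" for i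
    proof
      assume "Q \<subseteq> multiples (a i)"
      then obtain u where u: "u \<in> carrier R" "a i \<otimes> u \<ominus> \<one> \<in> multiples (a i)" using n[OF i] by blast
      have "a i \<otimes> u \<ominus> (a i \<otimes> u \<ominus> \<one>) \<in> multiples (a i)"
        using right_ideal_minus[OF MR multiples_mem[OF u(1)] u(2)] .
      moreover have "a i \<otimes> u \<ominus> (a i \<otimes> u \<ominus> \<one>) = \<one>"
        using u ac[of i] by (simp add: minus_eq minus_add a_assoc[symmetric] r_neg)
      ultimately show False using maximal_right_ideal_not_one[OF M(1)] by simp
    qed
    then show ?thesis by blast
  qed
  show False
    using acc
  proof
    assume "left_acc_reg (R Quot N)"
    then show False using eventually_not[OF ideal_N _ a c(1)] M(2) by blast
  next
    assume min: "\<forall>P. minimal_prime_ideal R P \<longrightarrow> left_acc_reg (R Quot P)"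
    define bad where "bad = (\<lambda>T. T \<subseteq> carrier R \<and> (\<forall>n. \<exists>i\<ge>n. annihilator T \<subseteq> multiples (a i)))"
    have step: "\<exists>T'. bad T' \<and> annihilator T \<subset> annihilator T'" if bad: "bad T" for T
    proof -
      have T: "T \<subseteq> carrier R" and frequently: "\<And>n. \<exists>i\<ge>n. annihilator T \<subseteq> multiples (a i)"
        using bad by (auto simp: bad_def)
      have AT: "ideal (annihilator T) R" using T by (rule ideal_annihilator)
      have "annihilator T \<noteq> carrier R"
        using frequently[of 0] maximal_right_ideal_not_one[OF M(1)] by blast
      moreover have "\<not> prime_ideal R (annihilator T)"
      proof
        assume "prime_ideal R (annihilator T)"
        then have "left_acc_reg (R Quot annihilator T)" using min annihilator_minimal_prime[OF T _ N] by blast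
        then show False
          using eventually_not[OF AT] regular_mod_annihilator[OF T] a c(1) frequently by meson
      qed
      ultimately obtain x y where xy: "x \<in> carrier R" "x \<notin> annihilator T" "y \<in> carrier R" "y \<notin> annihilator T"
        "\<And>r. r \<in> carrier R \<Longrightarrow> x \<otimes> r \<otimes> y \<in> annihilator T"
        using prime_idealI'[OF AT] by blast
      obtain T1 T2 where T12: "T1 \<subseteq> carrier R" "T2 \<subseteq> carrier R" "annihilator T \<subset> annihilator T1" "annihilator T \<subset> annihilator T2"
        and prod: "\<And>q1 q2. \<lbrakk>q1 \<in> annihilator T1; q2 \<in> annihilator T2\<rbrakk> \<Longrightarrow> q1 \<otimes> q2 \<in> annihilator T"
        using annihilator_split[OF T xy] by metis
      have "bad T1 \<or> bad T2"
      proof (rule ccontr)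
        assume "\<not> ?thesis"
        then obtain n1 n2 where n: "\<And>i. i \<ge> n1 \<Longrightarrow> \<not> annihilator T1 \<subseteq> multiples (a i)" "\<And>i. i \<ge> n2 \<Longrightarrow> \<not> annihilator T2 \<subseteq> multiples (a i)"
          using T12(1,2) unfolding bad_def by meson
        \<comment> \<open>Beyond both bounds neither annihilator lies in the maximal right ideal,
          which then misses a product of elements of the two.\<close>
        obtain i where i: "i \<ge> max n1 n2" "annihilator T \<subseteq> multiples (a i)" using frequently by blast
        obtain x y where "x \<in> annihilator T1" "y \<in> annihilator T2" "x \<otimes> y \<notin> multiples (a i)"
          using maximal_right_ideal_prod[OF M(1) ideal_right_ideal[OF ideal_annihilator[OF T12(1)]] _
              ideal_right_ideal[OF ideal_annihilator[OF T12(2)]], of i] n[of i] i by auto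
        then show False using prod i by blast
      qed
      then show ?thesis using T12 by blast
    qed
    \<comment> \<open>The enlargement starts here: the annihilator of 1 lies in \<open>N\<close>,
      hence in every \<open>multiples (a i)\<close>.\<close>
    have "annihilator {\<one>} \<subseteq> N" using annihilatorD[of _ "{\<one>}" \<one> \<one>] annihilator_carr by fastforce
    then have "bad {\<one>}" unfolding bad_def using M(2) by (meson empty_subsetI insert_subset one_closed order_refl order_trans)
    then obtain T where "\<And>n::nat. bad (T n)" "\<And>n. annihilator (T n) \<subset> annihilator (T (Suc n))"
      using dependent_nat_choice[of "\<lambda>_. bad" "\<lambda>_ T T'. annihilator T \<subset> annihilator T'"] step by metis
    then show False using no_ascending_annihilator[of T] by (simp add: bad_def)
  qed
qed

text \<open>A regular element of \<open>E\<close> exists by Goldie's theorem. If \<open>E\<close>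
  contained no \<open>factored\<close> element, \<open>factor_step\<close> could be iterated forever
  from it.\<close>

lemma essential_contains_factored:
  assumes E: "essential_over N E"
    and N: "\<And>P. prime_ideal R P \<Longrightarrow> N \<subseteq> P"
    and acc: "left_acc_reg (R Quot N) \<or> (\<forall>P. minimal_prime_ideal R P \<longrightarrow> left_acc_reg (R Quot P))"
  obtains c where "c \<in> E" "c \<in> factored"
proof (rule ccontr)
  assume contr: "\<not> thesis"
  note result = that
  have ER: "right_ideal R E" "N \<subseteq> E" using E by (auto simp: essential_over_def)
  obtain s where s: "s \<in> E" "regular_mod N s" using essential_contains_regular[OF E] .
  define bad where "bad = (\<lambda>c. regular_mod N c \<and> rgen (insert c N) \<inter> factored = {})"
  have "rgen (insert s N) \<subseteq> E" using s ER by (intro rgen_least) auto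
  then have "bad s" unfolding bad_def using s contr result by blast
  moreover have "\<exists>t. bad t \<and> (\<exists>a. maximal_right_ideal R (multiples a) \<and> N \<subseteq> multiples a \<and> c = a \<otimes> t \<and> regular_mod N a)"
    if "bad c" for c
    using that factor_step[of c] unfolding bad_def by metis
  ultimately obtain c where c: "\<And>n::nat. bad (c n)" "\<And>n. \<exists>a. maximal_right_ideal R (multiples a) \<and>
      N \<subseteq> multiples a \<and> c n = a \<otimes> c (Suc n) \<and> regular_mod N a"
    using dependent_nat_choice[of "\<lambda>_. bad" "\<lambda>_ c t. \<exists>a. maximal_right_ideal R (multiples a) \<and>
      N \<subseteq> multiples a \<and> c = a \<otimes> t \<and> regular_mod N a"] by metis
  from c(2) obtain a where a: "\<And>n. maximal_right_ideal R (multiples (a n)) \<and>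
      N \<subseteq> multiples (a n) \<and> c n = a n \<otimes> c (Suc n) \<and> regular_mod N (a n)"
    by metis
  show False
  proof (rule no_factor_sequence[of a c])
    show "regular_mod N (c i)" for i using c(1) by (simp add: bad_def)
  qed (use a in blast | fact N acc)+
qed

end

section \<open>Artinian intervals of right ideals\<close>

context ring
begin

definition chain_between :: "'a set \<Rightarrow> 'a set \<Rightarrow> (nat \<Rightarrow> 'a set) \<Rightarrow> bool" where
  "chain_between A B D \<longleftrightarrow> (\<forall>i. right_ideal R (D i) \<and> A \<subseteq> D i \<and> D i \<subseteq> B \<and> D (Suc i) \<subseteq> D i)"

definition artinian :: "'a set \<Rightarrow> 'a set \<Rightarrow> bool" where
  "artinian A B \<longleftrightarrow> (\<forall>D. chain_between A B D \<longrightarrow> (\<exists>n. \<forall>m\<ge>n. D m = D n))"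

text \<open>For right ideals, \<open>artinian\<close> and \<open>almost_artinian\<close> express
  that B/A has Krull dimension at most 0 and at most 1, in terms of chains inside R only.\<close>

definition almost_artinian :: "'a set \<Rightarrow> 'a set \<Rightarrow> bool" where
  "almost_artinian A B \<longleftrightarrow> (\<forall>D. chain_between A B D \<longrightarrow> (\<exists>n. \<forall>m\<ge>n. artinian (D (Suc m)) (D m)))"

lemma artinianD: "\<lbrakk>artinian A B; chain_between A B D\<rbrakk> \<Longrightarrow> \<exists>n. \<forall>m\<ge>n. D m = D n"
  by (simp add: artinian_def)

lemma almost_artinianD:
  "\<lbrakk>almost_artinian A B; chain_between A B D\<rbrakk> \<Longrightarrow> \<exists>n. \<forall>m\<ge>n. artinian (D (Suc m)) (D m)"
  by (simp add: almost_artinian_def)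

lemma chain_betweenD:
  assumes "chain_between A B D"
  shows "right_ideal R (D i)" "A \<subseteq> D i" "D i \<subseteq> B" "i \<le> j \<Longrightarrow> D j \<subseteq> D i"
  using assms lift_Suc_antimono_le[of D i j] unfolding chain_between_def by auto

lemma artinian_mono: "\<lbrakk>artinian A B; A \<subseteq> A'; B' \<subseteq> B\<rbrakk> \<Longrightarrow> artinian A' B'"
  unfolding artinian_def chain_between_def by (meson subset_trans)

lemma artinian_refl: "artinian A A"
  unfolding artinian_def chain_between_def by (metis subset_antisym)

lemma right_ideal_modular:
  assumes X: "right_ideal R X" and Y: "right_ideal R Y" and C: "right_ideal R C" and XY: "X \<subseteq> Y"
    and Int: "Y \<inter> C \<subseteq> X" and Un: "Y \<subseteq> rgen (X \<union> C)"
  shows "X = Y"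
proof
  show "Y \<subseteq> X"
  proof
    fix y assume y: "y \<in> Y"
    then obtain x c where xc: "x \<in> X" "c \<in> C" "y = x \<oplus> c" using Un rgen_Un[OF X C] by blast
    have "c \<in> carrier R" using xc right_ideal_carr[OF C] by blast
    then have "c \<in> Y" using right_ideal_add_cancel(2)[OF Y, of c x] xc y XY by blast
    then show "y \<in> X" using xc Int right_ideal_add[OF X] by blast
  qed
qed (rule XY)

lemma chain_between_Int:
  assumes "chain_between A B D" "right_ideal R C" "A' \<subseteq> A" "A' \<subseteq> C"
  shows "chain_between A' (B \<inter> C) (\<lambda>i. D i \<inter> C)"
  using assms(2-4) chain_betweenD(1-3)[OF assms(1)] chain_betweenD(4)[OF assms(1) le_SucI[OF order_refl]]
  unfolding chain_between_def by (blast intro: right_ideal_Int)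

lemma right_ideal_Un: "\<lbrakk>right_ideal R A; right_ideal R B\<rbrakk> \<Longrightarrow> right_ideal R (rgen (A \<union> B))"
  by (rule rgen_right_ideal) (auto dest: right_ideal_carr)

lemma chain_between_Un:
  assumes "chain_between A B D" "right_ideal R C"
  shows "chain_between (rgen (A \<union> C)) (rgen (B \<union> C)) (\<lambda>i. rgen (D i \<union> C))"
  unfolding chain_between_def
proof (intro allI conjI)
  fix i
  show "right_ideal R (rgen (D i \<union> C))"
    using chain_betweenD(1)[OF assms(1)] assms(2) by (rule right_ideal_Un)
  show "rgen (A \<union> C) \<subseteq> rgen (D i \<union> C)" "rgen (D i \<union> C) \<subseteq> rgen (B \<union> C)"
    "rgen (D (Suc i) \<union> C) \<subseteq> rgen (D i \<union> C)"
    using chain_betweenD(2,3)[OF assms(1), of i] chain_betweenD(4)[OF assms(1) le_SucI[OF order_refl], of i]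
    by (intro rgen_mono; blast)+
qed

text \<open>The intersections and the sums of a chain with \<open>C\<close> both become stationary,
  and by the modular law comparable right ideals with equal intersection and equal sum coincide.
  \<open>C\<close> is in general position to \<open>X\<close> and \<open>Y\<close>, as the single
  steps of a chain require.\<close>

lemma artinian_modular:
  assumes C: "right_ideal R C"
    and Int: "artinian (X \<inter> C) (Y \<inter> C)" and Un: "artinian (rgen (X \<union> C)) (rgen (Y \<union> C))"
  shows "artinian X Y"
  unfolding artinian_def
proof (intro allI impI)
  fix D assume D: "chain_between X Y D"
  obtain n1 where n1: "\<And>m. m \<ge> n1 \<Longrightarrow> D m \<inter> C = D n1 \<inter> C"
    using artinianD[OF Int chain_between_Int[OF D C]] by blast
  obtain n2 where n2: "\<And>m. m \<ge> n2 \<Longrightarrow> rgen (D m \<union> C) = rgen (D n2 \<union> C)"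
    using artinianD[OF Un chain_between_Un[OF D C]] by blast
  have "D m = D (max n1 n2)" if m: "m \<ge> max n1 n2" for m
  proof (rule right_ideal_modular[OF chain_betweenD(1)[OF D] chain_betweenD(1)[OF D] C])
    show "D m \<subseteq> D (max n1 n2)" using chain_betweenD(4)[OF D m] .
    show "D (max n1 n2) \<inter> C \<subseteq> D m" using n1[of m] n1[of "max n1 n2"] m by auto
    show "D (max n1 n2) \<subseteq> rgen (D m \<union> C)"
      using n2[of m] n2[of "max n1 n2"] m rgen_incl[of "D (max n1 n2) \<union> C"] by auto
  qed
  then show "\<exists>n. \<forall>m\<ge>n. D m = D n" by blast
qed

lemma rgen_Un_absorb: "\<lbrakk>right_ideal R C; A \<subseteq> C\<rbrakk> \<Longrightarrow> rgen (A \<union> C) = C"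
  by (simp add: Un_absorb1 rgen_eq)

lemma artinian_trans:
  assumes "right_ideal R B" "right_ideal R C" "A \<subseteq> C" "C \<subseteq> B" "artinian A C" "artinian C B"
  shows "artinian A B"
proof (rule artinian_modular[OF assms(2)])
  have "rgen (B \<union> C) = B" using assms by (simp add: Un_absorb2 rgen_eq)
  then show "artinian (rgen (A \<union> C)) (rgen (B \<union> C))" using assms by (simp add: rgen_Un_absorb)
  show "artinian (A \<inter> C) (B \<inter> C)" using assms by (simp add: Int_absorb1 Int_absorb2)
qed

lemma almost_artinian_trans:
  assumes "right_ideal R B" "right_ideal R C" "A \<subseteq> C" "C \<subseteq> B" "almost_artinian A C" "almost_artinian C B"
  shows "almost_artinian A B"
  unfolding almost_artinian_def
proof (intro allI impI)
  fix D assume D: "chain_between A B D"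
  have "chain_between A C (\<lambda>i. D i \<inter> C)"
    using chain_between_Int[OF D assms(2) _ assms(3)] assms(4) by (simp add: Int_absorb1)
  then obtain n1 where n1: "\<And>m. m \<ge> n1 \<Longrightarrow> artinian (D (Suc m) \<inter> C) (D m \<inter> C)"
    using almost_artinianD[OF assms(5)] by blast
  have "rgen (B \<union> C) = B" using assms by (simp add: Un_absorb2 rgen_eq)
  then have "chain_between C B (\<lambda>i. rgen (D i \<union> C))"
    using chain_between_Un[OF D assms(2)] assms by (simp add: rgen_Un_absorb)
  then obtain n2 where n2: "\<And>m. m \<ge> n2 \<Longrightarrow> artinian (rgen (D (Suc m) \<union> C)) (rgen (D m \<union> C))"
    using almost_artinianD[OF assms(6)] by blast
  have "artinian (D (Suc m)) (D m)" if "m \<ge> max n1 n2" for m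
    using n1[of m] n2[of m] that artinian_modular[OF assms(2)] by simp
  then show "\<exists>n. \<forall>m\<ge>n. artinian (D (Suc m)) (D m)" by blast
qed

text \<open>Left multiplication by \<open>y\<close> maps R/I onto (yR + A)/A, and chains are pulled
  back along it.\<close>

lemma artinian_cyclic:
  assumes A: "right_ideal R A" and y: "y \<in> carrier R" and I: "artinian I (carrier R)"
    and yI: "\<And>r. r \<in> I \<Longrightarrow> y \<otimes> r \<in> A" "I \<subseteq> carrier R"
  shows "artinian A (rgen (insert y A))"
  unfolding artinian_def
proof (intro allI impI)
  fix D assume D: "chain_between A (rgen (insert y A)) D"
  let ?E = "\<lambda>i. {r \<in> carrier R. y \<otimes> r \<in> D i}"
  have "chain_between I (carrier R) ?E"
    unfolding chain_between_def
  proof (intro allI conjI)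
    fix i
    show "right_ideal R (?E i)" using chain_betweenD(1)[OF D] y by (rule right_ideal_colon)
    show "I \<subseteq> ?E i" using yI chain_betweenD(2)[OF D, of i] by blast
    show "?E (Suc i) \<subseteq> ?E i" using chain_betweenD(4)[OF D le_SucI[OF order_refl], of i] by blast
  qed auto
  then obtain n where n: "\<And>m. m \<ge> n \<Longrightarrow> ?E m = ?E n" using artinianD[OF I] by blast
  have "D m = D n" if m: "m \<ge> n" for m
  proof
    show "D m \<subseteq> D n" using chain_betweenD(4)[OF D m] .
    show "D n \<subseteq> D m"
    proof
      fix d assume d: "d \<in> D n"
      then obtain a r where ar: "a \<in> A" "r \<in> carrier R" "d = a \<oplus> y \<otimes> r"
        using chain_betweenD(3)[OF D, of n] rgen_insert_right_ideal[OF A y] by blast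
      have "a \<in> D n" "a \<in> D m" using ar chain_betweenD(2)[OF D] by auto
      have "y \<otimes> r \<in> D n"
        using right_ideal_add_cancel(2)[OF chain_betweenD(1)[OF D] _ \<open>a \<in> D n\<close>, of "y \<otimes> r"] d ar y by simp
      then have "r \<in> ?E m" using n[OF m] ar(2) by blast
      then have "y \<otimes> r \<in> D m" by blast
      then show "d \<in> D m"
        using right_ideal_add[OF chain_betweenD(1)[OF D] \<open>a \<in> D m\<close>] ar(3) by simp
    qed
  qed
  then show "\<exists>n. \<forall>m\<ge>n. D m = D n" by blast
qed

lemma artinian_maximal:
  assumes "maximal_right_ideal R M"
  shows "artinian M (carrier R)"
  unfolding artinian_def
proof (intro allI impI)
  fix D assume D: "chain_between M (carrier R) D"
  have "D i = M \<or> D i = carrier R" for i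
    using assms chain_betweenD(1,2)[OF D, of i] unfolding maximal_right_ideal_def by blast
  then show "\<exists>n. \<forall>m\<ge>n. D m = D n"
    using chain_betweenD(2,4)[OF D] by (metis order_refl subset_antisym)
qed

text \<open>Closure under right multiplication rests on \<open>I\<close> being a left ideal:
  \<open>(e \<otimes> r) \<otimes> n = e \<otimes> (r \<otimes> n)\<close>.\<close>

lemma right_ideal_colon_ideal:
  assumes T: "right_ideal R T" and I: "ideal I R"
  shows "right_ideal R {e \<in> carrier R. \<forall>n\<in>I. e \<otimes> n \<in> T}"
proof (rule right_idealI)
  have Ic: "n \<in> carrier R" if "n \<in> I" for n using that ideal.Icarr[OF I] by blast
  show "\<zero> \<in> {e \<in> carrier R. \<forall>n\<in>I. e \<otimes> n \<in> T}" using right_ideal_zero[OF T] Ic by simp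
  show "x \<oplus> y \<in> {e \<in> carrier R. \<forall>n\<in>I. e \<otimes> n \<in> T}"
    if "x \<in> {e \<in> carrier R. \<forall>n\<in>I. e \<otimes> n \<in> T}" "y \<in> {e \<in> carrier R. \<forall>n\<in>I. e \<otimes> n \<in> T}" for x y
    using that right_ideal_add[OF T] Ic by (simp add: l_distr)
  show "x \<otimes> r \<in> {e \<in> carrier R. \<forall>n\<in>I. e \<otimes> n \<in> T}"
    if "x \<in> {e \<in> carrier R. \<forall>n\<in>I. e \<otimes> n \<in> T}" "r \<in> carrier R" for x r
    using that Ic ideal_l[OF I] by (simp add: m_assoc)
qed auto

lemma ideal_Un: 
  assumes I: "ideal I R" and J: "ideal J R"
  shows "ideal (rgen (I \<union> J)) R"
proof (rule idealI')
  note RI = ideal_right_ideal[OF I] and RJ = ideal_right_ideal[OF J]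
  show "right_ideal R (rgen (I \<union> J))" using RI RJ by (rule right_ideal_Un)
  fix x r assume x: "x \<in> rgen (I \<union> J)" and r: "r \<in> carrier R"
  then obtain a b where ab: "a \<in> I" "b \<in> J" "x = a \<oplus> b" using rgen_Un[OF RI RJ] by blast
  then have "r \<otimes> x = r \<otimes> a \<oplus> r \<otimes> b"
    using r right_ideal_carr[OF RI] right_ideal_carr[OF RJ] by (simp add: r_distr)
  then show "r \<otimes> x \<in> rgen (I \<union> J)"
    using ab ideal_l[OF I] ideal_l[OF J] r unfolding rgen_Un[OF RI RJ] by blast
qed

end

text \<open>From here on ACC-reg is represented by its outcome \<open>factoring\<close>.\<close>

locale factoring_mod = principal_mod R N for R :: "('a, 'b) ring_scheme" (structure) and N +
  assumes factoring: "essential_over N E \<Longrightarrow> \<exists>c\<in>factored. c \<in> E"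
begin

text \<open>Induction along the product: R/aR is simple, and aR/(acR + N) is an image of R/(cR + N)
  under left multiplication by \<open>a\<close>.\<close>

lemma artinian_factored:
  assumes "c \<in> factored"
  shows "artinian (rgen (insert c N)) (carrier R)"
  using assms
proof (induction rule: factored.induct)
  case one
  have "rgen (insert \<one> N) = carrier R"
    using right_ideal_one right_ideal_rgen_insert[OF right_ideal_N one_closed] rgen_incl[of "insert \<one> N"]
    by simp
  then show ?case by (simp add: artinian_refl)
next
  case (mult a c)
  have c: "c \<in> carrier R" using mult.hyps(5) by (rule factored_carrier)
  let ?I = "rgen (insert (a \<otimes> c) N)"
  have P: "right_ideal R (multiples a)" using mult.hyps(1) by (rule right_ideal_multiples)
  have I: "right_ideal R ?I" using mult.hyps(1) c right_ideal_N by (intro right_ideal_rgen_insert) auto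
  have IP: "?I \<subseteq> multiples a" using P mult.hyps(3) multiples_mem[OF c] by (intro rgen_least) auto
  have ac: "a \<otimes> c \<in> ?I" "N \<subseteq> ?I" using rgen_incl[of "insert (a \<otimes> c) N"] by auto
  have "artinian ?I (rgen (insert a ?I))"
  proof (rule artinian_cyclic[OF I mult.hyps(1) mult.IH])
    have "rgen (insert c N) \<subseteq> {r \<in> carrier R. a \<otimes> r \<in> ?I}"
      using right_ideal_colon[OF I mult.hyps(1)] ac c N_carr N_l[OF _ mult.hyps(1)]
      by (intro rgen_least) auto
    then show "\<And>r. r \<in> rgen (insert c N) \<Longrightarrow> a \<otimes> r \<in> ?I" "rgen (insert c N) \<subseteq> carrier R"
      by auto
  qed
  moreover have "rgen (insert a ?I) = multiples a"
  proof
    have "a \<in> multiples a" using multiples_mem[OF one_closed, of a] mult.hyps(1) by simp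
    then show "rgen (insert a ?I) \<subseteq> multiples a" using P IP by (intro rgen_least) auto
    show "multiples a \<subseteq> rgen (insert a ?I)"
      using right_ideal_mult[OF right_ideal_rgen_insert[OF I mult.hyps(1)]] rgen_incl[of "insert a ?I"]
      by (auto simp: multiples_def)
  qed
  ultimately have "artinian ?I (multiples a)" by simp
  then show ?case
    using artinian_trans[OF right_ideal_carrier P IP right_ideal_subset[OF P]] artinian_maximal[OF mult.hyps(2)]
    by blast
qed

text \<open>\<open>N\<close> acts as zero on B/A, so the elements that \<open>y\<close> multiplies
  into \<open>X\<close> form a right ideal above \<open>N\<close>. It is essential because every
  element of \<open>B\<close> outside \<open>A\<close> has a multiple in \<open>X\<close> outside
  \<open>A\<close>; \<open>factoring\<close> then supplies \<open>c\<close>.\<close>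

lemma colon_factored:
  assumes X: "right_ideal R X" and B: "right_ideal R B" and AX: "A \<subseteq> X"
    and BN: "\<And>b n. \<lbrakk>b \<in> B; n \<in> N\<rbrakk> \<Longrightarrow> b \<otimes> n \<in> A"
    and ess: "\<And>x. \<lbrakk>x \<in> B; x \<notin> A\<rbrakk> \<Longrightarrow> \<exists>r\<in>carrier R. x \<otimes> r \<in> X \<and> x \<otimes> r \<notin> A"
    and y: "y \<in> B"
  obtains c where "c \<in> factored" "y \<otimes> c \<in> X"
proof -
  have yc: "y \<in> carrier R" using y right_ideal_carr[OF B] by blast
  let ?E = "{r \<in> carrier R. y \<otimes> r \<in> X}"
  have "essential_over N ?E"
    unfolding essential_over_def
  proof (intro conjI ballI impI)
    show "right_ideal R ?E" using X yc by (rule right_ideal_colon)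
    show "N \<subseteq> ?E" using BN[OF y] AX N_carr by blast
    fix x assume x: "x \<in> carrier R" "x \<notin> N"
    show "\<exists>r\<in>carrier R. x \<otimes> r \<in> ?E \<and> x \<otimes> r \<notin> N"
    proof (cases "y \<otimes> x \<in> A")
      case True
      then show ?thesis using x AX by (intro bexI[of _ \<one>]) auto
    next
      case False
      have "y \<otimes> x \<in> B" using right_ideal_mult[OF B y x(1)] .
      then obtain r where r: "r \<in> carrier R" "y \<otimes> x \<otimes> r \<in> X" "y \<otimes> x \<otimes> r \<notin> A"
        using ess False by blast
      have "x \<otimes> r \<notin> N" using r BN[OF y, of "x \<otimes> r"] x yc by (auto simp: m_assoc)
      then show ?thesis using r x yc by (intro bexI[of _ r]) (auto simp: m_assoc)
    qed
  qed
  then show ?thesis using factoring that by blast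
qed

text \<open>Each element of \<open>Y\<close> is multiplied into \<open>X\<close> by some
  \<open>factored\<close> c, so over \<open>X\<close> finitely many elements of \<open>Y\<close>
  generate an artinian module. Y/X itself need not be finitely generated, and the missing finiteness
  comes from \<open>finite_essential\<close>: modulo the intersection \<open>J\<close> of the chain,
  a finitely generated artinian part is essential. The chain eventually meets that part in
  \<open>J\<close> only, and is then equal to \<open>J\<close> by essentiality.\<close>

lemma artinian_essential:
  assumes X: "right_ideal R X" and Y: "right_ideal R Y" and AX: "A \<subseteq> X"
    and YN: "\<And>b n. \<lbrakk>b \<in> Y; n \<in> N\<rbrakk> \<Longrightarrow> b \<otimes> n \<in> A"
    and ess: "\<And>x. \<lbrakk>x \<in> Y; x \<notin> A\<rbrakk> \<Longrightarrow> \<exists>r\<in>carrier R. x \<otimes> r \<in> X \<and> x \<otimes> r \<notin> A"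
  shows "artinian X Y"
  unfolding artinian_def
proof (intro allI impI)
  fix D assume D: "chain_between X Y D"
  \<comment> \<open>Passing from \<open>X\<close> to the intersection forces the stationary value on
    the finitely generated part to be \<open>J\<close> itself.\<close>
  define J where "J = \<Inter>(range D)"
  have I: "right_ideal R J"
    unfolding J_def using chain_betweenD(1)[OF D] by (intro right_ideal_Inter) auto
  have XI: "X \<subseteq> J" unfolding J_def using chain_betweenD(2)[OF D] by blast
  have JD: "J \<subseteq> D i" for i by (auto simp: J_def)
  obtain F where F: "finite F" "F \<subseteq> D 0"
    "\<And>x. \<lbrakk>x \<in> D 0; x \<notin> J\<rbrakk> \<Longrightarrow> \<exists>r\<in>carrier R. x \<otimes> r \<in> rgen (J \<union> F) \<and> x \<otimes> r \<notin> J"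
    using finite_essential[OF I chain_betweenD(1)[OF D, of 0]] by blast
  have Yc: "Y \<subseteq> carrier R" using Y by (rule right_ideal_subset)
  have gen: "right_ideal R (rgen (J \<union> G))" if "G \<subseteq> Y" for G
    using that right_ideal_subset[OF I] Yc by (intro rgen_right_ideal) auto
  have "artinian J (rgen (J \<union> G))" if "finite G" "G \<subseteq> Y" for G
    using that
  proof (induction G)
    case empty
    then show ?case using rgen_eq[OF I] by (simp add: artinian_refl)
  next
    case (insert f G)
    let ?G = "rgen (J \<union> G)"
    have fc: "f \<in> carrier R" and fY: "f \<in> Y" and GY: "G \<subseteq> Y" using insert.prems Yc by auto
    have G: "right_ideal R ?G" using GY by (rule gen)
    have IG: "J \<subseteq> ?G" "G \<subseteq> ?G" using rgen_incl[of "J \<union> G"] by blast+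
    obtain c where c: "c \<in> factored" "f \<otimes> c \<in> X" using colon_factored[OF X Y AX YN ess fY] .
    have cc: "c \<in> carrier R" using c(1) by (rule factored_carrier)
    have "artinian ?G (rgen (insert f ?G))"
    proof (rule artinian_cyclic[OF G fc artinian_factored[OF c(1)]])
      have "rgen (insert c N) \<subseteq> {r \<in> carrier R. f \<otimes> r \<in> ?G}"
      proof (rule rgen_least[OF right_ideal_colon[OF G fc]])
        have "f \<otimes> n \<in> ?G" if "n \<in> N" for n using YN[OF fY that] AX XI IG by blast
        moreover have "f \<otimes> c \<in> ?G" using c XI IG by blast
        ultimately show "insert c N \<subseteq> {r \<in> carrier R. f \<otimes> r \<in> ?G}" using cc N_carr by blast
      qed
      then show "\<And>r. r \<in> rgen (insert c N) \<Longrightarrow> f \<otimes> r \<in> ?G" "rgen (insert c N) \<subseteq> carrier R"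
        by auto
    qed
    moreover have eq: "rgen (insert f ?G) = rgen (J \<union> insert f G)"
    proof
      have "J \<union> insert f G \<subseteq> rgen (insert f ?G)"
        using rgen_incl[of "insert f ?G"] IG by blast
      then show "rgen (J \<union> insert f G) \<subseteq> rgen (insert f ?G)"
        by (rule rgen_least[OF right_ideal_rgen_insert[OF G fc]])
      have "?G \<subseteq> rgen (J \<union> insert f G)" by (rule rgen_mono) blast
      moreover have "f \<in> rgen (J \<union> insert f G)" using rgen_incl[of "J \<union> insert f G"] by blast
      ultimately show "rgen (insert f ?G) \<subseteq> rgen (J \<union> insert f G)"
        using rgen_least[OF gen[OF insert.prems], of "insert f ?G"] by simp
    qed
    ultimately have 1: "artinian ?G (rgen (J \<union> insert f G))" by simp
    show ?case
      using artinian_trans[OF gen[OF insert.prems] G IG(1) _ insert.IH[OF GY] 1] rgen_incl[of "insert f ?G"] eq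
      by simp
  qed
  then have artF: "artinian J (rgen (J \<union> F))"
    using F chain_betweenD(3)[OF D, of 0] by blast
  have FY: "F \<subseteq> Y" using F chain_betweenD(3)[OF D, of 0] by blast
  let ?G = "rgen (J \<union> F)"
  have "chain_between J Y D"
    using D JD unfolding chain_between_def by blast
  then have "chain_between J (Y \<inter> ?G) (\<lambda>i. D i \<inter> ?G)"
    using rgen_incl[of "J \<union> F"] by (intro chain_between_Int[OF _ gen[OF FY]]) auto
  moreover have "artinian J (Y \<inter> ?G)" using artinian_mono[OF artF] by blast
  ultimately obtain n where n: "\<And>m. m \<ge> n \<Longrightarrow> D m \<inter> ?G = D n \<inter> ?G"
    using artinianD by blast
  have V: "D n \<inter> ?G \<subseteq> J"
  proof
    fix x assume x: "x \<in> D n \<inter> ?G"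
    have "x \<in> D i" for i
    proof (cases "n \<le> i")
      case True
      then show ?thesis using n[of i] x by blast
    next
      case False
      then show ?thesis using chain_betweenD(4)[OF D, of i n] x by auto
    qed
    then show "x \<in> J" by (simp add: J_def)
  qed
  have "D n \<subseteq> J"
  proof (rule ccontr)
    assume "\<not> ?thesis"
    then obtain x where x: "x \<in> D n" "x \<notin> J" by blast
    have "x \<in> D 0" using x chain_betweenD(4)[OF D, of 0 n] by auto
    then obtain r where r: "r \<in> carrier R" "x \<otimes> r \<in> ?G" "x \<otimes> r \<notin> J" using F(3) x by blast
    have "x \<otimes> r \<in> D n" using right_ideal_mult[OF chain_betweenD(1)[OF D] x(1) r(1)] .
    then show False using V r by blast
  qed
  then have "D m = D n" if "m \<ge> n" for m
    using chain_betweenD(4)[OF D that] JD[of m] by blast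
  then show "\<exists>n. \<forall>m\<ge>n. D m = D n" by blast
qed

text \<open>Only finitely many of the inclusions in a descending chain fail to be essential modulo
  \<open>A\<close>; these indices form \<open>S\<close>. At every other index
  \<open>artinian_essential\<close> applies.\<close>

lemma almost_artinian_annihilated:
  assumes A: "right_ideal R A" and B: "right_ideal R B"
    and BN: "\<And>b n. \<lbrakk>b \<in> B; n \<in> N\<rbrakk> \<Longrightarrow> b \<otimes> n \<in> A"
  shows "almost_artinian A B"
  unfolding almost_artinian_def
proof (intro allI impI)
  fix D assume D: "chain_between A B D"
  define S where "S = {m. \<exists>y\<in>D m. y \<notin> A \<and> (\<forall>r\<in>carrier R. y \<otimes> r \<in> D (Suc m) \<longrightarrow> y \<otimes> r \<in> A)}"
  have "finite S"
  proof (rule ccontr)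
    assume inf: "infinite S"
    have "\<exists>y. y \<in> D (enumerate S k) \<and> y \<notin> A \<and>
        (\<forall>r\<in>carrier R. y \<otimes> r \<in> D (Suc (enumerate S k)) \<longrightarrow> y \<otimes> r \<in> A)" for k
      using enumerate_in_set[OF inf, of k] unfolding S_def by blast
    then obtain y where y: "\<And>k. y k \<in> D (enumerate S k) \<and> y k \<notin> A \<and>
        (\<forall>r\<in>carrier R. y k \<otimes> r \<in> D (Suc (enumerate S k)) \<longrightarrow> y k \<otimes> r \<in> A)"
      by metis
    \<comment> \<open>Consecutive members of \<open>S\<close> may be far apart. Independence is
      known relative to \<open>D (Suc m)\<close> for \<open>m\<close> in \<open>S\<close>, so the
      next member has to be at least \<open>Suc m\<close>.\<close>
    have le: "Suc (enumerate S k) \<le> enumerate S (Suc k)" for k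
      using enumerate_step[OF inf, of k] by simp
    show False
    proof (rule descending_chain_essential[OF A, of "\<lambda>k. D (enumerate S k)" y])
      fix k
      show "right_ideal R (D (enumerate S k))" "A \<subseteq> D (enumerate S k)"
        using chain_betweenD(1,2)[OF D] by auto
      show "D (enumerate S (Suc k)) \<subseteq> D (enumerate S k)"
        using chain_betweenD(4)[OF D, of "enumerate S k" "enumerate S (Suc k)"] le[of k] by simp
      show "y k \<in> D (enumerate S k)" "y k \<notin> A" using y by auto
      fix r assume "r \<in> carrier R" "y k \<otimes> r \<in> D (enumerate S (Suc k))"
      then show "y k \<otimes> r \<in> A" using y[of k] chain_betweenD(4)[OF D le[of k]] by blast
    qed
  qed
  then obtain n where n: "\<And>m. m \<in> S \<Longrightarrow> m < n" using finite_nat_set_iff_bounded by auto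
  have "artinian (D (Suc m)) (D m)" if "m \<ge> n" for m
  proof (rule artinian_essential[OF chain_betweenD(1)[OF D] chain_betweenD(1)[OF D] chain_betweenD(2)[OF D]])
    show "b \<otimes> x \<in> A" if "b \<in> D m" "x \<in> N" for b x
      using BN that chain_betweenD(3)[OF D, of m] by blast
    have "m \<notin> S" using n[of m] that by auto
    then show "\<exists>r\<in>carrier R. x \<otimes> r \<in> D (Suc m) \<and> x \<otimes> r \<notin> A" if "x \<in> D m" "x \<notin> A" for x
      using that unfolding S_def by blast
  qed
  then show "\<exists>n. \<forall>m\<ge>n. artinian (D (Suc m)) (D m)" by blast
qed

end

section \<open>Nilpotency of the prime radical\<close>

context ring
begin

lemma rgen_finite_support_set:
  assumes "A \<subseteq> carrier R" "X \<subseteq> carrier R" "finite F" "F \<subseteq> rgen (A \<union> X)"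
  obtains Y where "finite Y" "Y \<subseteq> X" "F \<subseteq> rgen (A \<union> Y)"
proof -
  have "\<forall>f\<in>F. \<exists>Y. finite Y \<and> Y \<subseteq> X \<and> f \<in> rgen (A \<union> Y)"
    using rgen_finite_support[OF assms(1,2)] assms(4) by blast
  then obtain Y where Y: "\<And>f. f \<in> F \<Longrightarrow> finite (Y f) \<and> Y f \<subseteq> X \<and> f \<in> rgen (A \<union> Y f)"
    by metis
  show ?thesis
  proof (rule that[of "\<Union>(Y ` F)"])
    show "finite (\<Union>(Y ` F))" using Y assms(3) by blast
    show "\<Union>(Y ` F) \<subseteq> X" using Y by blast
    show "F \<subseteq> rgen (A \<union> \<Union>(Y ` F))"
    proof
      fix f assume f: "f \<in> F"
      have "rgen (A \<union> Y f) \<subseteq> rgen (A \<union> \<Union>(Y ` F))" using f by (intro rgen_mono) blast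
      then show "f \<in> rgen (A \<union> \<Union>(Y ` F))" using Y[OF f] by blast
    qed
  qed
qed

text \<open>Bare products, without the sums that \<open>ideal_prod\<close> includes: finite sets
  have a finite product, and sums are left to \<open>rgen\<close>.\<close>

definition setprod :: "'a set \<Rightarrow> 'a set \<Rightarrow> 'a set" where
  "setprod X Y = {x \<otimes> y | x y. x \<in> X \<and> y \<in> Y}"

lemma setprodI: "\<lbrakk>x \<in> X; y \<in> Y\<rbrakk> \<Longrightarrow> x \<otimes> y \<in> setprod X Y"
  by (auto simp: setprod_def)

lemma setprod_subset:
  "(\<And>x y. \<lbrakk>x \<in> X; y \<in> Y\<rbrakk> \<Longrightarrow> x \<otimes> y \<in> Z) \<Longrightarrow> setprod X Y \<subseteq> Z"
  by (auto simp: setprod_def)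

lemma setprod_carrier: "\<lbrakk>X \<subseteq> carrier R; Y \<subseteq> carrier R\<rbrakk> \<Longrightarrow> setprod X Y \<subseteq> carrier R"
  by (rule setprod_subset) auto

lemma finite_setprod: "\<lbrakk>finite X; finite Y\<rbrakk> \<Longrightarrow> finite (setprod X Y)"
  unfolding setprod_def by (rule finite_image_set2) auto

lemma finite_subset_setprod:
  assumes "finite Z" "Z \<subseteq> setprod X Y"
  obtains G H where "finite G" "G \<subseteq> X" "finite H" "H \<subseteq> Y" "Z \<subseteq> setprod G H"
proof -
  have "Z \<subseteq> (\<lambda>(x, y). x \<otimes> y) ` (X \<times> Y)" using assms(2) by (auto simp: setprod_def)
  then obtain P where P: "P \<subseteq> X \<times> Y" "finite P" "Z = (\<lambda>(x, y). x \<otimes> y) ` P"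
    using finite_subset_image[OF assms(1)] by metis
  show ?thesis
    by (rule that[of "fst ` P" "snd ` P"]) (use P in \<open>force simp: setprod_def\<close>)+
qed

text \<open>The annihilator of the simple module B/M is prime: if \<open>x\<close> is not in it,
  some \<open>b0 \<otimes> x\<close> generates B/M, so that x R y in the annihilator forces
  \<open>y\<close> into it. \<open>N\<close> lies in every prime ideal.\<close>

lemma simple_annihilated:
  assumes M: "right_ideal R M" and B: "right_ideal R B" and MB: "M \<subseteq> B" "M \<noteq> B"
    and max: "\<And>J. \<lbrakk>right_ideal R J; M \<subseteq> J; J \<subseteq> B\<rbrakk> \<Longrightarrow> J = M \<or> J = B"
    and N: "\<And>P. prime_ideal R P \<Longrightarrow> N \<subseteq> P"
    and bn: "b \<in> B" "n \<in> N"
  shows "b \<otimes> n \<in> M"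
proof -
  let ?P = "{r \<in> carrier R. \<forall>b\<in>B. b \<otimes> r \<in> M}"
  have Bc: "b \<in> carrier R" if "b \<in> B" for b using that right_ideal_carr[OF B] by blast
  have P: "ideal ?P R"
  proof (rule idealI'[OF right_idealI])
    show "\<zero> \<in> ?P" using right_ideal_zero[OF M] Bc by simp
    show "x \<oplus> y \<in> ?P" if "x \<in> ?P" "y \<in> ?P" for x y
      using that right_ideal_add[OF M] Bc by (simp add: r_distr)
    show "x \<otimes> r \<in> ?P" if x: "x \<in> ?P" and r: "r \<in> carrier R" for x r
    proof (intro CollectI conjI ballI)
      fix b assume b: "b \<in> B"
      have "b \<otimes> x \<otimes> r \<in> M" using right_ideal_mult[OF M _ r, of "b \<otimes> x"] x b by blast
      then show "b \<otimes> (x \<otimes> r) \<in> M" using x r Bc[OF b] by (simp add: m_assoc)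
    qed (use x r in simp)
    show "r \<otimes> x \<in> ?P" if x: "x \<in> ?P" and r: "r \<in> carrier R" for x r
    proof (intro CollectI conjI ballI)
      fix b assume b: "b \<in> B"
      have "b \<otimes> r \<otimes> x \<in> M" using x right_ideal_mult[OF B b r] by blast
      then show "b \<otimes> (r \<otimes> x) \<in> M" using x r Bc[OF b] by (simp add: m_assoc)
    qed (use x r in simp)
  qed auto
  have "prime_ideal R ?P"
  proof (rule prime_idealI'[OF P])
    show "?P \<noteq> carrier R"
    proof
      assume "?P = carrier R"
      then have "\<one> \<in> ?P" by simp
      then have "b \<in> M" if "b \<in> B" for b using that Bc[OF that] by force
      then show False using MB by blast
    qed
    fix x y assume x: "x \<in> carrier R" and y: "y \<in> carrier R"
      and xy: "\<And>r. r \<in> carrier R \<Longrightarrow> x \<otimes> r \<otimes> y \<in> ?P"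
    show "x \<in> ?P \<or> y \<in> ?P"
    proof (rule disjCI)
      assume "y \<notin> ?P"
      show "x \<in> ?P"
      proof (rule ccontr)
        assume "x \<notin> ?P"
        then obtain b0 where b0: "b0 \<in> B" "b0 \<otimes> x \<notin> M" using x by blast
        have b0x: "b0 \<otimes> x \<in> B" using right_ideal_mult[OF B b0(1) x] .
        let ?J = "rgen (insert (b0 \<otimes> x) M)"
        have "right_ideal R ?J" using M Bc[OF b0x] by (rule right_ideal_rgen_insert)
        moreover have "M \<subseteq> ?J" "b0 \<otimes> x \<in> ?J" using rgen_incl[of "insert (b0 \<otimes> x) M"] by auto
        moreover have "?J \<subseteq> B" using b0x MB by (intro rgen_least[OF B]) auto
        ultimately have J: "?J = B" using max[of ?J] b0 by blast
        have "b \<otimes> y \<in> M" if b: "b \<in> B" for b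
        proof -
          obtain m r where mr: "m \<in> M" "r \<in> carrier R" "b = m \<oplus> b0 \<otimes> x \<otimes> r"
            using b J rgen_insert_right_ideal[OF M Bc[OF b0x]] by blast
          have mc: "m \<in> carrier R" using mr(1) right_ideal_carr[OF M] by blast
          have "b \<otimes> y = m \<otimes> y \<oplus> b0 \<otimes> (x \<otimes> r \<otimes> y)"
            unfolding mr(3) using mr(2) mc Bc[OF b0(1)] x y by (simp add: l_distr m_assoc)
          moreover have "m \<otimes> y \<in> M" using right_ideal_mult[OF M mr(1) y] .
          moreover have "b0 \<otimes> (x \<otimes> r \<otimes> y) \<in> M" using xy[OF mr(2)] b0(1) by blast
          ultimately show ?thesis using right_ideal_add[OF M] by simp
        qed
        then show False using y \<open>y \<notin> ?P\<close> by blast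
      qed
    qed
  qed
  then show ?thesis using N bn by blast
qed

lemma rgen_mult_left:
  assumes x: "x \<in> rgen (Q \<union> X)" and b: "b \<in> carrier R" and T: "right_ideal R T"
    and Q: "\<And>q. q \<in> Q \<Longrightarrow> q \<in> carrier R \<and> b \<otimes> q \<in> T"
    and X: "\<And>x. x \<in> X \<Longrightarrow> x \<in> carrier R \<and> b \<otimes> x \<in> T"
  shows "b \<otimes> x \<in> T"
proof -
  have "rgen (Q \<union> X) \<subseteq> {r \<in> carrier R. b \<otimes> r \<in> T}"
    using Q X by (intro rgen_least[OF right_ideal_colon[OF T b]]) blast
  then show ?thesis using x by blast
qed

end

context deviation_ring
begin

text \<open>
  An idempotent ideal inside the Jacobson radical vanishes: write \<open>A \<lhd> B\<close> if \<open>B\<close> is finitely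
  generated and \<open>A \<subseteq> B F\<close> with \<open>F \<subseteq> V\<close> finite. Then \<open>A \<noteq> B\<close> by Nakayama's lemma, and \<open>\<lhd>\<close> is
  dense because \<open>F\<close> consists of sums of products of elements of \<open>V\<close>.
\<close>

lemma idempotent_ideal:
  assumes N: "\<And>P. prime_ideal R P \<Longrightarrow> N \<subseteq> P" "N \<subseteq> carrier R"
    and Q: "ideal Q R" and V: "V \<subseteq> carrier R" and VN: "V \<subseteq> rgen (Q \<union> N)"
    and VV: "V \<subseteq> rgen (Q \<union> setprod V V)"
  shows "V \<subseteq> Q"
proof (rule ccontr)
  assume "\<not> V \<subseteq> Q"
  then obtain v where v: "v \<in> V" "v \<notin> Q" by blast
  have QR: "right_ideal R Q" using Q by (rule ideal_right_ideal)
  have Qc: "Q \<subseteq> carrier R" using QR by (rule right_ideal_subset)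
  have VVc: "setprod V V \<subseteq> carrier R" using V V by (rule setprod_carrier)
  have gen: "right_ideal R (rgen (Q \<union> X))" if "X \<subseteq> carrier R" for X
    using that Qc by (intro rgen_right_ideal) auto
  have split: "\<exists>G H. finite G \<and> G \<subseteq> V \<and> finite H \<and> H \<subseteq> V \<and> F \<subseteq> rgen (Q \<union> setprod G H)"
    if F: "finite F" "F \<subseteq> V" for F
  proof -
    obtain Y where Y: "finite Y" "Y \<subseteq> setprod V V" "F \<subseteq> rgen (Q \<union> Y)"
      using rgen_finite_support_set[OF Qc VVc F(1) subset_trans[OF F(2) VV]] .
    obtain G H where GH: "finite G" "G \<subseteq> V" "finite H" "H \<subseteq> V" "Y \<subseteq> setprod G H"
      using finite_subset_setprod[OF Y(1,2)] .
    have "rgen (Q \<union> Y) \<subseteq> rgen (Q \<union> setprod G H)"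
      by (rule rgen_mono[OF Un_mono[OF order_refl GH(5)]])
    then show ?thesis
      by (intro exI[of _ G] exI[of _ H] conjI GH(1-4) subset_trans[OF Y(3)])
  qed
  \<comment> \<open>Everything is read modulo \<open>Q\<close>, and \<open>B0\<close> is a finite
    set of generators of \<open>B\<close>. Keeping \<open>A\<close> nonzero makes \<open>B\<close>
    nonzero, as Nakayama's argument requires.\<close>
  define \<Phi> where "\<Phi> = (\<lambda>A B. \<exists>B0 F. finite B0 \<and> B0 \<subseteq> carrier R \<and> finite F \<and> F \<subseteq> V \<and>
    right_ideal R A \<and> Q \<subseteq> A \<and> \<not> A \<subseteq> Q \<and> B = rgen (Q \<union> B0) \<and> A \<subseteq> rgen (Q \<union> setprod B0 F))"
  obtain G H where GH: "finite G" "G \<subseteq> V" "finite H" "H \<subseteq> V" "{v} \<subseteq> rgen (Q \<union> setprod G H)"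
    using split[of "{v}"] v(1) by auto
  have Gc: "G \<subseteq> carrier R" "H \<subseteq> carrier R" using GH V by auto
  have vc: "v \<in> carrier R" using v(1) V by blast
  have "rgen (insert v Q) \<subseteq> rgen (Q \<union> setprod G H)"
    using gen[OF setprod_carrier[OF Gc]] GH(5) rgen_incl[of "Q \<union> setprod G H"]
    by (intro rgen_least) auto
  moreover have "Q \<subseteq> rgen (insert v Q)" "\<not> rgen (insert v Q) \<subseteq> Q"
    using rgen_incl[of "insert v Q"] v(2) by auto
  ultimately have start: "\<Phi> (rgen (insert v Q)) (rgen (Q \<union> G))"
    unfolding \<Phi>_def using GH(1-4) Gc(1) right_ideal_rgen_insert[OF QR vc]
    by (intro exI[of _ G] exI[of _ H] conjI) simp_all
  show False
  proof (rule no_dense_family[of \<Phi>, OF start])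
    fix A B assume "\<Phi> A B"
    then obtain B0 F where B0: "finite B0" "B0 \<subseteq> carrier R" and F: "finite F" "F \<subseteq> V"
      and A: "right_ideal R A" "Q \<subseteq> A" "\<not> A \<subseteq> Q" and B: "B = rgen (Q \<union> B0)"
      and AB: "A \<subseteq> rgen (Q \<union> setprod B0 F)"
      unfolding \<Phi>_def by blast
    have BR: "right_ideal R B" unfolding B using B0(2) by (rule gen)
    have QB: "Q \<subseteq> B" "B0 \<subseteq> B" unfolding B using rgen_incl[of "Q \<union> B0"] by auto
    have Fc: "F \<subseteq> carrier R" using F V by blast
    show "right_ideal R A \<and> right_ideal R B" using A BR by blast
    have AsubB: "A \<subseteq> B"
    proof -
      have "setprod B0 F \<subseteq> B" using QB Fc right_ideal_mult[OF BR] by (intro setprod_subset) blast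
      then have "rgen (Q \<union> setprod B0 F) \<subseteq> B" using QB by (intro rgen_least[OF BR]) blast
      then show ?thesis using AB by blast
    qed
    have B0Q: "\<not> B0 \<subseteq> Q"
    proof
      assume "B0 \<subseteq> Q"
      then have "B = Q" unfolding B by (simp add: Un_absorb2 rgen_eq[OF QR])
      then show False using AsubB A by blast
    qed
    \<comment> \<open>Nakayama's argument: \<open>V\<close> annihilates the simple module B/M, so
      \<open>M\<close> contains every \<open>b \<otimes> f\<close> with \<open>b\<close> in
      \<open>B\<close> and \<open>f\<close> in \<open>V\<close>, and hence \<open>A\<close>.\<close>
    obtain M where M: "right_ideal R M" "Q \<subseteq> M" "M \<subseteq> B" "M \<noteq> B"
      "\<And>J. \<lbrakk>right_ideal R J; M \<subseteq> J; J \<subseteq> B\<rbrakk> \<Longrightarrow> J = M \<or> J = B"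
    proof (rule maximal_subideal[OF QR B0 B0Q, folded B], goal_cases)
      case (1 M)
      show ?case by (rule 1(1)[OF 1(2-5)]) (rule 1(6))
    qed
    have bf: "b \<otimes> f \<in> M" if b: "b \<in> B" and f: "f \<in> V" for b f
    proof (rule rgen_mult_left[OF _ right_ideal_carr[OF BR b] M(1)])
      show "f \<in> rgen (Q \<union> N)" using f VN by blast
      show "q \<in> carrier R \<and> b \<otimes> q \<in> M" if "q \<in> Q" for q
        using that Qc M(2) ideal_l[OF Q that right_ideal_carr[OF BR b]] by blast
      show "n \<in> carrier R \<and> b \<otimes> n \<in> M" if "n \<in> N" for n
        using simple_annihilated[OF M(1) BR M(3,4) M(5) N(1) b that] N(2) that by blast
    qed
    have "A \<subseteq> M"
    proof -
      have "setprod B0 F \<subseteq> M" using bf QB F(2) by (intro setprod_subset) blast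
      then have "rgen (Q \<union> setprod B0 F) \<subseteq> M" using M(2) by (intro rgen_least[OF M(1)]) blast
      then show ?thesis using AB by blast
    qed
    then show "A \<subseteq> B \<and> A \<noteq> B" using M(3,4) by blast
    \<comment> \<open>The products of \<open>B0\<close> and \<open>G\<close> generate the middle
      right ideal. As \<open>F\<close> lies in the right ideal of the products of \<open>G\<close>
      and \<open>H\<close>, the finite set \<open>H\<close> relates \<open>A\<close> to the middle,
      and \<open>G\<close> relates the middle to \<open>B\<close>.\<close>
    obtain G H where GH: "finite G" "G \<subseteq> V" "finite H" "H \<subseteq> V" "F \<subseteq> rgen (Q \<union> setprod G H)"
      using split[OF F] by blast
    have Gc: "G \<subseteq> carrier R" and Hc: "H \<subseteq> carrier R" using GH V by auto
    let ?BG = "setprod B0 G"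
    let ?C = "rgen (Q \<union> ?BG)"
    have C0: "finite ?BG" "?BG \<subseteq> carrier R"
      by (rule finite_setprod[OF B0(1) GH(1)], rule setprod_carrier[OF B0(2) Gc])
    have C: "right_ideal R ?C" using C0(2) by (rule gen)
    let ?T = "rgen (Q \<union> setprod ?BG H)"
    have T: "right_ideal R ?T" using setprod_carrier[OF C0(2) Hc] by (rule gen)
    have "A \<subseteq> ?T"
    proof -
      have "b \<otimes> f \<in> ?T" if b: "b \<in> B0" and f: "f \<in> F" for b f
      proof (rule rgen_mult_left[of f Q "setprod G H"])
        show "f \<in> rgen (Q \<union> setprod G H)" using f GH(5) by blast
        show bc: "b \<in> carrier R" using b B0(2) by blast
        show "right_ideal R ?T" by (rule T)
        show "q \<in> carrier R \<and> b \<otimes> q \<in> ?T" if "q \<in> Q" for q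
          using that Qc ideal_l[OF Q that bc] rgen_incl[of "Q \<union> setprod ?BG H"] by blast
        fix x assume "x \<in> setprod G H"
        then obtain g h where gh: "g \<in> G" "h \<in> H" "x = g \<otimes> h" by (auto simp: setprod_def)
        have "b \<otimes> g \<otimes> h \<in> setprod ?BG H" using b gh by (intro setprodI)
        then have "b \<otimes> g \<otimes> h \<in> ?T" using rgen_incl[of "Q \<union> setprod ?BG H"] by blast
        then show "x \<in> carrier R \<and> b \<otimes> x \<in> ?T"
          using gh bc subsetD[OF Gc gh(1)] subsetD[OF Hc gh(2)] by (simp add: m_assoc)
      qed
      then have "setprod B0 F \<subseteq> ?T" by (rule setprod_subset)
      then have "rgen (Q \<union> setprod B0 F) \<subseteq> ?T"
        using rgen_incl[of "Q \<union> setprod ?BG H"] by (intro rgen_least[OF T]) blast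
      then show ?thesis using AB by blast
    qed
    have "\<Phi> A ?C"
      unfolding \<Phi>_def
      by (intro exI[of _ ?BG] exI[of _ H] conjI C0 GH(3,4) A \<open>A \<subseteq> ?T\<close> refl)
    have "\<not> ?C \<subseteq> Q"
    proof -
      have "setprod ?BG H \<subseteq> ?C"
      proof (rule setprod_subset)
        fix x y assume "x \<in> ?BG" "y \<in> H"
        then have "x \<in> ?C" "y \<in> carrier R" using rgen_incl[of "Q \<union> ?BG"] Hc by auto
        then show "x \<otimes> y \<in> ?C" by (rule right_ideal_mult[OF C])
      qed
      then have "?T \<subseteq> ?C" using rgen_incl[of "Q \<union> ?BG"] by (intro rgen_least[OF C]) blast
      then show ?thesis using \<open>A \<subseteq> ?T\<close> A(3) by blast
    qed
    moreover have "Q \<subseteq> ?C" using rgen_incl[of "Q \<union> ?BG"] by blast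
    ultimately have "\<Phi> ?C B"
      unfolding \<Phi>_def
      by (intro exI[of _ B0] exI[of _ G] conjI B0 GH(1,2) C B order_refl)
    then show "\<exists>C. \<Phi> A C \<and> \<Phi> C B" using \<open>\<Phi> A ?C\<close> by blast
  qed
qed

end

section \<open>Powers of N and nilpotency\<close>

context factoring_mod
begin

primrec npow :: "nat \<Rightarrow> 'a set" where
  "npow 0 = carrier R"
| "npow (Suc k) = npow k \<cdot> N"

lemma ideal_npow: "ideal (npow k) R"
  by (induction k) (auto intro: oneideal ideal_prod_is_ideal ideal_N)

lemmas right_ideal_npow = ideal_right_ideal[OF ideal_npow]
  and npow_carr = ideal.Icarr[OF ideal_npow]

lemma npow_subset: "npow k \<subseteq> carrier R"
  using npow_carr by blast

lemma npow_mult_N: "\<lbrakk>x \<in> npow k; n \<in> N\<rbrakk> \<Longrightarrow> x \<otimes> n \<in> npow (Suc k)"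
  by (simp add: ideal_prod.prod)

lemma npow_Suc_subset:
  assumes T: "right_ideal R T" and prod: "\<And>x n. \<lbrakk>x \<in> npow k; n \<in> N\<rbrakk> \<Longrightarrow> x \<otimes> n \<in> T"
  shows "npow (Suc k) \<subseteq> T"
proof
  fix s assume "s \<in> npow (Suc k)"
  then have "s \<in> npow k \<cdot> N" by simp
  then show "s \<in> T"
    by (induction s rule: ideal_prod.induct) (auto intro: prod right_ideal_add[OF T])
qed

lemma npow_subset_N: "npow (Suc k) \<subseteq> N"
  using npow_carr by (intro npow_Suc_subset right_ideal_N) (simp add: N_l)

lemma npow_antimono: "npow (Suc k) \<subseteq> npow k"
  using right_ideal_mult[OF right_ideal_npow] N_carr
  by (intro npow_Suc_subset right_ideal_npow) simp

text \<open>Multiplying on the right by one fixed \<open>n\<close> does not respect generated right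
  ideals, as x r n need not be a multiple of x n. Quantifying over all of the two-sided ideal
  \<open>N\<close> repairs this.\<close>

lemma rgen_right_mult_N:
  assumes x: "x \<in> rgen X" and T: "right_ideal R T"
    and X: "\<And>x n. \<lbrakk>x \<in> X; n \<in> N\<rbrakk> \<Longrightarrow> x \<otimes> n \<in> T" "X \<subseteq> carrier R" and n: "n \<in> N"
  shows "x \<otimes> n \<in> T"
proof -
  have "rgen X \<subseteq> {e \<in> carrier R. \<forall>n\<in>N. e \<otimes> n \<in> T}"
    using X by (intro rgen_least[OF right_ideal_colon_ideal[OF T ideal_N]]) blast
  then show ?thesis using x n by blast
qed

lemma npow_add: "npow (i + j) \<subseteq> rgen (setprod (npow i) (npow j))"
proof (induction j)
  case 0
  have "x \<in> setprod (npow i) (carrier R)" if "x \<in> npow i" for x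
    using setprodI[OF that one_closed] npow_carr[OF that] by simp
  then show ?case using rgen_incl[of "setprod (npow i) (npow 0)"] by auto
next
  case (Suc j)
  let ?T = "rgen (setprod (npow i) (npow (Suc j)))"
  have T: "right_ideal R ?T" by (intro rgen_right_ideal setprod_carrier npow_subset)
  have "npow (Suc (i + j)) \<subseteq> ?T"
  proof (rule npow_Suc_subset[OF T])
    fix x n assume x: "x \<in> npow (i + j)" and n: "n \<in> N"
    show "x \<otimes> n \<in> ?T"
    proof (rule rgen_right_mult_N[OF _ T _ _ n])
      show "x \<in> rgen (setprod (npow i) (npow j))" using x Suc.IH by blast
      show "setprod (npow i) (npow j) \<subseteq> carrier R" by (intro setprod_carrier npow_subset)
      fix y m assume "y \<in> setprod (npow i) (npow j)" and m: "m \<in> N"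
      then obtain a b where ab: "a \<in> npow i" "b \<in> npow j" "y = a \<otimes> b" by (auto simp: setprod_def)
      have "a \<otimes> (b \<otimes> m) \<in> setprod (npow i) (npow (Suc j))"
        by (rule setprodI[OF ab(1) npow_mult_N[OF ab(2) m]])
      then have "a \<otimes> (b \<otimes> m) \<in> ?T" using rgen_incl[of "setprod (npow i) (npow (Suc j))"] by blast
      then show "y \<otimes> m \<in> ?T" using ab npow_carr N_carr[OF m] by (simp add: m_assoc)
    qed
  qed
  then show ?case by simp
qed

text \<open>
  Since \<open>N = c N\<close> for products \<open>c\<close> of generators of maximal right ideals, \<open>N^(k+1)\<close> is
  generated modulo \<open>N^(k+2)\<close> by a finite subset of \<open>N^k\<close>.
\<close>

lemma npow_finitely_generated:
  obtains G where "finite G" "G \<subseteq> npow k" "npow (Suc k) \<subseteq> rgen (npow (Suc (Suc k)) \<union> G)"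
proof -
  obtain G where G: "finite G" "G \<subseteq> npow k"
    "\<And>x. \<lbrakk>x \<in> npow k; x \<notin> npow (Suc k)\<rbrakk> \<Longrightarrow>
      \<exists>r\<in>carrier R. x \<otimes> r \<in> rgen (npow (Suc k) \<union> G) \<and> x \<otimes> r \<notin> npow (Suc k)"
    using finite_essential[OF right_ideal_npow[of "Suc k"] right_ideal_npow[of k]] by blast
  let ?E = "rgen (npow (Suc k) \<union> G)" and ?T = "rgen (npow (Suc (Suc k)) \<union> G)"
  have Gc: "G \<subseteq> carrier R" using G(2) npow_subset by blast
  have E: "right_ideal R ?E" by (intro rgen_right_ideal Un_least npow_subset Gc)
  have T: "right_ideal R ?T" by (intro rgen_right_ideal Un_least npow_subset Gc)
  have "npow (Suc k) \<subseteq> ?T"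
  proof (rule npow_Suc_subset[OF T])
    fix w n assume w: "w \<in> npow k" and n: "n \<in> N"
    have "npow (Suc k) \<subseteq> ?E" using rgen_incl[of "npow (Suc k) \<union> G"] by blast
    then obtain c where c: "c \<in> factored" "w \<otimes> c \<in> ?E"
      using colon_factored[OF E right_ideal_npow[of k] _ npow_mult_N G(3) w] by blast
    \<comment> \<open>Moving \<open>c\<close> from \<open>n\<close> to \<open>w\<close> puts
      \<open>w \<otimes> c\<close> into the right ideal generated by N^(k+1) and \<open>G\<close>.
      Multiplication by \<open>n'\<close> takes the first part into N^(k+2) and keeps the second in
      the right ideal of \<open>G\<close>.\<close>
    obtain n' where n': "n' \<in> N" "n = c \<otimes> n'" using factored_N[OF c(1) n] by blast
    have "w \<otimes> c \<otimes> n' \<in> ?T"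
    proof (rule rgen_right_mult_N[OF c(2) T _ _ n'(1)])
      show "npow (Suc k) \<union> G \<subseteq> carrier R" by (intro Un_least npow_subset Gc)
      fix x m assume x: "x \<in> npow (Suc k) \<union> G" and m: "m \<in> N"
      show "x \<otimes> m \<in> ?T"
      proof (cases "x \<in> G")
        case True
        then show ?thesis
          using rgen_incl[of "npow (Suc (Suc k)) \<union> G"] right_ideal_mult[OF T _ N_carr[OF m]] by blast
      next
        case False
        then show ?thesis
          using npow_mult_N[OF _ m, of x "Suc k"] x rgen_incl[of "npow (Suc (Suc k)) \<union> G"] by blast
      qed
    qed
    then show "w \<otimes> n \<in> ?T"
      using n' npow_carr[OF w] factored_carrier[OF c(1)] N_carr by (simp add: m_assoc)
  qed
  then show ?thesis using that G(1,2) by blast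
qed

text \<open>Modulo \<open>Q\<close> the powers k+1 and k+2 of N agree, hence so do all later ones.
  Thus N^(k+1) is idempotent modulo \<open>Q\<close>, and \<open>idempotent_ideal\<close>
  applies.\<close>

lemma npow_subset_of_generators:
  assumes N: "\<And>P. prime_ideal R P \<Longrightarrow> N \<subseteq> P" and Q: "ideal Q R"
    and sub: "npow (Suc k) \<subseteq> rgen (npow (Suc (Suc k)) \<union> Q)"
  shows "npow (Suc k) \<subseteq> Q"
proof -
  have QR: "right_ideal R Q" using Q by (rule ideal_right_ideal)
  have Qc: "Q \<subseteq> carrier R" using QR by (rule right_ideal_subset)
  have gen: "right_ideal R (rgen (Q \<union> npow m))" for m by (intro rgen_right_ideal Un_least npow_subset Qc)
  have all: "npow (Suc k) \<subseteq> rgen (Q \<union> npow (Suc k + i))" for i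
  proof (induction i)
    case 0
    then show ?case using rgen_incl[of "Q \<union> npow (Suc k)"] by auto
  next
    case (Suc i)
    let ?T = "rgen (Q \<union> npow (Suc (Suc k + i)))"
    have QT: "Q \<subseteq> ?T" "npow (Suc (Suc k + i)) \<subseteq> ?T"
      using rgen_incl[of "Q \<union> npow (Suc (Suc k + i))"] by blast+
    have "npow (Suc (Suc k)) \<subseteq> ?T"
    proof (rule npow_Suc_subset[OF gen])
      fix x n assume x: "x \<in> npow (Suc k)" and n: "n \<in> N"
      show "x \<otimes> n \<in> ?T"
      proof (rule rgen_right_mult_N[OF _ gen _ _ n])
        show "x \<in> rgen (Q \<union> npow (Suc k + i))" using x Suc.IH by blast
        show "Q \<union> npow (Suc k + i) \<subseteq> carrier R" by (intro Un_least npow_subset Qc)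
        fix y m assume y: "y \<in> Q \<union> npow (Suc k + i)" and m: "m \<in> N"
        show "y \<otimes> m \<in> ?T"
        proof (cases "y \<in> Q")
          case True
          then show ?thesis using right_ideal_mult[OF QR _ N_carr[OF m]] QT by blast
        next
          case False
          then show ?thesis using npow_mult_N[OF _ m, of y "Suc k + i"] y QT by blast
        qed
      qed
    qed
    then have "rgen (npow (Suc (Suc k)) \<union> Q) \<subseteq> ?T" using QT by (intro rgen_least[OF gen]) blast
    then show ?case using sub by auto
  qed
  show ?thesis
  proof (rule idempotent_ideal[OF N _ Q npow_subset])
    show "N \<subseteq> carrier R" using N_carr by blast
    show "npow (Suc k) \<subseteq> rgen (Q \<union> N)"
      using npow_subset_N[of k] rgen_incl[of "Q \<union> N"] by blast
    let ?S = "setprod (npow (Suc k)) (npow (Suc k))"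
    have S: "right_ideal R (rgen (Q \<union> ?S))"
      by (intro rgen_right_ideal Un_least setprod_carrier npow_subset Qc)
    \<comment> \<open>The exponent \<open>Suc k + Suc k\<close> turns the iterated inclusion into
      one about the square of N^(k+1).\<close>
    have "npow (Suc k + Suc k) \<subseteq> rgen ?S" by (rule npow_add)
    also have "rgen ?S \<subseteq> rgen (Q \<union> ?S)" by (rule rgen_mono) blast
    finally have "rgen (Q \<union> npow (Suc k + Suc k)) \<subseteq> rgen (Q \<union> ?S)"
      using rgen_incl[of "Q \<union> ?S"] by (intro rgen_least[OF S]) blast
    then show "npow (Suc k) \<subseteq> rgen (Q \<union> ?S)" using all[of "Suc k"] by blast
  qed
qed

lemma ideal_chain_Union:
  assumes "\<C> \<noteq> {}" "subset.chain {Q. ideal Q R \<and> P Q} \<C>"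
  shows "ideal (\<Union>\<C>) R"
proof (rule idealI'[OF right_ideal_chain_Union[OF _ assms]])
  have I: "ideal I R" if "I \<in> \<C>" for I using assms(2) that by (auto simp: subset.chain_def)
  then show "\<And>A. A \<in> \<C> \<Longrightarrow> right_ideal R A" by (intro ideal_right_ideal)
  show "r \<otimes> x \<in> \<Union>\<C>" if "x \<in> \<Union>\<C>" "r \<in> carrier R" for x r
    using that I ideal_l by blast
qed

text \<open>An ideal maximal among those containing no power of N is prime, so it contains N, a
  contradiction. The work lies in the chain condition of Zorn's lemma: if N^k lay in the union of a
  chain, the finite subset of N^k that generates N^(k+1) modulo N^(k+2) would lie in one member, and
  that member would contain N^(k+1).\<close>

theorem N_nilpotent:
  assumes N: "\<And>P. prime_ideal R P \<Longrightarrow> N \<subseteq> P"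
  shows "\<exists>k. npow k \<subseteq> {\<zero>}"
proof (rule ccontr)
  assume contr: "\<not> ?thesis"
  let ?F = "{Q. ideal Q R \<and> (\<forall>k. \<not> npow k \<subseteq> Q)}"
  have "\<exists>M\<in>?F. \<forall>X\<in>?F. M \<subseteq> X \<longrightarrow> X = M"
  proof (rule subset_Zorn_nonempty)
    show "?F \<noteq> {}" using zeroideal contr by blast
    fix \<C> assume C: "\<C> \<noteq> {}" "subset.chain ?F \<C>"
    have "\<not> npow k \<subseteq> \<Union>\<C>" for k
    proof
      assume k: "npow k \<subseteq> \<Union>\<C>"
      obtain G where G: "finite G" "G \<subseteq> npow k" "npow (Suc k) \<subseteq> rgen (npow (Suc (Suc k)) \<union> G)"
        using npow_finitely_generated .
      obtain Q where Q: "Q \<in> \<C>" "G \<subseteq> Q"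
        using finite_subset_Union_chain[OF G(1) subset_trans[OF G(2) k] C] by blast
      have "Q \<in> ?F" using Q(1) C(2) unfolding subset.chain_def by blast
      then have QF: "ideal Q R" "\<not> npow (Suc k) \<subseteq> Q" by blast+
      have "rgen (npow (Suc (Suc k)) \<union> G) \<subseteq> rgen (npow (Suc (Suc k)) \<union> Q)"
        using Q(2) by (intro rgen_mono) blast
      then show False using npow_subset_of_generators[OF N QF(1), of k] G(3) QF(2) by blast
    qed
    then show "\<Union>\<C> \<in> ?F" using ideal_chain_Union[OF C] by blast
  qed
  then obtain P where "P \<in> ?F" and maximal: "\<forall>X\<in>?F. P \<subseteq> X \<longrightarrow> X = P" by (rule bexE)
  then have P: "ideal P R" "\<And>k. \<not> npow k \<subseteq> P" by simp_all
  have max: "\<exists>k. npow k \<subseteq> X" if "ideal X R" "P \<subseteq> X" "X \<noteq> P" for X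
  proof (rule ccontr)
    assume "\<not> ?thesis"
    then have "X \<in> ?F" using that(1) by simp
    then show False using maximal that(2,3) by blast
  qed
  have PR: "right_ideal R P" using P(1) by (rule ideal_right_ideal)
  have "prime_ideal R P"
    unfolding prime_ideal_def
  proof (intro conjI allI impI)
    show "P \<noteq> carrier R" using P(2)[of 0] by auto
    fix I J assume I: "ideal I R" and J: "ideal J R" and IJ: "I \<cdot> J \<subseteq> P"
    note IR = ideal_right_ideal[OF I] and JR = ideal_right_ideal[OF J]
    show "I \<subseteq> P \<or> J \<subseteq> P"
    proof (rule ccontr)
      assume "\<not> ?thesis"
      then have "rgen (P \<union> I) \<noteq> P" "rgen (P \<union> J) \<noteq> P" "P \<subseteq> rgen (P \<union> I)" "P \<subseteq> rgen (P \<union> J)"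
        using rgen_incl[of "P \<union> I"] rgen_incl[of "P \<union> J"] by auto
      then obtain i j where ij: "npow i \<subseteq> rgen (P \<union> I)" "npow j \<subseteq> rgen (P \<union> J)"
        using max[OF ideal_Un[OF P(1) I]] max[OF ideal_Un[OF P(1) J]] by blast
      have "setprod (npow i) (npow j) \<subseteq> P"
      proof (rule setprod_subset)
        fix x y assume "x \<in> npow i" "y \<in> npow j"
        then obtain p a q b where x: "p \<in> P" "a \<in> I" "x = p \<oplus> a" and y: "q \<in> P" "b \<in> J" "y = q \<oplus> b"
          using ij unfolding rgen_Un[OF PR IR] rgen_Un[OF PR JR] by blast
        have c: "p \<in> carrier R" "a \<in> carrier R" "q \<in> carrier R" "b \<in> carrier R"
          using x y right_ideal_carr[OF PR] right_ideal_carr[OF IR] right_ideal_carr[OF JR] by auto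
        have "x \<otimes> y = p \<otimes> (q \<oplus> b) \<oplus> (a \<otimes> q \<oplus> a \<otimes> b)"
          unfolding x(3) y(3) using c by (simp add: l_distr r_distr a_ac)
        moreover have "p \<otimes> (q \<oplus> b) \<in> P" using ideal_r[OF P(1) x(1)] c by simp
        moreover have "a \<otimes> q \<in> P" using ideal_l[OF P(1) y(1)] c by simp
        moreover have "a \<otimes> b \<in> P" using IJ ideal_prod.prod[OF x(2) y(2)] by blast
        ultimately show "x \<otimes> y \<in> P" using right_ideal_add[OF PR] by simp
      qed
      then have "npow (i + j) \<subseteq> P" using npow_add[of i j] rgen_least[OF PR] by blast
      then show False using P(2) by blast
    qed
  qed (rule P(1))
  then show False using N P(2)[of "Suc 0"] npow_subset_N[of 0] by blast
qed

theorem almost_artinian_ring: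
  assumes N: "\<And>P. prime_ideal R P \<Longrightarrow> N \<subseteq> P"
  shows "almost_artinian {\<zero>} (carrier R)"
proof -
  have "almost_artinian (npow k) (carrier R)" for k
  proof (induction k)
    case 0
    have "almost_artinian A A" if "right_ideal R A" for A
      unfolding almost_artinian_def
    proof (intro allI impI)
      fix D assume D: "chain_between A A D"
      have "D m = A" for m using chain_betweenD(2,3)[OF D] by blast
      then show "\<exists>n. \<forall>m\<ge>n. artinian (D (Suc m)) (D m)" by (simp add: artinian_refl)
    qed
    then show ?case using right_ideal_carrier by simp
  next
    case (Suc k)
    have "almost_artinian (npow (Suc k)) (npow k)"
      by (rule almost_artinian_annihilated[OF right_ideal_npow right_ideal_npow npow_mult_N])
    then show ?case
      using almost_artinian_trans[OF right_ideal_carrier right_ideal_npow npow_antimono npow_subset _ Suc.IH]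
      by blast
  qed
  moreover obtain k where "npow k \<subseteq> {\<zero>}" using N_nilpotent[OF N] by blast
  then have "npow k = {\<zero>}" using right_ideal_zero[OF right_ideal_npow[of k]] by blast
  ultimately show ?thesis by metis
qed

end

section \<open>Krull dimension and intervals of right ideals\<close>

context right_module
begin

lemma smult_zero: "x \<in> carrier M \<Longrightarrow> \<zero>\<^bsub>R\<^esub> \<odot>\<^bsub>M\<^esub> x = \<zero>\<^bsub>M\<^esub>"
  using smult_l_distr[of "\<zero>\<^bsub>R\<^esub>" "\<zero>\<^bsub>R\<^esub>" x] smult_closed[of "\<zero>\<^bsub>R\<^esub>" x]
  by (metis M.add.r_cancel_one R.r_zero R.zero_closed)

lemma smult_uminus_one: "x \<in> carrier M \<Longrightarrow> \<ominus>\<^bsub>M\<^esub> x = (\<ominus>\<^bsub>R\<^esub> \<one>\<^bsub>R\<^esub>) \<odot>\<^bsub>M\<^esub> x"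
  using smult_l_distr[of "\<ominus>\<^bsub>R\<^esub> \<one>\<^bsub>R\<^esub>" "\<one>\<^bsub>R\<^esub>" x]
  by (intro M.minus_equality) (simp_all add: R.l_neg smult_zero smult_one smult_closed)

lemma submoduleI:
  assumes "S \<subseteq> carrier M" "\<zero>\<^bsub>M\<^esub> \<in> S" "\<And>x y. \<lbrakk>x \<in> S; y \<in> S\<rbrakk> \<Longrightarrow> x \<oplus>\<^bsub>M\<^esub> y \<in> S"
    and smult: "\<And>a x. \<lbrakk>a \<in> carrier R; x \<in> S\<rbrakk> \<Longrightarrow> a \<odot>\<^bsub>M\<^esub> x \<in> S"
  shows "submodule S R M"
proof (intro submodule.intro submodule_axioms.intro)
  have "\<ominus>\<^bsub>M\<^esub> x \<in> S" if "x \<in> S" for x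
  proof -
    have "x \<in> carrier M" using that assms(1) by blast
    then show ?thesis using smult_uminus_one[of x] smult[of "\<ominus>\<^bsub>R\<^esub> \<one>\<^bsub>R\<^esub>" x] that by simp
  qed
  then show "subgroup S (add_monoid M)"
    using assms(1-3) by (intro M.add.subgroupI) (auto simp: a_inv_def)
qed (rule smult)

lemma submoduleD:
  assumes "submodule S R M"
  shows submodule_subset: "S \<subseteq> carrier M"
    and submodule_zero: "\<zero>\<^bsub>M\<^esub> \<in> S"
    and submodule_add: "\<lbrakk>x \<in> S; y \<in> S\<rbrakk> \<Longrightarrow> x \<oplus>\<^bsub>M\<^esub> y \<in> S"
    and submodule_smult: "\<lbrakk>a \<in> carrier R; x \<in> S\<rbrakk> \<Longrightarrow> a \<odot>\<^bsub>M\<^esub> x \<in> S"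
proof -
  interpret S: submodule S R M by fact
  show "S \<subseteq> carrier M" using S.subset by simp
  show "\<zero>\<^bsub>M\<^esub> \<in> S" using S.one_closed by simp
  show "\<lbrakk>x \<in> S; y \<in> S\<rbrakk> \<Longrightarrow> x \<oplus>\<^bsub>M\<^esub> y \<in> S" using S.m_closed by simp
  show "\<lbrakk>a \<in> carrier R; x \<in> S\<rbrakk> \<Longrightarrow> a \<odot>\<^bsub>M\<^esub> x \<in> S" by (rule S.smult_closed)
qed

lemma submodule_restrict:
  assumes "submodule S R M" "submodule T R M" "S \<subseteq> T"
  shows "submodule S R (M\<lparr>carrier := T\<rparr>)"
proof -
  interpret T: right_module R "M\<lparr>carrier := T\<rparr>" using assms(2) by (rule submodule_is_right_module)
  show ?thesis
    using submoduleD[OF assms(1)] assms(3) by (intro T.submoduleI) auto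
qed

lemma quotient_projection:
  assumes B: "submodule B R M"
  shows quotient_carrier: "carrier (quotient_module M B) = (\<lambda>x. B +>\<^bsub>M\<^esub> x) ` carrier M"
    and quotient_add: "\<lbrakk>x \<in> carrier M; y \<in> carrier M\<rbrakk> \<Longrightarrow>
      (B +>\<^bsub>M\<^esub> x) \<oplus>\<^bsub>quotient_module M B\<^esub> (B +>\<^bsub>M\<^esub> y) = B +>\<^bsub>M\<^esub> (x \<oplus>\<^bsub>M\<^esub> y)"
    and quotient_smult: "\<lbrakk>a \<in> carrier R; x \<in> carrier M\<rbrakk> \<Longrightarrow>
      a \<odot>\<^bsub>quotient_module M B\<^esub> (B +>\<^bsub>M\<^esub> x) = B +>\<^bsub>M\<^esub> (a \<odot>\<^bsub>M\<^esub> x)"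
    and quotient_zero_iff: "x \<in> carrier M \<Longrightarrow>
      B +>\<^bsub>M\<^esub> x = \<zero>\<^bsub>quotient_module M B\<^esub> \<longleftrightarrow> x \<in> B"
proof -
  interpret B: submodule B R M by fact
  interpret B': abelian_subgroup B M
    by (rule abelian_subgroupI3)
      (auto intro: additive_subgroup.intro B.subgroup_axioms M.abelian_group_axioms)
  let ?c = "\<lambda>x. B +>\<^bsub>M\<^esub> x"
  show "carrier (quotient_module M B) = ?c ` carrier M"
    by (auto simp: quotient_module_def A_RCOSETS_def')
  show "\<lbrakk>x \<in> carrier M; y \<in> carrier M\<rbrakk> \<Longrightarrow> ?c x \<oplus>\<^bsub>quotient_module M B\<^esub> ?c y = ?c (x \<oplus>\<^bsub>M\<^esub> y)"
    by (simp add: quotient_module_def B'.a_rcos_sum)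
  show "?c x = \<zero>\<^bsub>quotient_module M B\<^esub> \<longleftrightarrow> x \<in> B" if "x \<in> carrier M"
    using that B'.a_rcos_self[of x] B'.a_rcos_const[of x] by (auto simp: quotient_module_def)
  show "a \<odot>\<^bsub>quotient_module M B\<^esub> ?c x = ?c (a \<odot>\<^bsub>M\<^esub> x)" if a: "a \<in> carrier R" and x: "x \<in> carrier M"
  proof -
    have "?c (a \<odot>\<^bsub>M\<^esub> y) = ?c (a \<odot>\<^bsub>M\<^esub> x)" if y: "y \<in> ?c x" for y
    proof -
      obtain b where b: "b \<in> B" "y = b \<oplus>\<^bsub>M\<^esub> x" using y by (auto simp: a_r_coset_def')
      have "a \<odot>\<^bsub>M\<^esub> y = a \<odot>\<^bsub>M\<^esub> b \<oplus>\<^bsub>M\<^esub> a \<odot>\<^bsub>M\<^esub> x"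
        using b a x submodule_subset[OF B] by (auto simp: smult_r_distr)
      moreover have "a \<odot>\<^bsub>M\<^esub> b \<in> B" using b a by (rule_tac B.smult_closed)
      ultimately have "a \<odot>\<^bsub>M\<^esub> y \<in> ?c (a \<odot>\<^bsub>M\<^esub> x)" by (auto simp: a_r_coset_def')
      then show ?thesis
        using M.a_repr_independence[OF _ smult_closed[OF a x] B.subgroup_axioms] by simp
    qed
    then have "(\<Union>y\<in>?c x. ?c (a \<odot>\<^bsub>M\<^esub> y)) = ?c (a \<odot>\<^bsub>M\<^esub> x)"
      using B'.a_rcos_self[OF x] by blast
    then show ?thesis by (simp add: quotient_module_def)
  qed
qed

end

section \<open>Module factors presented by intervals of right ideals\<close>

context ring
begin

lemma submodule_regular_iff: "submodule A R (right_regular_module R) \<longleftrightarrow> right_ideal R A"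
proof -
  interpret M: right_module R "right_regular_module R" by (rule right_regular_module_is_right_module)
  show ?thesis
  proof
    assume "submodule A R (right_regular_module R)"
    from M.submoduleD[OF this] show "right_ideal R A"
      by (intro right_idealI) (auto simp: right_regular_module_def)
  next
    assume A: "right_ideal R A"
    show "submodule A R (right_regular_module R)"
      using right_ideal_subset[OF A] right_ideal_zero[OF A] right_ideal_add[OF A] right_ideal_mult[OF A]
      by (intro M.submoduleI) (auto simp: right_regular_module_def)
  qed
qed

text \<open>\<open>Q\<close> is isomorphic to the subquotient \<open>B / A\<close> of \<open>R\<close> as a right module, via \<open>g\<close>.\<close>

definition presents :: "('a, 'c) module \<Rightarrow> 'a set \<Rightarrow> 'a set \<Rightarrow> ('a \<Rightarrow> 'c) \<Rightarrow> bool" where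
  "presents Q A B g \<longleftrightarrow> right_module R Q \<and> right_ideal R B \<and> g ` B = carrier Q \<and>
    (\<forall>x\<in>B. \<forall>y\<in>B. g (x \<oplus> y) = g x \<oplus>\<^bsub>Q\<^esub> g y) \<and>
    (\<forall>a\<in>carrier R. \<forall>x\<in>B. g (x \<otimes> a) = a \<odot>\<^bsub>Q\<^esub> g x) \<and> A = {x \<in> B. g x = \<zero>\<^bsub>Q\<^esub>}"

lemma presentsD:
  assumes "presents Q A B g"
  shows "right_module R Q" "right_ideal R B" "g ` B = carrier Q"
    "\<lbrakk>x \<in> B; y \<in> B\<rbrakk> \<Longrightarrow> g (x \<oplus> y) = g x \<oplus>\<^bsub>Q\<^esub> g y"
    "\<lbrakk>a \<in> carrier R; x \<in> B\<rbrakk> \<Longrightarrow> g (x \<otimes> a) = a \<odot>\<^bsub>Q\<^esub> g x"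
    "A = {x \<in> B. g x = \<zero>\<^bsub>Q\<^esub>}" "g \<zero> = \<zero>\<^bsub>Q\<^esub>"
proof -
  show p: "right_module R Q" "right_ideal R B" "g ` B = carrier Q"
    "\<lbrakk>x \<in> B; y \<in> B\<rbrakk> \<Longrightarrow> g (x \<oplus> y) = g x \<oplus>\<^bsub>Q\<^esub> g y"
    "\<lbrakk>a \<in> carrier R; x \<in> B\<rbrakk> \<Longrightarrow> g (x \<otimes> a) = a \<odot>\<^bsub>Q\<^esub> g x"
    "A = {x \<in> B. g x = \<zero>\<^bsub>Q\<^esub>}" for a x y
    using assms unfolding presents_def by blast+
  interpret Q: right_module R Q by (rule p)
  have z: "\<zero> \<in> B" using p(2) by (rule right_ideal_zero)
  have "g \<zero> \<in> carrier Q" using z p(3) by blast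
  then show "g \<zero> = \<zero>\<^bsub>Q\<^esub>" using p(5)[OF zero_closed z] Q.smult_zero by simp
qed

lemma presents_regular: "presents (right_regular_module R) {\<zero>} (carrier R) (\<lambda>x. x)"
  unfolding presents_def
  using right_regular_module_is_right_module right_ideal_carrier
  by (auto simp: right_regular_module_def)

lemma presents_diff:
  assumes p: "presents Q A B g" and xy: "x \<in> B" "y \<in> B" "g x = g y"
  shows "x \<ominus> y \<in> A"
proof -
  interpret Q: right_module R Q by (rule presentsD[OF p])
  note B = presentsD(2)[OF p]
  have c: "x \<in> carrier R" "y \<in> carrier R" using xy right_ideal_carr[OF B] by auto
  have d: "x \<ominus> y \<in> B" using right_ideal_minus[OF B xy(1,2)] .
  have gc: "g (x \<ominus> y) \<in> carrier Q" "g y \<in> carrier Q" using d xy presentsD(3)[OF p] by auto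
  have "g ((x \<ominus> y) \<oplus> y) = g (x \<ominus> y) \<oplus>\<^bsub>Q\<^esub> g y" using presentsD(4)[OF p d xy(2)] .
  moreover have "(x \<ominus> y) \<oplus> y = x" using c by (simp add: minus_eq a_assoc l_neg)
  ultimately have "g y = g (x \<ominus> y) \<oplus>\<^bsub>Q\<^esub> g y" using xy(3) by simp
  then have "g (x \<ominus> y) = \<zero>\<^bsub>Q\<^esub>" using gc Q.M.add.r_cancel_one by metis
  then show ?thesis using presentsD(6)[OF p] d by simp
qed

lemma presents_image_submodule:
  assumes p: "presents Q A B g" and C: "right_ideal R C" "C \<subseteq> B"
  shows "submodule (g ` C) R Q"
proof -
  interpret Q: right_module R Q by (rule presentsD[OF p])
  show ?thesis
  proof (rule Q.submoduleI)
    show "g ` C \<subseteq> carrier Q" using presentsD(3)[OF p] C by blast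
    show "\<zero>\<^bsub>Q\<^esub> \<in> g ` C" using presentsD(7)[OF p] right_ideal_zero[OF C(1)] by (metis imageI)
    fix x y assume "x \<in> g ` C" "y \<in> g ` C"
    then obtain a b where ab: "a \<in> C" "b \<in> C" "x = g a" "y = g b" by blast
    have "g (a \<oplus> b) = x \<oplus>\<^bsub>Q\<^esub> y" using presentsD(4)[OF p, of a b] ab C(2) by auto
    then show "x \<oplus>\<^bsub>Q\<^esub> y \<in> g ` C" using right_ideal_add[OF C(1) ab(1,2)] by (metis imageI)
  next
    fix r x assume r: "r \<in> carrier R" and "x \<in> g ` C"
    then obtain a where a: "a \<in> C" "x = g a" by blast
    have "g (a \<otimes> r) = r \<odot>\<^bsub>Q\<^esub> x" using presentsD(5)[OF p r, of a] a C(2) by auto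
    then show "r \<odot>\<^bsub>Q\<^esub> x \<in> g ` C" using right_ideal_mult[OF C(1) a(1) r] by (metis imageI)
  qed
qed

lemma presents_preimage:
  assumes p: "presents Q A B g" and S: "submodule S R Q"
  shows "right_ideal R {x \<in> B. g x \<in> S}" "A \<subseteq> {x \<in> B. g x \<in> S}" "g ` {x \<in> B. g x \<in> S} = S"
proof -
  interpret Q: right_module R Q by (rule presentsD[OF p])
  note B = presentsD(2)[OF p]
  show "right_ideal R {x \<in> B. g x \<in> S}"
  proof (rule right_idealI)
    show "{x \<in> B. g x \<in> S} \<subseteq> carrier R" using right_ideal_subset[OF B] by blast
    show "\<zero> \<in> {x \<in> B. g x \<in> S}"
      using right_ideal_zero[OF B] presentsD(7)[OF p] Q.submodule_zero[OF S] by simp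
    show "x \<oplus> y \<in> {x \<in> B. g x \<in> S}" if "x \<in> {x \<in> B. g x \<in> S}" "y \<in> {x \<in> B. g x \<in> S}" for x y
      using that right_ideal_add[OF B] presentsD(4)[OF p] Q.submodule_add[OF S] by simp
    show "x \<otimes> r \<in> {x \<in> B. g x \<in> S}" if "x \<in> {x \<in> B. g x \<in> S}" "r \<in> carrier R" for x r
      using that right_ideal_mult[OF B] presentsD(5)[OF p] Q.submodule_smult[OF S] by simp
  qed
  show "A \<subseteq> {x \<in> B. g x \<in> S}" using presentsD(6)[OF p] Q.submodule_zero[OF S] by auto
  show "g ` {x \<in> B. g x \<in> S} = S"
    using presentsD(3)[OF p] Q.submodule_subset[OF S] by (auto simp: image_iff)
qed

text \<open>The recursion of \<open>krull_class\<close> runs through copies of factors on a fixed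
  type. Following \<open>g\<close> by the projection and the inverse isomorphism presents the copy
  by an interval of right ideals again, so an induction on the dimension can stay inside R. The
  kernel is exactly \<open>D\<close> because \<open>D\<close> contains \<open>A\<close>.\<close>

lemma presents_factor:
  assumes p: "presents Q A B g" and C: "right_ideal R C" "C \<subseteq> B"
    and D: "right_ideal R D" "A \<subseteq> D" "D \<subseteq> C"
    and Q': "right_module R Q'" "module_iso R Q' (quotient_module (Q\<lparr>carrier := g ` C\<rparr>) (g ` D))"
  shows "\<exists>g'. presents Q' D C g'"
proof -
  interpret Q: right_module R Q by (rule presentsD[OF p])
  let ?Q = "Q\<lparr>carrier := g ` C\<rparr>"
  have subC: "submodule (g ` C) R Q" using p C by (rule presents_image_submodule)
  have subD: "submodule (g ` D) R Q"
    using p D(1) subset_trans[OF D(3) C(2)] by (rule presents_image_submodule)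
  interpret Q0: right_module R ?Q using subC by (rule Q.submodule_is_right_module)
  have sub: "submodule (g ` D) R ?Q"
    using subD subC D(3) by (intro Q.submodule_restrict) auto
  let ?N = "quotient_module ?Q (g ` D)"
  interpret N: right_module R ?N using sub by (rule Q0.quotient_module_is_right_module)
  interpret Q': right_module R Q' by (rule Q')
  obtain h where h: "bij_betw h (carrier Q') (carrier ?N)"
    "\<And>x y. \<lbrakk>x \<in> carrier Q'; y \<in> carrier Q'\<rbrakk> \<Longrightarrow> h (x \<oplus>\<^bsub>Q'\<^esub> y) = h x \<oplus>\<^bsub>?N\<^esub> h y"
    "\<And>a x. \<lbrakk>a \<in> carrier R; x \<in> carrier Q'\<rbrakk> \<Longrightarrow> h (a \<odot>\<^bsub>Q'\<^esub> x) = a \<odot>\<^bsub>?N\<^esub> h x"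
    using Q'(2) unfolding module_iso_def by blast
  define k where "k = inv_into (carrier Q') h"
  have k: "k X \<in> carrier Q'" "h (k X) = X" if "X \<in> carrier ?N" for X
    using h(1) that inv_into_into[of X h "carrier Q'"] f_inv_into_f[of X h "carrier Q'"]
    unfolding k_def bij_betw_def by auto
  have kh: "k (h x) = x" if "x \<in> carrier Q'" for x
    using h(1) that unfolding k_def bij_betw_def by (simp add: inv_into_f_f)
  have kadd: "k (X \<oplus>\<^bsub>?N\<^esub> Y) = k X \<oplus>\<^bsub>Q'\<^esub> k Y" if "X \<in> carrier ?N" "Y \<in> carrier ?N" for X Y
    using h(2)[of "k X" "k Y"] k that kh[of "k X \<oplus>\<^bsub>Q'\<^esub> k Y"] by simp
  have ksm: "k (a \<odot>\<^bsub>?N\<^esub> X) = a \<odot>\<^bsub>Q'\<^esub> k X" if "a \<in> carrier R" "X \<in> carrier ?N" for a X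
    using h(3)[of a "k X"] k that kh[of "a \<odot>\<^bsub>Q'\<^esub> k X"] by (simp add: Q'.smult_closed)
  have k0: "k X = \<zero>\<^bsub>Q'\<^esub> \<longleftrightarrow> X = \<zero>\<^bsub>?N\<^esub>" if X: "X \<in> carrier ?N" for X
  proof -
    have "k \<zero>\<^bsub>?N\<^esub> = \<zero>\<^bsub>Q'\<^esub>"
      using ksm[of \<zero> "\<zero>\<^bsub>?N\<^esub>"] k(1)[of "\<zero>\<^bsub>?N\<^esub>"] N.smult_zero[of "\<zero>\<^bsub>?N\<^esub>"]
        Q'.smult_zero[of "k \<zero>\<^bsub>?N\<^esub>"] by simp
    then show ?thesis using k(2)[OF X] k(2)[of "\<zero>\<^bsub>?N\<^esub>"] by auto
  qed
  let ?c = "\<lambda>x. g ` D +>\<^bsub>?Q\<^esub> g x"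
  have car: "carrier ?N = ?c ` C" using Q0.quotient_carrier[OF sub] by (simp add: image_image)
  have c: "?c x \<in> carrier ?N" if "x \<in> C" for x using car that by blast
  have cadd: "?c (x \<oplus> y) = ?c x \<oplus>\<^bsub>?N\<^esub> ?c y" if "x \<in> C" "y \<in> C" for x y
    using Q0.quotient_add[OF sub, of "g x" "g y"] that
      presentsD(4)[OF p subsetD[OF C(2) that(1)] subsetD[OF C(2) that(2)]] by simp
  have csm: "?c (x \<otimes> a) = a \<odot>\<^bsub>?N\<^esub> ?c x" if "a \<in> carrier R" "x \<in> C" for a x
    using Q0.quotient_smult[OF sub, of a "g x"] that
      presentsD(5)[OF p that(1) subsetD[OF C(2) that(2)]] by simp
  have c0: "?c x = \<zero>\<^bsub>?N\<^esub> \<longleftrightarrow> x \<in> D" if x: "x \<in> C" for x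
  proof -
    have "g x \<in> g ` D \<longleftrightarrow> x \<in> D"
    proof
      assume "g x \<in> g ` D"
      then obtain d where d: "d \<in> D" "g x = g d" by blast
      have "x \<ominus> d \<in> A" using presents_diff[OF p _ _ d(2)] x d(1) C(2) D(3) by blast
      then have "(x \<ominus> d) \<oplus> d \<in> D" using D(1,2) d(1) right_ideal_add by blast
      moreover have "(x \<ominus> d) \<oplus> d = x"
        using right_ideal_carr[OF C(1) x] right_ideal_carr[OF D(1) d(1)]
        by (simp add: minus_eq a_assoc l_neg)
      ultimately show "x \<in> D" by simp
    qed blast
    then show ?thesis using Q0.quotient_zero_iff[OF sub, of "g x"] x by simp
  qed
  have "presents Q' D C (\<lambda>x. k (?c x))"
    unfolding presents_def
  proof (intro conjI ballI)
    show "(\<lambda>x. k (?c x)) ` C = carrier Q'"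
    proof
      show "(\<lambda>x. k (?c x)) ` C \<subseteq> carrier Q'" using k c by blast
      show "carrier Q' \<subseteq> (\<lambda>x. k (?c x)) ` C"
      proof
        fix y assume y: "y \<in> carrier Q'"
        then have "h y \<in> carrier ?N" using h(1) by (auto simp: bij_betw_def)
        then obtain x where "x \<in> C" "h y = ?c x" unfolding car by blast
        then show "y \<in> (\<lambda>x. k (?c x)) ` C" using kh[OF y] by (metis imageI)
      qed
    qed
    show "k (?c (x \<oplus> y)) = k (?c x) \<oplus>\<^bsub>Q'\<^esub> k (?c y)" if "x \<in> C" "y \<in> C" for x y
      using cadd[OF that] kadd[OF c[OF that(1)] c[OF that(2)]] by simp
    show "k (?c (x \<otimes> a)) = a \<odot>\<^bsub>Q'\<^esub> k (?c x)" if "a \<in> carrier R" "x \<in> C" for a x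
      using csm[OF that] ksm[OF that(1) c[OF that(2)]] by simp
    show "D = {x \<in> C. k (?c x) = \<zero>\<^bsub>Q'\<^esub>}"
      using k0[OF c] c0 D(3) by blast
  qed (use Q' C in auto)
  then show ?thesis by blast
qed

lemma krull_class_right_module: "krull_class R \<beta> Q \<Longrightarrow> right_module R Q"
  by (cases \<beta>) simp_all

text \<open>In a dense family one can descend from \<open>B\<close> forever, with
  \<open>\<Phi> A (D n)\<close> providing the room for the next step. Some factor of this chain has
  smaller dimension, while \<open>\<Phi> (D (Suc n)) (D n)\<close> holds at every step, against the
  induction hypothesis. The claim covers all pairs inside the presenting interval.\<close>

lemma krull_class_no_dense_family:
  fixes \<beta> :: "'o::wellorder option" and Q :: "('a, 'm) module"
  assumes \<Phi>: "\<And>A B. \<Phi> A B \<Longrightarrow>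
      right_ideal R A \<and> right_ideal R B \<and> A \<subset> B \<and> (\<exists>C. \<Phi> A C \<and> \<Phi> C B)"
    and Q: "krull_class R \<beta> Q" "presents Q A0 B0 g" and AB: "A0 \<subseteq> A" "B \<subseteq> B0"
  shows "\<not> \<Phi> A B"
  using Q AB
proof (induction \<beta> arbitrary: Q A0 B0 g A B rule: less_induct)
  case (less \<beta>)
  note p = less.prems(2)
  show ?case
  proof
    assume AB: "\<Phi> A B"
    show False
    proof (cases \<beta>)
      case None
      then have "carrier Q = {\<zero>\<^bsub>Q\<^esub>}" using less.prems(1) by simp
      then have "A0 = B0" using presentsD(3,6)[OF p] by blast
      then show False using \<Phi>[OF AB] less.prems(3,4) by blast
    next
      case (Some \<alpha>)
      have "\<exists>D. \<forall>n::nat. \<Phi> A (D n) \<and> D n \<subseteq> B \<and> \<Phi> (D (Suc n)) (D n)"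
      proof -
        have "\<exists>C'. (\<Phi> A C' \<and> C' \<subseteq> B) \<and> \<Phi> C' C" if C: "\<Phi> A C \<and> C \<subseteq> B" for C
        proof -
          obtain C' where C': "\<Phi> A C'" "\<Phi> C' C" using \<Phi> C by blast
          then have "C' \<subseteq> C" using \<Phi>[OF C'(2)] by blast
          then show ?thesis using C C' by blast
        qed
        then show ?thesis
          using dependent_nat_choice[of "\<lambda>_ C. \<Phi> A C \<and> C \<subseteq> B" "\<lambda>_ C C'. \<Phi> C' C"] AB by auto
      qed
      then obtain D where D: "\<And>n::nat. \<Phi> A (D n)" "\<And>n. D n \<subseteq> B" "\<And>n. \<Phi> (D (Suc n)) (D n)"
        by blast
      have DR: "right_ideal R (D n)" "A \<subseteq> D n" "D (Suc n) \<subseteq> D n" for n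
        using \<Phi>[OF D(1)[of n]] \<Phi>[OF D(3)[of n]] by auto
      have DB: "D n \<subseteq> B0" for n using D(2) less.prems(4) by blast
      have "descending_chain R Q (\<lambda>n. g ` D n)"
        unfolding descending_chain_def
        by (intro allI conjI presents_image_submodule[OF p DR(1) DB] image_mono DR(3))
      then have "finite {i. \<not> (\<exists>\<gamma> (Q' :: ('a, 'm) module). \<gamma> < Some \<alpha> \<and>
          module_iso R Q' (quotient_module (Q\<lparr>carrier := g ` D i\<rparr>) (g ` D (Suc i))) \<and>
          krull_class R \<gamma> Q')}"
        by (rule less.prems(1)[unfolded Some krull_class.simps(2), THEN conjunct2, THEN spec, THEN mp])
      then have "{i. \<not> (\<exists>\<gamma> (Q' :: ('a, 'm) module). \<gamma> < Some \<alpha> \<and>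
          module_iso R Q' (quotient_module (Q\<lparr>carrier := g ` D i\<rparr>) (g ` D (Suc i))) \<and>
          krull_class R \<gamma> Q')} \<noteq> UNIV"
        using infinite_UNIV_nat by metis
      then obtain i \<gamma> and Q' :: "('a, 'm) module" where i: "\<gamma> < Some \<alpha>"
        "module_iso R Q' (quotient_module (Q\<lparr>carrier := g ` D i\<rparr>) (g ` D (Suc i)))"
        "krull_class R \<gamma> Q'"
        by blast
      obtain g' where "presents Q' (D (Suc i)) (D i) g'"
        using presents_factor[OF p DR(1) DB DR(1) subset_trans[OF less.prems(3) DR(2)] DR(3)
            krull_class_right_module[OF i(3)] i(2)] by blast
      then show False using less.IH[OF _ i(3)] i(1) Some D(3) by blast
    qed
  qed
qed

lemma krull_dim_has_deviation:
  assumes "has_right_krull_dim TYPE('o::wellorder) R"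
  shows "has_deviation R"
proof -
  obtain \<beta> :: "'o option" where \<beta>: "krull_class R \<beta> (right_regular_module R)"
    using assms by (auto simp: has_right_krull_dim_def has_krull_dim_def)
  show ?thesis
    unfolding has_deviation_def
  proof (intro allI impI)
    fix \<Phi> A B
    assume \<Phi>: "\<forall>A B. \<Phi> A B \<longrightarrow>
      right_ideal R A \<and> right_ideal R B \<and> A \<subset> B \<and> (\<exists>C. \<Phi> A C \<and> \<Phi> C B)"
    show "\<not> \<Phi> A B"
    proof
      assume AB: "\<Phi> A B"
      then have "right_ideal R A" "right_ideal R B" using \<Phi> by blast+
      then have "{\<zero>} \<subseteq> A" "B \<subseteq> carrier R" using right_ideal_zero right_ideal_subset by blast+
      then show False
        using krull_class_no_dense_family[of \<Phi>, OF _ \<beta> presents_regular] \<Phi> AB by metis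
    qed
  qed
qed

text \<open>In a dense family the lower member can be raised forever below a fixed upper one, which
  gives a strictly ascending chain.\<close>

lemma noetherian_has_deviation:
  assumes acc: "satisfies_acc (right_ideal R)"
  shows "has_deviation R"
  unfolding has_deviation_def
proof (intro allI impI notI)
  fix \<Phi> A B
  assume \<Phi>: "\<forall>A B. \<Phi> A B \<longrightarrow>
    right_ideal R A \<and> right_ideal R B \<and> A \<subset> B \<and> (\<exists>C. \<Phi> A C \<and> \<Phi> C B)" and AB: "\<Phi> A B"
  have "\<exists>C'. \<Phi> C' B \<and> C \<subset> C'" if C: "\<Phi> C B" for C
  proof -
    obtain C' where C': "\<Phi> C C'" "\<Phi> C' B" using \<Phi> C by blast
    then have "C \<subset> C'" using \<Phi> by blast
    then show ?thesis using C' by blast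
  qed
  then obtain D where D: "\<And>n::nat. \<Phi> (D n) B" "\<And>n. D n \<subset> D (Suc n)"
    using dependent_nat_choice[of "\<lambda>_ C. \<Phi> C B" "\<lambda>_ C C'. C \<subset> C'"] AB by metis
  have "right_ideal R (D i)" "D i \<subseteq> D (Suc i)" for i using \<Phi> D(1)[of i] D(2)[of i] by blast+
  then have "\<forall>i. right_ideal R (D i) \<and> D i \<subseteq> D (Suc i)" by blast
  then have "\<exists>n. \<forall>m\<ge>n. D m = D n"
    by (rule acc[unfolded satisfies_acc_def, THEN spec, THEN mp])
  then obtain n where n: "\<And>m. m \<ge> n \<Longrightarrow> D m = D n" by blast
  show False using D(2)[of n] n[of "Suc n"] by simp
qed

text \<open>Preimages under \<open>g\<close> turn a chain of submodules into a chain between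
  \<open>A\<close> and \<open>B\<close>. Once it is stationary the factors are zero, and they have
  the index \<open>None\<close>, that is -1, below \<open>Some 0\<close>.\<close>

lemma artinian_krull_class:
  fixes Q :: "('a, 'm) module"
  assumes artinian: "artinian A B" and p: "presents Q A B g"
  shows "krull_class R (Some (0::nat)) Q"
  unfolding krull_class.simps(2)
proof (intro conjI allI impI)
  show Q: "right_module R Q" by (rule presentsD[OF p])
  interpret Q: right_module R Q by (rule Q)
  fix C assume "descending_chain R Q C"
  then have C: "\<And>i. submodule (C i) R Q" "\<And>i. C (Suc i) \<subseteq> C i"
    by (auto simp: descending_chain_def)
  have "chain_between A B (\<lambda>i. {x \<in> B. g x \<in> C i})"
    unfolding chain_between_def using presents_preimage(1,2)[OF p C(1)] C(2) by blast
  then obtain n where n: "\<And>m. m \<ge> n \<Longrightarrow> {x \<in> B. g x \<in> C m} = {x \<in> B. g x \<in> C n}"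
    using artinianD[OF artinian] by blast
  have stable: "C m = C n" if "m \<ge> n" for m
    using presents_preimage(3)[OF p C(1)] n[OF that] by metis
  have "\<exists>\<beta> (Q' :: ('a, 'm) module). \<beta> < Some (0::nat) \<and>
      module_iso R Q' (quotient_module (Q\<lparr>carrier := C m\<rparr>) (C (Suc m))) \<and> krull_class R \<beta> Q'"
    if m: "m \<ge> n" for m
  proof -
    have eq: "C (Suc m) = C m" using stable[of m] stable[of "Suc m"] m by simp
    let ?Q = "Q\<lparr>carrier := C m\<rparr>"
    interpret Q0: right_module R ?Q using C(1) by (rule Q.submodule_is_right_module)
    have sub: "submodule (C m) R ?Q" using Q.submodule_restrict[OF C(1) C(1)] by blast
    obtain Q' :: "('a, 'm) module"
      where Q': "right_module R Q'" "module_iso R Q' (quotient_module ?Q (C m))"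
      using Q0.quotient_module_copy[OF sub] by blast
    interpret Q': right_module R Q' by (rule Q')
    obtain h where "bij_betw h (carrier Q') (carrier (quotient_module ?Q (C m)))"
      using Q'(2) unfolding module_iso_def by blast
    moreover have "X = \<zero>\<^bsub>quotient_module ?Q (C m)\<^esub>" if "X \<in> carrier (quotient_module ?Q (C m))" for X
      using that Q0.quotient_zero_iff[OF sub] unfolding Q0.quotient_carrier[OF sub] by auto
    ultimately have "x = \<zero>\<^bsub>Q'\<^esub>" if "x \<in> carrier Q'" for x
      using that Q'.M.zero_closed unfolding bij_betw_def by (metis imageI inj_onD)
    then have "krull_class R None Q'" using Q'(1) Q'.M.zero_closed by auto
    then show ?thesis using Q'(2) eq by (intro exI[of _ None] exI[of _ Q']) simp
  qed
  then have "{i. \<not> (\<exists>\<beta> (Q' :: ('a, 'm) module). \<beta> < Some (0::nat) \<and>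
      module_iso R Q' (quotient_module (Q\<lparr>carrier := C i\<rparr>) (C (Suc i))) \<and> krull_class R \<beta> Q')} \<subseteq> {..<n}"
    by (metis (mono_tags, lifting) lessThan_iff linorder_not_le mem_Collect_eq subsetI)
  then show "finite {i. \<not> (\<exists>\<beta> (Q' :: ('a, 'm) module). \<beta> < Some (0::nat) \<and>
      module_iso R Q' (quotient_module (Q\<lparr>carrier := C i\<rparr>) (C (Suc i))) \<and> krull_class R \<beta> Q')}"
    by (rule finite_subset) simp
qed

lemma almost_artinian_krull_class:
  assumes "almost_artinian {\<zero>} (carrier R)"
  shows "krull_class R (Some (1::nat)) (right_regular_module R)"
  unfolding krull_class.simps(2)
proof (intro conjI allI impI)
  let ?M = "right_regular_module R"
  show M: "right_module R ?M" by (rule right_regular_module_is_right_module)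
  interpret M: right_module R ?M by (rule M)
  fix C assume "descending_chain R ?M C"
  then have sub: "\<And>i. submodule (C i) R ?M" and C: "\<And>i. right_ideal R (C i)" "\<And>i. C (Suc i) \<subseteq> C i"
    by (auto simp: descending_chain_def submodule_regular_iff)
  have "chain_between {\<zero>} (carrier R) C"
    unfolding chain_between_def using C right_ideal_zero right_ideal_subset by blast
  then obtain n where n: "\<And>m. m \<ge> n \<Longrightarrow> artinian (C (Suc m)) (C m)"
    using almost_artinianD[OF assms] by blast
  have "\<exists>\<beta> (Q :: ('a, 'a) module). \<beta> < Some (1::nat) \<and>
      module_iso R Q (quotient_module (?M\<lparr>carrier := C m\<rparr>) (C (Suc m))) \<and> krull_class R \<beta> Q"
    if m: "m \<ge> n" for m
  proof -
    let ?Q = "?M\<lparr>carrier := C m\<rparr>"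
    interpret Q0: right_module R ?Q using sub by (rule M.submodule_is_right_module)
    have "submodule (C (Suc m)) R ?Q" using M.submodule_restrict[OF sub sub C(2)] .
    then obtain Q :: "('a, 'a) module" where Q: "right_module R Q" "module_iso R Q (quotient_module ?Q (C (Suc m)))"
      using Q0.quotient_module_copy by blast
    have "\<exists>g. presents Q (C (Suc m)) (C m) g"
      using presents_factor[OF presents_regular C(1) right_ideal_subset[OF C(1)] C(1) _ C(2) Q(1)]
        right_ideal_zero[OF C(1)] Q(2) by auto
    then have "krull_class R (Some (0::nat)) Q" using artinian_krull_class[OF n[OF m]] by blast
    then show ?thesis using Q(2) by (intro exI[of _ "Some 0"] exI[of _ Q]) simp
  qed
  then have "{i. \<not> (\<exists>\<beta> (Q :: ('a, 'a) module). \<beta> < Some (1::nat) \<and>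
      module_iso R Q (quotient_module (?M\<lparr>carrier := C i\<rparr>) (C (Suc i))) \<and> krull_class R \<beta> Q)} \<subseteq> {..<n}"
    by (metis (mono_tags, lifting) lessThan_iff linorder_not_le mem_Collect_eq subsetI)
  then show "finite {i. \<not> (\<exists>\<beta> (Q :: ('a, 'a) module). \<beta> < Some (1::nat) \<and>
      module_iso R Q (quotient_module (?M\<lparr>carrier := C i\<rparr>) (C (Suc i))) \<and> krull_class R \<beta> Q)}"
    by (rule finite_subset) simp
qed

section \<open>The prime radical, the noetherian case and the conclusion\<close>

lemma ideal_prime_radical: "ideal (prime_radical R) R"
proof -
  have P: "ideal P R" if "prime_ideal R P" for P using that by (simp add: prime_ideal_def)
  show ?thesis
  proof (rule idealI'[OF right_idealI])
    show "prime_radical R \<subseteq> carrier R" by (auto simp: prime_radical_def)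
    show "\<zero> \<in> prime_radical R"
      using right_ideal_zero[OF ideal_right_ideal[OF P]] by (simp add: prime_radical_def)
    show "x \<oplus> y \<in> prime_radical R" if "x \<in> prime_radical R" "y \<in> prime_radical R" for x y
      using that right_ideal_add[OF ideal_right_ideal[OF P]] by (simp add: prime_radical_def)
    show "x \<otimes> r \<in> prime_radical R" if "x \<in> prime_radical R" "r \<in> carrier R" for x r
      using that ideal_r[OF P] by (simp add: prime_radical_def)
    show "r \<otimes> x \<in> prime_radical R" if "x \<in> prime_radical R" "r \<in> carrier R" for x r
      using that ideal_l[OF P] by (simp add: prime_radical_def)
  qed
qed

text \<open>The preimages in R of a chain of left ideals of R/Q form a chain of left ideals, and
  each left ideal of R/Q is the image of its preimage.\<close>

lemma left_acc_reg_quotient: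
  assumes acc: "satisfies_acc (left_ideal R)" and Q: "ideal Q R"
  shows "left_acc_reg (R Quot Q)"
  unfolding left_acc_reg_def satisfies_acc_def
proof (intro allI impI)
  interpret Q: ideal Q R by (rule Q)
  let ?S = "R Quot Q"
  interpret S: ring ?S by (rule Q.quotient_is_ring)
  have carS: "carrier ?S = (+>) Q ` carrier R"
    by (auto simp: FactRing_def A_RCOSETS_def')
  have hom: "(Q +> x) \<otimes>\<^bsub>?S\<^esub> (Q +> y) = Q +> (x \<otimes> y)" "(Q +> x) \<oplus>\<^bsub>?S\<^esub> (Q +> y) = Q +> (x \<oplus> y)"
    if "x \<in> carrier R" "y \<in> carrier R" for x y
    using that by (simp_all add: FactRing_def Q.rcoset_mult_add Q.a_rcos_sum)
  have zero: "Q +> \<zero> = \<zero>\<^bsub>?S\<^esub>" using a_rcos_zero[OF Q Q.zero_closed] by (simp add: FactRing_def)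
  fix C :: "nat \<Rightarrow> 'a set set"
  assume C: "\<forall>i. (\<exists>s. regular_element ?S s \<and> C i = {r \<otimes>\<^bsub>?S\<^esub> s | r. r \<in> carrier ?S}) \<and> C i \<subseteq> C (Suc i)"
  have gen: "\<exists>s. s \<in> carrier ?S \<and> C i = {r \<otimes>\<^bsub>?S\<^esub> s | r. r \<in> carrier ?S}" for i
  proof -
    obtain s where "regular_element ?S s" "C i = {r \<otimes>\<^bsub>?S\<^esub> s | r. r \<in> carrier ?S}"
      using C by blast
    then show ?thesis by (intro exI[of _ s]) (simp add: regular_element_def)
  qed
  let ?L = "\<lambda>i. {x \<in> carrier R. Q +> x \<in> C i}"
  have "left_ideal R (?L i)" for i
  proof -
    obtain s where s: "s \<in> carrier ?S" "C i = {r \<otimes>\<^bsub>?S\<^esub> s | r. r \<in> carrier ?S}"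
      using gen by blast
    have C0: "\<zero>\<^bsub>?S\<^esub> \<in> C i"
      unfolding s(2) using S.l_null[OF s(1)] S.zero_closed by (metis (mono_tags, lifting) mem_Collect_eq)
    have Cadd: "x \<oplus>\<^bsub>?S\<^esub> y \<in> C i" if xy: "x \<in> C i" "y \<in> C i" for x y
    proof -
      obtain u where "u \<in> carrier ?S" "x = u \<otimes>\<^bsub>?S\<^esub> s" using xy(1) unfolding s(2) by auto
      moreover obtain v where "v \<in> carrier ?S" "y = v \<otimes>\<^bsub>?S\<^esub> s" using xy(2) unfolding s(2) by auto
      ultimately have "x \<oplus>\<^bsub>?S\<^esub> y = (u \<oplus>\<^bsub>?S\<^esub> v) \<otimes>\<^bsub>?S\<^esub> s" "u \<oplus>\<^bsub>?S\<^esub> v \<in> carrier ?S"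
        using s(1) S.l_distr by auto
      then show ?thesis unfolding s(2) by auto
    qed
    have Cmult: "r \<otimes>\<^bsub>?S\<^esub> x \<in> C i" if rx: "r \<in> carrier ?S" "x \<in> C i" for r x
    proof -
      obtain u where "u \<in> carrier ?S" "x = u \<otimes>\<^bsub>?S\<^esub> s" using rx(2) unfolding s(2) by auto
      then have "r \<otimes>\<^bsub>?S\<^esub> x = (r \<otimes>\<^bsub>?S\<^esub> u) \<otimes>\<^bsub>?S\<^esub> s" "r \<otimes>\<^bsub>?S\<^esub> u \<in> carrier ?S"
        using s(1) rx S.m_assoc by auto
      then show ?thesis unfolding s(2) by auto
    qed
    have Lmult: "r \<otimes> x \<in> ?L i" if "r \<in> carrier R" "x \<in> ?L i" for r x
      using that hom(1)[of r x] Cmult[of "Q +> r" "Q +> x"] carS by auto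
    have Ladd: "x \<oplus> y \<in> ?L i" if "x \<in> ?L i" "y \<in> ?L i" for x y
      using that hom(2)[of x y] Cadd[of "Q +> x" "Q +> y"] by simp
    have Luminus: "\<ominus> x \<in> ?L i" if "x \<in> ?L i" for x
      using Lmult[of "\<ominus> \<one>" x] that by (simp add: l_minus)
    have "\<zero> \<in> ?L i" using zero C0 by simp
    then have "subgroup (?L i) (add_monoid R)"
      using Ladd Luminus by (intro add.subgroupI) (auto simp: a_inv_def)
    then show ?thesis using Lmult by (auto simp: left_ideal_def intro: additive_subgroup.intro)
  qed
  moreover have "?L i \<subseteq> ?L (Suc i)" for i using C by blast
  ultimately have "\<forall>i. left_ideal R (?L i) \<and> ?L i \<subseteq> ?L (Suc i)" by blast
  then have "\<exists>n. \<forall>m\<ge>n. ?L m = ?L n"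
    by (rule acc[unfolded satisfies_acc_def, THEN spec, THEN mp])
  then obtain n where n: "\<And>m. m \<ge> n \<Longrightarrow> ?L m = ?L n" by blast
  have "C i = (+>) Q ` ?L i" for i
  proof -
    have "C i \<subseteq> carrier ?S" using gen[of i] by auto
    then show ?thesis unfolding carS by blast
  qed
  then have "C m = C n" if "m \<ge> n" for m using n[OF that] by metis
  then show "\<exists>n. \<forall>m\<ge>n. C m = C n" by blast
qed

lemma right_krull_dim_le_one:
  assumes principal: "\<And>I. maximal_right_ideal R I \<Longrightarrow> principal_right_ideal R I"
    and dev: "has_deviation R"
    and acc: "left_acc_reg (R Quot prime_radical R) \<or>
      (\<forall>P. minimal_prime_ideal R P \<longrightarrow> left_acc_reg (R Quot P))"
  shows "krull_class R (Some (1::nat)) (right_regular_module R)"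
proof -
  let ?N = "prime_radical R"
  have N: "?N \<subseteq> P" if "prime_ideal R P" for P using that by (auto simp: prime_radical_def)
  interpret deviation_ring R by unfold_locales (rule dev)
  have semiprime: "a \<in> ?N"
    if a: "a \<in> carrier R" "\<And>r. r \<in> carrier R \<Longrightarrow> a \<otimes> r \<otimes> a \<in> ?N" for a
  proof -
    have "a \<in> P" if P: "prime_ideal R P" for P
      using prime_idealD'[OF P a(1) a(1)] a(2) N[OF P] by blast
    then show ?thesis using a(1) by (simp add: prime_radical_def)
  qed
  interpret semiprime_mod R ?N
    by (intro semiprime_mod.intro deviation_ring_axioms semiprime_mod_axioms.intro
        ideal_prime_radical) (rule semiprime)
  interpret principal_mod R ?N
    by (intro principal_mod.intro semiprime_mod_axioms principal_mod_axioms.intro principal)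
  interpret factoring_mod R ?N
  proof (intro factoring_mod.intro principal_mod_axioms factoring_mod_axioms.intro)
    fix E assume "essential_over ?N E"
    then show "\<exists>c\<in>factored. c \<in> E"
      using essential_contains_factored[OF _ N acc] by blast
  qed
  show ?thesis by (rule almost_artinian_krull_class[OF almost_artinian_ring[OF N]])
qed

end

theorem corollary7p6:
  fixes R :: "('a, 'b) ring_scheme"
  assumes "ring R"
    and "\<forall>I. maximal_right_ideal R I \<longrightarrow> principal_right_ideal R I"
  shows "(has_right_krull_dim TYPE('o::wellorder) R \<and>
            (left_acc_reg (R Quot prime_radical R) \<or>
             (\<forall>P. minimal_prime_ideal R P \<longrightarrow> left_acc_reg (R Quot P))) \<longrightarrow>
          has_right_krull_dim TYPE(nat) R \<and> right_krull_dim R \<le> Some (1 :: nat))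
       \<and> (left_right_noetherian R \<longrightarrow>
          has_right_krull_dim TYPE(nat) R \<and> right_krull_dim R \<le> Some (1 :: nat))"
proof -
  interpret ring R by fact
  have result: "has_right_krull_dim TYPE(nat) R \<and> right_krull_dim R \<le> Some (1 :: nat)"
    if "has_deviation R" "left_acc_reg (R Quot prime_radical R) \<or>
      (\<forall>P. minimal_prime_ideal R P \<longrightarrow> left_acc_reg (R Quot P))"
  proof -
    have K: "krull_class R (Some (1::nat)) (right_regular_module R)"
      using right_krull_dim_le_one assms(2) that by blast
    then have "has_right_krull_dim TYPE(nat) R"
      unfolding has_right_krull_dim_def has_krull_dim_def by blast
    moreover have "right_krull_dim R \<le> Some (1 :: nat)"
      unfolding right_krull_dim_def krull_dim_def by (rule Least_le) (rule K)
    ultimately show ?thesis by blast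
  qed
  \<comment> \<open>The noetherian case falls under condition (A): the left chain condition passes
    to R/N, and the right one excludes dense families of right ideals.\<close>
  have "left_acc_reg (R Quot prime_radical R)" "has_deviation R" if "left_right_noetherian R"
    using that left_acc_reg_quotient[OF _ ideal_prime_radical] noetherian_has_deviation
    by (auto simp: left_right_noetherian_def)
  then show ?thesis using result krull_dim_has_deviation by blast
qed

end
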